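(* Let $\chi\in C^3(\mathbb{R}^3)$, $f,g\in L^2(S)$, and let the positive integer $N$ be chosen such that $$ \lambda:=\left(\frac{1+\tilde\kappa^2}{\delta N^2}\right)^{1/2}<1 ,\qquad \tilde\kappa=\sqrt\delta\,\kappa . $$ Then for any integer $m$ with $0<m<q$ the approximation error of the truncated Fourier series is bounded by $$ \left|\langle f,(\mathcal{A}-\mathcal{A}_N)g\rangle\right|\le c\left(m^2N^{3/2}\lambda^m+N^{-1/2}\right)\|f\|_{L^2(S)}\,\|g\|_{L^2(S)}, $$ where the constant $c$ is independent of $\kappa,\delta,N,m,f,g$ (it may depend on $S$, $\chi$, the filter $H$ and the fixed constants $\kappa_0,\gamma,\theta$ in the standing assumptions).
   Context: Geometry: $S=\partial D$ is the smooth boundary surface of a bounded obstacle $D\subset\mathbb{R}^3$, scaled so that $S\subset[0,1-d]^3$ with a constant $0<d<1$. $\langle f,u\rangle=\int_S f(x)u(x)\,dS_x$. Filter: $q\ge1$ is an integer and $H(z)=\sum_{k=1}^q\frac{c_k}{z+w_k^2}$ is a rational function with real nonzero $w_k$ (repeated poles, as in $H(z)=(1+z)^{-q}$, are also admitted), with $H(0)=1$ and $|H(z)|\le C_H\min(1,z^{-q})$ for $z>0$. Standing assumptions on the parameters (wave number $\kappa\to\infty$, mollification parameter $\delta\sim\kappa^{-2}$): there are fixed constants $\kappa_0>0$, $\gamma>0$, $0<\theta<1$ with $\kappa\ge\kappa_0$ and $\gamma\le\delta\kappa^2\le\theta\min_kw_k^2$. Mollified Helmholtz kernel: for $r\in\mathbb{R}^3$,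 $$ G_\delta(r)=\frac{1}{2\pi^2}\int_0^\infty H\big(\delta(\rho^2-\kappa^2)\big)\,\frac{\rho^2}{\rho^2-\kappa^2}\,j_0(\rho\|r\|)\,d\rho,\qquad j_0(z)=\frac{\sin z}{z}, $$ where the path of integration avoids $\rho=\kappa$ by passing below it in the lower complex half-plane. Cut-off: $\chi$ equals $1$ on $[-1+d,1-d]^3$ and vanishes outside $[-1,1]^3$; $G^S:=\chi G_\delta$. Its Fourier coefficients are $\hat G_k=\frac18\int_{[-1,1]^3}\exp(-\pi i\,k\cdot r)\,G^S(r)\,d^3r$, $k\in\mathbb{Z}^3$, and the truncated Fourier series is $G_N(r)=\sum_{\|k\|_\infty\le N}\hat G_k\exp(\pi i\,k\cdot r)$. Operators: $\mathcal{A}g(x)=\int_SG^S(x-y)g(y)\,dS_y$ and $\mathcal{A}_Ng(x)=\int_SG_N(x-y)g(y)\,dS_y$ for $x\in S$. *)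

theory Defs
  imports "HOL-Analysis.Analysis" "HOL-Complex_Analysis.Contour_Integration"
begin

section \<open>Functions of class C^n\<close>

text \<open>Meaningful for open \<open>U\<close>. The directional derivatives along the canonical basis are the
  partial derivatives.\<close>

fun C_n_on :: "nat \<Rightarrow> ('a::euclidean_space \<Rightarrow> real) \<Rightarrow> 'a set \<Rightarrow> bool" where
  "C_n_on 0 f U \<longleftrightarrow> continuous_on U f"
| "C_n_on (Suc n) f U \<longleftrightarrow>
     (\<forall>x\<in>U. f differentiable (at x)) \<and>
     (\<forall>b\<in>Basis. C_n_on n (\<lambda>x. frechet_derivative f (at x) b) U)"

section \<open>The obstacle and its boundary surface\<close>

text \<open>Near each boundary point, \<open>D\<close> is the strict sublevel set of a C-infinity function
  without critical points, so that the boundary is its zero set, an embedded smooth surface.\<close>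

definition smooth_boundary :: "(real^3) set \<Rightarrow> bool" where
  "smooth_boundary D \<longleftrightarrow>
     (\<forall>x\<in>frontier D. \<exists>U \<phi>. open U \<and> x \<in> U \<and> (\<forall>n. C_n_on n \<phi> U) \<and>
        (\<forall>y\<in>U. \<exists>h. frechet_derivative \<phi> (at y) h \<noteq> 0) \<and>
        D \<inter> U = {y \<in> U. \<phi> y < 0})"

text \<open>The surface element is two-dimensional Hausdorff measure. The factor \<open>pi / 4\<close> (area of the
  disc of diameter 1) makes it agree with the area element \<open>|\<partial>\<^sub>1X \<times> \<partial>\<^sub>2X| du\<close> of a regular
  parametrisation \<open>X\<close>.\<close>

definition hausdorff2_content :: "real \<Rightarrow> (real^3) set \<Rightarrow> ennreal" where
  "hausdorff2_content \<epsilon> A =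
     (INF C \<in> {C :: nat \<Rightarrow> (real^3) set.
                 A \<subseteq> (\<Union>i. C i) \<and> (\<forall>i. bounded (C i) \<and> diameter (C i) \<le> \<epsilon>)}.
        \<Sum>i. ennreal (pi / 4 * (diameter (C i))\<^sup>2))"

definition hausdorff2_outer :: "(real^3) set \<Rightarrow> ennreal" where
  "hausdorff2_outer A = (SUP \<epsilon> \<in> {0<..}. hausdorff2_content \<epsilon> A)"

text \<open>As a metric outer measure, \<^const>\<open>hausdorff2_outer\<close> is countably additive on Borel
  sets, so \<^const>\<open>measure_of\<close> does not degenerate here.\<close>

definition surface_measure :: "(real^3) set \<Rightarrow> (real^3) measure" where
  "surface_measure S = restrict_space (measure_of UNIV (sets borel) hausdorff2_outer) S"

definition L2_on :: "(real^3) set \<Rightarrow> (real^3 \<Rightarrow> complex) \<Rightarrow> bool" where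
  "L2_on S f \<longleftrightarrow> f \<in> borel_measurable (surface_measure S) \<and>
     integrable (surface_measure S) (\<lambda>x. (cmod (f x))\<^sup>2)"

definition L2_norm_on :: "(real^3) set \<Rightarrow> (real^3 \<Rightarrow> complex) \<Rightarrow> real" where
  "L2_norm_on S f = sqrt (LINT x|surface_measure S. (cmod (f x))\<^sup>2)"

text \<open>Bilinear pairing, without complex conjugation.\<close>

definition pairing :: "(real^3) set \<Rightarrow> (real^3 \<Rightarrow> complex) \<Rightarrow> (real^3 \<Rightarrow> complex) \<Rightarrow> complex" where
  "pairing S f u = (LINT x|surface_measure S. f x * u x)"

section \<open>The filter and the mollified kernel\<close>

text \<open>Partial fractions with \<open>q\<close> poles counted with multiplicity: the exponent is the
  number of occurrences of the pole \<open>- (w k)\<^sup>2\<close> among the first \<open>k\<close> poles. It is 1 throughout when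
  the poles are distinct, while for \<open>w\<^sub>1 = \<dots> = w\<^sub>q\<close> it is \<open>k\<close>, which covers
  \<open>H(z) = (1 + z)\<^sup>-\<^sup>q\<close>.\<close>

definition rational_filter :: "nat \<Rightarrow> (nat \<Rightarrow> complex) \<Rightarrow> (nat \<Rightarrow> real) \<Rightarrow> complex \<Rightarrow> complex" where
  "rational_filter q a w z =
     (\<Sum>k=1..q. a k / (z + of_real ((w k)\<^sup>2)) ^ card {j \<in> {1..k}. (w j)\<^sup>2 = (w k)\<^sup>2})"

definition j0 :: "complex \<Rightarrow> complex" where
  "j0 z = (if z = 0 then 1 else sin z / z)"

definition kernel_integrand ::
    "(complex \<Rightarrow> complex) \<Rightarrow> real \<Rightarrow> real \<Rightarrow> real^3 \<Rightarrow> complex \<Rightarrow> complex" where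
  "kernel_integrand H \<delta> \<kappa> r \<rho> =
     H (of_real \<delta> * (\<rho>\<^sup>2 - (of_real \<kappa>)\<^sup>2)) * (\<rho>\<^sup>2 / (\<rho>\<^sup>2 - (of_real \<kappa>)\<^sup>2)) * j0 (\<rho> * of_real (norm r))"

text \<open>The path from 0 to infinity follows the real axis except for the lower semicircle
  about \<open>\<kappa>\<close> from \<open>\<kappa>/2\<close> to \<open>3\<kappa>/2\<close>. When \<open>\<delta>\<kappa>\<^sup>2 < (w k)\<^sup>2\<close> for all \<open>k\<close>, the poles stemming from
  \<open>H\<close> are purely imaginary, so by Cauchy's theorem the choice of the indentation in the lower
  right quadrant does not matter.\<close>

definition mollified_kernel ::
    "(complex \<Rightarrow> complex) \<Rightarrow> real \<Rightarrow> real \<Rightarrow> real^3 \<Rightarrow> complex" where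
  "mollified_kernel H \<delta> \<kappa> r = 1 / (2 * (of_real pi)\<^sup>2) *
     ((LINT \<rho>:{0..\<kappa>/2}|lborel. kernel_integrand H \<delta> \<kappa> r (of_real \<rho>)) +
      contour_integral (part_circlepath (of_real \<kappa>) (\<kappa>/2) pi (2*pi)) (kernel_integrand H \<delta> \<kappa> r) +
      (LINT \<rho>:{3*\<kappa>/2..}|lborel. kernel_integrand H \<delta> \<kappa> r (of_real \<rho>)))"

definition cutoff_kernel ::
    "(real^3 \<Rightarrow> real) \<Rightarrow> (complex \<Rightarrow> complex) \<Rightarrow> real \<Rightarrow> real \<Rightarrow> real^3 \<Rightarrow> complex" where
  "cutoff_kernel chi H \<delta> \<kappa> r = of_real (chi r) * mollified_kernel H \<delta> \<kappa> r"

section \<open>Truncated Fourier series and integral operators\<close>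

definition freq_dot :: "int^3 \<Rightarrow> real^3 \<Rightarrow> real" where
  "freq_dot k r = (\<Sum>i\<in>UNIV. of_int (k $ i) * r $ i)"

definition fourier_coeff :: "(real^3 \<Rightarrow> complex) \<Rightarrow> int^3 \<Rightarrow> complex" where
  "fourier_coeff F k = 1 / 8 *
     (LINT r:cbox (vec (-1)) (vec 1)|lborel. exp (- (of_real pi * \<i> * of_real (freq_dot k r))) * F r)"

definition fourier_truncation :: "nat \<Rightarrow> (real^3 \<Rightarrow> complex) \<Rightarrow> real^3 \<Rightarrow> complex" where
  "fourier_truncation N F r =
     (\<Sum>k\<in>{k :: int^3. \<forall>i. \<bar>k $ i\<bar> \<le> int N}.
        fourier_coeff F k * exp (of_real pi * \<i> * of_real (freq_dot k r)))"

definition surface_operator ::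
    "(real^3) set \<Rightarrow> (real^3 \<Rightarrow> complex) \<Rightarrow> (real^3 \<Rightarrow> complex) \<Rightarrow> real^3 \<Rightarrow> complex" where
  "surface_operator S K g x = (LINT y|surface_measure S. K (x - y) * g y)"

definition truncation_ratio :: "real \<Rightarrow> real \<Rightarrow> nat \<Rightarrow> real" where
  "truncation_ratio \<delta> \<kappa> N = sqrt ((1 + (sqrt \<delta> * \<kappa>)\<^sup>2) / (\<delta> * (real N)\<^sup>2))"

end

theory Submission
  imports Defs "HOL-Complex_Analysis.Cauchy_Integral_Theorem"
begin

text \<open>
  Any two points of \<open>S\<close> differ by a vector in the interior of the cube and \<open>S\<close> has finite area, so
  it is enough to bound \<open>G\<^sup>S - G\<^sub>N\<close> uniformly there. In the integral defining \<open>G\<^sub>\<delta>\<close> the indentation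
  is shrunk to a fixed radius by Cauchy's theorem. Put \<open>t = \<kappa> / N\<close>, which is at most \<open>\<lambda>\<close>.

  For \<open>|\<rho>| \<le> 2 N\<close>, the function \<open>j\<^sub>0 (\<rho> |r|)\<close> is the average of the plane waves
  \<open>exp (i \<rho> \<omega> \<bullet> r)\<close> over the unit sphere. Three integrations by parts against the cut-off and Bessel's
  inequality show that the frequencies beyond \<open>N\<close> of the cut-off times a plane wave contribute at most
  \<open>O (N powr (-3/2))\<close>. The weight in front of \<open>j\<^sub>0\<close> has integral \<open>O (N + \<kappa> ln N)\<close>, and the resulting
  \<open>t N powr (-1/2) ln N\<close> is absorbed by \<open>N powr (3/2) t ^ (q - 1) + N powr (-1/2)\<close>.

  For \<open>\<rho> > 2 N\<close> the filter makes the weight \<open>O ((\<kappa> / \<rho>) ^ (2 q))\<close>. With \<open>|j\<^sub>0 (z)| \<le> min 1 (1 / |z|)\<close> this part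
  of the kernel has sup norm \<open>O (N t ^ (2 q))\<close> and \<open>L\<^sup>2\<close> norm \<open>O (t ^ (2 q))\<close>, and its truncated series is at
  most \<open>(2 N + 1) powr (3/2)\<close> times the \<open>L\<^sup>2\<close> norm.
\<close>

section \<open>Fourier series on the cube\<close>

text \<open>The estimate is proved with the exponent \<open>q - 1\<close>; since \<lambda> < 1, it
  implies the one for every smaller \<open>m\<close>. A plane wave only shifts frequencies, so all
  three derivatives fall on the fixed cut-off. The rate comes from the sum of |k| ^ -6 over |k| > N,
  which is O (N ^ -3) in dimension three and enters through its square root by Cauchy-Schwarz. Above
  2 N a wave may resonate with a retained or discarded mode, so only the decay of the filter is used
  there. The factor \<kappa> ln N is the trace of the simple pole at \<rho> = \<kappa>, approached
  up to a distance that does not depend on \<kappa>. Convergence of the Fourier series is not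
  presupposed: a continuous function is shown to be bounded in the open cube by the sum of the
  moduli of its coefficients.\<close>

definition cube :: "(real^3) set" where "cube = cbox (vec (-1)) (vec 1)"

section \<open>Fourier modes and their orthogonality\<close>

definition fmode :: "int^3 \<Rightarrow> real^3 \<Rightarrow> complex" where
  "fmode k r = exp (of_real pi * \<i> * of_real (freq_dot k r))"

lemma freq_dot_simps:
  "freq_dot (k + l) r = freq_dot k r + freq_dot l r"
  "freq_dot (- k) r = - freq_dot k r"
  "freq_dot 0 r = 0"
  "freq_dot k (r - x) = freq_dot k r - freq_dot k x"
  by (auto simp: freq_dot_def algebra_simps sum.distrib sum_negf sum_subtractf)

lemma fmode_add: "fmode (k + l) r = fmode k r * fmode l r"
  by (simp add: fmode_def freq_dot_simps exp_add[symmetric] algebra_simps)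

lemma fmode_0 [simp]: "fmode 0 r = 1"
  by (simp add: fmode_def freq_dot_simps)

lemma fmode_minus: "fmode (- k) r = cnj (fmode k r)"
  by (simp add: fmode_def freq_dot_simps exp_cnj)

lemma norm_fmode [simp]: "norm (fmode k r) = 1"
proof -
  have "fmode k r = exp (\<i> * of_real (pi * freq_dot k r))"
    by (simp add: fmode_def algebra_simps)
  then show ?thesis by (metis norm_exp_i_times)
qed

lemma continuous_on_fmode [continuous_intros]:
  "continuous_on A f \<Longrightarrow> continuous_on A (\<lambda>x. fmode k (f x))"
  unfolding fmode_def freq_dot_def by (intro continuous_intros)

lemma measurable_fmode [measurable]: "fmode k \<in> borel_measurable borel"
  by (intro borel_measurable_continuous_onI continuous_intros)

text \<open>\<open>lborel\<close> is the image of the product measure on coordinate functions, so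
  Fubini on the product splits the integral into one-dimensional factors.\<close>

lemma lborel_integral_prod_Basis:
  fixes f :: "'a::euclidean_space \<Rightarrow> real \<Rightarrow> complex"
  assumes "\<And>b. b \<in> Basis \<Longrightarrow> integrable lborel (f b)"
  shows "(LINT x|lborel. (\<Prod>b\<in>Basis. f b (x \<bullet> b))) = (\<Prod>b\<in>Basis. LINT t|lborel. f b t)"
proof -
  interpret product_sigma_finite "\<lambda>_::'a. lborel :: real measure"
    by (simp add: lborel.sigma_finite_measure_axioms product_sigma_finite_def)
  have [measurable]: "\<And>b. b \<in> Basis \<Longrightarrow> f b \<in> borel_measurable borel"
    using assms by (auto dest: borel_measurable_integrable)
  have "(LINT x|lborel. (\<Prod>b\<in>Basis. f b (x \<bullet> b))) =
      (LINT x|distr (\<Pi>\<^sub>M b\<in>Basis. lborel) borel (\<lambda>g. \<Sum>b\<in>Basis. g b *\<^sub>R b). (\<Prod>b\<in>Basis. f b ((x::'a) \<bullet> b)))"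
    by (subst lborel_eq) simp
  also have "\<dots> = (LINT g|(\<Pi>\<^sub>M b\<in>Basis. lborel). (\<Prod>b\<in>Basis. f b ((\<Sum>c\<in>Basis. g c *\<^sub>R c) \<bullet> (b::'a))))"
    by (intro integral_distr) measurable
  also have "\<dots> = (LINT g|(\<Pi>\<^sub>M b\<in>(Basis::'a set). lborel). (\<Prod>b\<in>Basis. f b (g b)))"
    by (intro Bochner_Integration.integral_cong prod.cong) (auto simp: inner_sum_left inner_Basis if_distrib cong: if_cong)
  also have "\<dots> = (\<Prod>b\<in>Basis. LINT t|lborel. f b t)"
    by (rule product_integral_prod) (use assms in auto)
  finally show ?thesis .
qed

lemma integral_exp_interval:
  fixes n :: int
  shows "(LINT t:{-1..1}|lborel. exp (of_real pi * \<i> * of_real (of_int n * t))) = (if n = 0 then 2 else 0)"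
proof (cases "n = 0")
  case True
  then show ?thesis by (simp add: set_lebesgue_integral_def scaleR_conv_of_real)
next
  case False
  let ?c = "of_real pi * \<i> * of_int n :: complex"
  have c: "?c \<noteq> 0" using False by simp
  have "(LINT t:{-1..1}|lborel. exp (of_real pi * \<i> * of_real (of_int n * t))) =
     integral {-1..1} (\<lambda>t. exp (of_real pi * \<i> * of_real (of_int n * t)))"
    by (intro set_borel_integral_eq_integral borel_integrable_atLeastAtMost')
       (intro continuous_intros)
  also have "((\<lambda>t. exp (?c * of_real t)) has_integral
     exp (?c * of_real 1) / ?c - exp (?c * of_real (-1)) / ?c) {-1..1}"
  proof (rule fundamental_theorem_of_calculus)
    fix t :: real
    have "((\<lambda>z. exp (?c * z) / ?c) has_field_derivative exp (?c * of_real t)) (at (of_real t))"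
      using c by (auto intro!: derivative_eq_intros)
    then show "((\<lambda>t. exp (?c * of_real t) / ?c) has_vector_derivative exp (?c * of_real t)) (at t within {-1..1})"
      by (rule has_vector_derivative_real_field)
  qed simp
  then have "integral {-1..1} (\<lambda>t. exp (of_real pi * \<i> * of_real (of_int n * t))) =
     exp (?c * of_real 1) / ?c - exp (?c * of_real (-1)) / ?c"
    by (simp only: of_real_mult of_real_of_int_eq mult.assoc[symmetric]) (rule integral_unique)
  \<comment> \<open>The endpoints are one full period 2 apart, so the antiderivative takes the same
    value at both.\<close>
  also have "exp (?c * of_real 1) = exp (?c * of_real (-1)) * exp (of_int (2 * n) * pi * \<i>)"
    unfolding exp_add[symmetric] by (rule arg_cong[of _ _ exp]) (simp add: algebra_simps)
  also have "exp (of_int (2 * n) * pi * \<i>) = 1"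
    by (subst exp_eq_1) (auto intro!: exI[of _ n])
  finally have "(LINT t:{-1..1}|lborel. exp (of_real pi * \<i> * of_real (of_int n * t))) =
      exp (?c * of_real (-1)) * 1 / ?c - exp (?c * of_real (-1)) / ?c" .
  then show ?thesis using False by (simp only: mult_1_right diff_self if_False)
qed

lemma Basis_vec_eq: "(Basis :: (real^3) set) = range (\<lambda>i. axis i 1)"
  by (auto simp: Basis_vec_def)

lemma prod_Basis_vec: "(\<Prod>b\<in>(Basis::(real^3) set). f b) = (\<Prod>i\<in>UNIV. f (axis i 1))"
  unfolding Basis_vec_eq by (subst prod.reindex) (auto simp: inj_on_def axis_eq_axis)

lemma mem_cube_iff: "r \<in> cube \<longleftrightarrow> (\<forall>i. r $ i \<in> {-1..1})"
  by (auto simp: mem_box_cart cube_def)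

lemma integral_fmode_cube: "(LINT r:cube|lborel. fmode k r) = (if k = 0 then 8 else 0)"
proof -
  \<comment> \<open>The factor is defined for an arbitrary vector \<open>b\<close> because the
    product formula ranges over \<open>Basis\<close>; at \<open>b = axis i 1\<close> the inner sum
    collapses to \<open>k $ i\<close>.\<close>
  define f :: "real^3 \<Rightarrow> real \<Rightarrow> complex" where
    "f b t = indicator {-1..1} t *\<^sub>R exp (of_real pi * \<i> * of_real ((\<Sum>i\<in>UNIV. of_int (k $ i) * b $ i) * t))" for b t
  have f: "f (axis i 1) t = indicator {-1..1} t *\<^sub>R exp (of_real pi * \<i> * of_real (of_int (k $ i) * t))" for i t
    unfolding f_def by (simp add: axis_def if_distrib cong: if_cong)
  have "(LINT r:cube|lborel. fmode k r) = (LINT r|lborel. (\<Prod>b\<in>Basis. f b (r \<bullet> b)))"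
    unfolding set_lebesgue_integral_def
  proof (intro Bochner_Integration.integral_cong refl)
    fix r :: "real^3"
    have "(\<Prod>b\<in>Basis. f b (r \<bullet> b)) = (\<Prod>i\<in>UNIV. indicator {-1..1} (r $ i) *\<^sub>R exp (of_real pi * \<i> * of_real (of_int (k $ i) * r $ i)))"
      by (subst prod_Basis_vec) (simp add: f inner_axis)
    also have "\<dots> = (\<Prod>i\<in>UNIV. of_real (indicator {-1..1} (r $ i))) * (\<Prod>i\<in>UNIV. exp (of_real pi * \<i> * of_real (of_int (k $ i) * r $ i)))"
      by (simp add: prod.distrib[symmetric] scaleR_conv_of_real)
    also have "(\<Prod>i\<in>UNIV. of_real (indicator {-1..1} (r $ i))) = (of_real (indicator cube r) :: complex)"
      by (cases "r \<in> cube") (auto simp: indicator_def mem_cube_iff intro!: prod.neutral prod_zero)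
    also have "(\<Prod>i\<in>UNIV. exp (of_real pi * \<i> * of_real (of_int (k $ i) * r $ i))) = fmode k r"
      by (simp add: exp_sum[symmetric] fmode_def freq_dot_def sum_distrib_left)
    finally show "indicator cube r *\<^sub>R fmode k r = (\<Prod>b\<in>Basis. f b (r \<bullet> b))"
      by (simp add: scaleR_conv_of_real)
  qed
  also have "\<dots> = (\<Prod>b\<in>Basis. LINT t|lborel. f b t)"
  proof (rule lborel_integral_prod_Basis)
    fix b :: "real^3"
    show "integrable lborel (f b)"
      unfolding f_def set_integrable_def[symmetric]
      by (intro borel_integrable_atLeastAtMost') (intro continuous_intros)
  qed
  also have "\<dots> = (\<Prod>i\<in>UNIV. if k $ i = 0 then 2 else 0)"
  proof (subst prod_Basis_vec, intro prod.cong refl)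
    fix i :: 3
    have "f (axis i 1) = (\<lambda>t. indicator {-1..1} t *\<^sub>R exp (of_real pi * \<i> * of_real (of_int (k $ i) * t)))"
      by (rule ext) (rule f)
    then show "integral\<^sup>L lborel (f (axis i 1)) = (if k $ i = 0 then 2 else 0)"
      using integral_exp_interval[of "k $ i"] by (simp only: set_lebesgue_integral_def)
  qed
  also have "\<dots> = (if k = 0 then 8 else 0)"
    by (cases "k = 0") (auto simp: vec_eq_iff prod_3 intro!: prod_zero)
  finally show ?thesis .
qed

text \<open>A class large enough for the far part of the kernel, which is only shown to be
  measurable and bounded, and closed under the algebra below, so that integrability over the cube
  never has to be argued separately.\<close>

definition cube_bounded :: "(real^3 \<Rightarrow> complex) \<Rightarrow> bool" where
  "cube_bounded F \<longleftrightarrow> F \<in> borel_measurable borel \<and> (\<exists>K. \<forall>r\<in>cube. cmod (F r) \<le> K)"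

lemma cube_boundedI:
  "F \<in> borel_measurable borel \<Longrightarrow> (\<And>r. r \<in> cube \<Longrightarrow> cmod (F r) \<le> K) \<Longrightarrow> cube_bounded F"
  by (auto simp: cube_bounded_def)

lemma cube_bounded_measurable [measurable_dest]: "cube_bounded F \<Longrightarrow> F \<in> borel_measurable borel"
  by (auto simp: cube_bounded_def)

lemma cube_bounded_continuous: "continuous_on UNIV F \<Longrightarrow> cube_bounded F"
  unfolding cube_bounded_def
proof
  assume F: "continuous_on UNIV F"
  then have "bounded (F ` cube)"
    unfolding cube_def
    by (intro compact_imp_bounded compact_continuous_image compact_cbox) (rule continuous_on_subset, auto)
  then show "\<exists>K. \<forall>r\<in>cube. cmod (F r) \<le> K" by (auto simp: bounded_iff)
qed (rule borel_measurable_continuous_onI)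

lemma cube_bounded_mult: "cube_bounded F \<Longrightarrow> cube_bounded G \<Longrightarrow> cube_bounded (\<lambda>r. F r * G r)"
  unfolding cube_bounded_def
proof (elim conjE exE, intro conjI)
  fix K L assume K: "\<forall>r\<in>cube. cmod (F r) \<le> K" and L: "\<forall>r\<in>cube. cmod (G r) \<le> L"
  have "cmod (F r * G r) \<le> K * L" if "r \<in> cube" for r
  proof -
    from K L that have "cmod (F r) \<le> K" "cmod (G r) \<le> L" by auto
    then show ?thesis unfolding norm_mult by (meson mult_mono norm_ge_zero order_trans)
  qed
  then show "\<exists>K. \<forall>r\<in>cube. cmod (F r * G r) \<le> K" by blast
qed auto

lemma cube_bounded_add: "cube_bounded F \<Longrightarrow> cube_bounded G \<Longrightarrow> cube_bounded (\<lambda>r. F r + G r)"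
  unfolding cube_bounded_def
proof (elim conjE exE, intro conjI)
  fix K L assume "\<forall>r\<in>cube. cmod (F r) \<le> K" "\<forall>r\<in>cube. cmod (G r) \<le> L"
  then show "\<exists>K. \<forall>r\<in>cube. cmod (F r + G r) \<le> K"
    by (intro exI[of _ "K + L"]) (auto intro: norm_triangle_le add_mono)
qed auto

lemma cube_bounded_cnj: "cube_bounded F \<Longrightarrow> cube_bounded (\<lambda>r. cnj (F r))"
  unfolding cube_bounded_def
  by (auto intro: borel_measurable_continuous_on[of cnj] continuous_intros)

lemma cube_bounded_const: "cube_bounded (\<lambda>r. c)" and cube_bounded_fmode: "cube_bounded (fmode k)"
  by (intro cube_bounded_continuous continuous_intros)+

lemma cube_bounded_sum: "(\<And>k. k \<in> A \<Longrightarrow> cube_bounded (F k)) \<Longrightarrow> cube_bounded (\<lambda>r. \<Sum>k\<in>A. F k r)"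
  by (induction A rule: infinite_finite_induct) (auto intro: cube_bounded_const cube_bounded_add)

lemma cube_bounded_uminus: "cube_bounded F \<Longrightarrow> cube_bounded (\<lambda>r. - F r)"
  unfolding cube_bounded_def by auto

lemma cube_bounded_diff: "cube_bounded F \<Longrightarrow> cube_bounded G \<Longrightarrow> cube_bounded (\<lambda>r. F r - G r)"
  using cube_bounded_add[OF _ cube_bounded_uminus[of G]] by simp

lemmas cube_bounded_intros = cube_bounded_mult cube_bounded_add cube_bounded_cnj cube_bounded_const
  cube_bounded_fmode cube_bounded_sum cube_bounded_diff cube_bounded_uminus

lemma emeasure_cube: "emeasure lborel cube = 8"
proof -
  have "emeasure lborel cube = (\<Prod>b\<in>Basis. (vec 1 - vec (-1) :: real^3) \<bullet> b)"
    unfolding cube_def by (rule emeasure_lborel_cbox) (auto simp: Basis_vec_eq inner_axis)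
  also have "(\<Prod>b\<in>Basis. (vec 1 - vec (-1) :: real^3) \<bullet> b) = 8"
    by (subst prod_Basis_vec) (simp add: inner_axis)
  finally show ?thesis by simp
qed

lemma sets_cube [measurable]: "cube \<in> sets borel"
  by (simp add: cube_def)

lemma measure_cube: "measure lborel cube = 8"
  by (simp add: measure_def emeasure_cube)

lemma cube_bounded_integrable: assumes "cube_bounded F" shows "set_integrable lborel cube F"
proof -
  from assms obtain K where K: "\<And>r. r \<in> cube \<Longrightarrow> cmod (F r) \<le> K" and [measurable]: "F \<in> borel_measurable borel"
    by (auto simp: cube_bounded_def)
  show ?thesis
    unfolding set_integrable_def
    by (rule integrableI_bounded_set_indicator[of _ _ _ K])
       (use K in \<open>auto simp: emeasure_cube\<close>)
qed

abbreviation cint :: "(real^3 \<Rightarrow> complex) \<Rightarrow> complex" where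
  "cint F \<equiv> LINT r:cube|lborel. F r"

lemma cint_add: "cube_bounded F \<Longrightarrow> cube_bounded G \<Longrightarrow> cint (\<lambda>r. F r + G r) = cint F + cint G"
  by (intro set_integral_add cube_bounded_integrable)

lemma cint_diff: "cube_bounded F \<Longrightarrow> cube_bounded G \<Longrightarrow> cint (\<lambda>r. F r - G r) = cint F - cint G"
  by (intro set_integral_diff cube_bounded_integrable)

lemma cint_sum: "(\<And>k. k \<in> A \<Longrightarrow> cube_bounded (F k)) \<Longrightarrow> cint (\<lambda>r. \<Sum>k\<in>A. F k r) = (\<Sum>k\<in>A. cint (F k))"
proof (induction A rule: infinite_finite_induct)
  case (insert x A)
  have "cint (\<lambda>r. F x r + (\<Sum>k\<in>A. F k r)) = cint (F x) + cint (\<lambda>r. \<Sum>k\<in>A. F k r)"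
    using insert.prems by (intro cint_add cube_bounded_sum) auto
  with insert show ?case by simp
qed (auto simp: set_lebesgue_integral_def)

lemma cint_cnj: "cint (\<lambda>r. cnj (F r)) = cnj (cint F)"
  unfolding set_lebesgue_integral_def
  by (subst Bochner_Integration.integral_cnj[symmetric]) (simp add: scaleR_conv_of_real)

lemma fourier_coeff_eq: "fourier_coeff F k = 1/8 * cint (\<lambda>r. fmode (-k) r * F r)"
  unfolding fourier_coeff_def cube_def[symmetric] by (simp add: fmode_def freq_dot_simps)

lemma fourier_truncation_eq: "fourier_truncation N F r =
   (\<Sum>k\<in>{k :: int^3. \<forall>i. \<bar>k $ i\<bar> \<le> int N}. fourier_coeff F k * fmode k r)"
  unfolding fourier_truncation_def fmode_def by simp

text \<open>Expand the mean square distance between \<open>F\<close> and its partial sum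
  \<open>P\<close> over \<open>A\<close>. By orthogonality both mixed terms and the term of
  \<open>P\<close> alone equal 8, the volume of the cube, times the coefficient sum, so the
  nonnegative distance is the integral for \<open>F\<close> minus that quantity.\<close>

lemma Bessel_cube:
  assumes F: "cube_bounded F" and A: "finite A"
  shows "(\<Sum>k\<in>A. (cmod (fourier_coeff F k))\<^sup>2) \<le> 1/8 * (LINT r:cube|lborel. (cmod (F r))\<^sup>2)"
proof -
  define P where "P r = (\<Sum>k\<in>A. fourier_coeff F k * fmode k r)" for r
  let ?c = "fourier_coeff F"
  have P: "cube_bounded P" unfolding P_def by (intro cube_bounded_intros)
  have c: "cint (\<lambda>r. fmode (-k) r * F r) = 8 * ?c k" for k
    by (simp add: fourier_coeff_eq)
  have FP: "cint (\<lambda>r. F r * cnj (P r)) = 8 * (\<Sum>k\<in>A. cnj (?c k) * ?c k)"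
  proof -
    have "cint (\<lambda>r. F r * cnj (P r)) = cint (\<lambda>r. \<Sum>k\<in>A. cnj (?c k) * (fmode (-k) r * F r))"
      unfolding P_def by (simp add: fmode_minus sum_distrib_left mult_ac)
    also have "\<dots> = (\<Sum>k\<in>A. cnj (?c k) * (8 * ?c k))"
      by (subst cint_sum) (auto intro!: cube_bounded_intros F simp: c[symmetric])
    finally show ?thesis by (simp add: sum_distrib_left mult_ac)
  qed
  have PF: "cint (\<lambda>r. P r * cnj (F r)) = 8 * (\<Sum>k\<in>A. cnj (?c k) * ?c k)"
  proof -
    have "cint (\<lambda>r. P r * cnj (F r)) = cnj (cint (\<lambda>r. F r * cnj (P r)))"
      by (subst cint_cnj[symmetric]) (simp add: mult.commute)
    then show ?thesis by (simp add: FP mult.commute)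
  qed
  have PP: "cint (\<lambda>r. P r * cnj (P r)) = 8 * (\<Sum>k\<in>A. cnj (?c k) * ?c k)"
  proof -
    have "cint (\<lambda>r. P r * cnj (P r)) = cint (\<lambda>r. \<Sum>k\<in>A. \<Sum>l\<in>A. (?c k * cnj (?c l)) * fmode (k + - l) r)"
      unfolding P_def fmode_add by (simp add: fmode_minus sum_product mult_ac)
    also have "\<dots> = (\<Sum>k\<in>A. \<Sum>l\<in>A. (?c k * cnj (?c l)) * (if k + - l = 0 then 8 else 0))"
      by (subst cint_sum, intro cube_bounded_intros, subst cint_sum, intro cube_bounded_intros)
         (simp add: integral_fmode_cube)
    also have "\<dots> = (\<Sum>k\<in>A. 8 * (cnj (?c k) * ?c k))"
      using A by (intro sum.cong refl) (simp add: if_distrib sum.delta' cong: if_cong)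
    finally show ?thesis by (simp add: sum_distrib_left)
  qed
  have "cint (\<lambda>r. of_real ((cmod (F r - P r))\<^sup>2)) =
     cint (\<lambda>r. F r * cnj (F r) - F r * cnj (P r) - (P r * cnj (F r) - P r * cnj (P r)))"
    unfolding complex_norm_square by (simp add: algebra_simps)
  also have "\<dots> = cint (\<lambda>r. F r * cnj (F r)) - 8 * (\<Sum>k\<in>A. cnj (?c k) * ?c k)"
    by (subst cint_diff, (intro cube_bounded_intros F P)+)+ (simp add: FP PF PP)
  also have "cint (\<lambda>r. F r * cnj (F r)) = cint (\<lambda>r. of_real ((cmod (F r))\<^sup>2))"
    unfolding complex_norm_square ..
  finally have "complex_of_real (LINT r:cube|lborel. (cmod (F r - P r))\<^sup>2) =
      of_real ((LINT r:cube|lborel. (cmod (F r))\<^sup>2) - 8 * (\<Sum>k\<in>A. (cmod (?c k))\<^sup>2))"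
    unfolding set_integral_complex_of_real by (simp add: complex_norm_square[symmetric] mult.commute del: of_real_power)
  then have "(LINT r:cube|lborel. (cmod (F r - P r))\<^sup>2) =
      (LINT r:cube|lborel. (cmod (F r))\<^sup>2) - 8 * (\<Sum>k\<in>A. (cmod (?c k))\<^sup>2)"
    by (simp only: of_real_eq_iff)
  moreover have "(LINT r:cube|lborel. (cmod (F r - P r))\<^sup>2) \<ge> 0"
    unfolding set_lebesgue_integral_def by (intro Bochner_Integration.integral_nonneg) auto
  ultimately show ?thesis by simp
qed

section \<open>Trigonometric polynomials and pointwise bounds from coefficients\<close>

definition trig_poly :: "(real^3 \<Rightarrow> complex) \<Rightarrow> bool" where
  "trig_poly f \<longleftrightarrow> (\<exists>A p. finite A \<and> f = (\<lambda>r. \<Sum>k\<in>A. p k * fmode k r))"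

lemma trig_polyI: "finite A \<Longrightarrow> (\<And>r. f r = (\<Sum>k\<in>A. p k * fmode k r)) \<Longrightarrow> trig_poly f"
  unfolding trig_poly_def by blast

lemma trig_poly_add:
  assumes "trig_poly f" "trig_poly g" shows "trig_poly (\<lambda>r. f r + g r)"
proof -
  from assms obtain A p B q where A: "finite A" "\<And>r. f r = (\<Sum>k\<in>A. p k * fmode k r)"
    and B: "finite B" "\<And>r. g r = (\<Sum>k\<in>B. q k * fmode k r)" by (auto simp: trig_poly_def)
  have "f r = (\<Sum>k\<in>A \<union> B. (if k \<in> A then p k else 0) * fmode k r)" for r
    unfolding A(2) by (rule sum.mono_neutral_cong_left) (use A B in auto)
  moreover have "g r = (\<Sum>k\<in>A \<union> B. (if k \<in> B then q k else 0) * fmode k r)" for r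
    unfolding B(2) by (rule sum.mono_neutral_cong_left) (use A B in auto)
  ultimately have "f r + g r = (\<Sum>k\<in>A \<union> B. ((if k \<in> A then p k else 0) + (if k \<in> B then q k else 0)) * fmode k r)" for r
    by (simp add: distrib_right sum.distrib)
  then show ?thesis using A B by (intro trig_polyI[of "A \<union> B"]) auto
qed

lemma trig_poly_fmode_mult:
  assumes "trig_poly f" shows "trig_poly (\<lambda>r. c * fmode l r * f r)"
proof -
  from assms obtain A p where A: "finite A" "\<And>r. f r = (\<Sum>k\<in>A. p k * fmode k r)"
    by (auto simp: trig_poly_def)
  show ?thesis
  proof (rule trig_polyI)
    show "finite ((\<lambda>k. k + l) ` A)" using A by simp
    fix r
    have "c * fmode l r * f r = (\<Sum>k\<in>A. c * p k * fmode (k + l) r)"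
      unfolding A(2) by (simp add: sum_distrib_left fmode_add mult_ac)
    also have "\<dots> = (\<Sum>k\<in>(\<lambda>k. k + l) ` A. c * p (k - l) * fmode k r)"
      by (subst sum.reindex) (auto simp: inj_on_def)
    finally show "c * fmode l r * f r = (\<Sum>k\<in>(\<lambda>k. k + l) ` A. c * p (k - l) * fmode k r)" .
  qed
qed

lemma trig_poly_const: "trig_poly (\<lambda>r. c)"
  by (rule trig_polyI[of "{0}" _ "\<lambda>_. c"]) auto

lemma trig_poly_sum: "(\<And>k. k \<in> A \<Longrightarrow> trig_poly (f k)) \<Longrightarrow> trig_poly (\<lambda>r. \<Sum>k\<in>A. f k r)"
  by (induction A rule: infinite_finite_induct) (auto intro: trig_poly_const trig_poly_add)

lemma trig_poly_mult:
  assumes "trig_poly f" "trig_poly g" shows "trig_poly (\<lambda>r. f r * g r)"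
proof -
  from assms obtain A p where A: "finite A" "\<And>r. f r = (\<Sum>k\<in>A. p k * fmode k r)"
    by (auto simp: trig_poly_def)
  show ?thesis unfolding A(2) sum_distrib_right
    by (intro trig_poly_sum trig_poly_fmode_mult assms)
qed

lemma trig_poly_power: "trig_poly f \<Longrightarrow> trig_poly (\<lambda>r. f r ^ n)"
  by (induction n) (auto intro: trig_poly_const trig_poly_mult)

lemma set_integrable_complex_of_real_iff:
  "set_integrable M A (\<lambda>r. complex_of_real (f r)) \<longleftrightarrow> set_integrable M A f"
  unfolding set_integrable_def
  by (subst complex_of_real_integrable_eq[symmetric]) (simp add: scaleR_conv_of_real)

lemma continuous_set_integrable_cube:
  fixes f :: "real^3 \<Rightarrow> real"
  assumes "continuous_on UNIV f" shows "set_integrable lborel cube f"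
  using cube_bounded_integrable[OF cube_bounded_continuous, of "\<lambda>r. of_real (f r)"] assms
  by (simp add: set_integrable_complex_of_real_iff continuous_intros)

text \<open>A finite form of Parseval: pairing \<open>R\<close> with \<open>D\<close> pairs their
  coefficients. Since \<open>R\<close> is nonnegative, each of its coefficients is at most its own
  mean over the cube, and the volume 8 cancels.\<close>

lemma trig_poly_integral_bound:
  assumes P: "trig_poly (\<lambda>r. of_real (R r))" and R: "\<And>r. R r \<ge> 0"
    and D: "cube_bounded D" and B: "\<And>A. finite A \<Longrightarrow> (\<Sum>k\<in>A. cmod (fourier_coeff D k)) \<le> B"
  shows "cmod (cint (\<lambda>r. of_real (R r) * D r)) \<le> B * (LINT r:cube|lborel. R r)"
proof -
  from P obtain A p where A: "finite A" "\<And>r. of_real (R r) = (\<Sum>k\<in>A. p k * fmode k r)"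
    unfolding trig_poly_def by metis
  have Rb: "cube_bounded (\<lambda>r. of_real (R r))" unfolding A(2) by (intro cube_bounded_intros)
  have p: "cmod (p k) \<le> 1/8 * (LINT r:cube|lborel. R r)" if "k \<in> A" for k
  proof -
    have "cint (\<lambda>r. fmode (-k) r * of_real (R r)) = cint (\<lambda>r. \<Sum>l\<in>A. p l * fmode (l + - k) r)"
      unfolding A(2) fmode_add by (simp add: sum_distrib_left mult_ac)
    also have "\<dots> = (\<Sum>l\<in>A. p l * (if l + - k = 0 then 8 else 0))"
      by (subst cint_sum, intro cube_bounded_intros) (simp add: integral_fmode_cube)
    also have "\<dots> = 8 * p k" using that A(1) by (simp add: if_distrib sum.delta cong: if_cong)
    finally have "8 * cmod (p k) = cmod (cint (\<lambda>r. fmode (-k) r * of_real (R r)))"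
      by (simp add: norm_mult)
    also have "\<dots> \<le> (LINT r:cube|lborel. cmod (fmode (-k) r * of_real (R r)))"
      by (rule set_integral_norm_bound) (intro cube_bounded_integrable cube_bounded_intros Rb)
    also have "\<dots> = (LINT r:cube|lborel. R r)" using R by (simp add: norm_mult)
    finally show ?thesis by simp
  qed
  have c: "cint (\<lambda>r. fmode k r * D r) = 8 * fourier_coeff D (-k)" for k
    by (simp add: fourier_coeff_eq)
  have I0: "(LINT r:cube|lborel. R r) \<ge> 0"
    unfolding set_lebesgue_integral_def using R by (intro Bochner_Integration.integral_nonneg) auto
  have "cint (\<lambda>r. of_real (R r) * D r) = cint (\<lambda>r. \<Sum>k\<in>A. p k * (fmode k r * D r))"
    unfolding A(2) sum_distrib_right by (simp add: mult.assoc)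
  also have "\<dots> = (\<Sum>k\<in>A. p k * (8 * fourier_coeff D (-k)))"
    by (subst cint_sum) (auto intro!: cube_bounded_intros D simp: c[symmetric])
  also have "cmod \<dots> \<le> (\<Sum>k\<in>A. (LINT r:cube|lborel. R r) * cmod (fourier_coeff D (-k)))"
  proof (rule sum_norm_le)
    fix k assume "k \<in> A"
    from mult_right_mono[OF p[OF this], of "8 * cmod (fourier_coeff D (-k))"]
    show "cmod (p k * (8 * fourier_coeff D (-k))) \<le> (LINT r:cube|lborel. R r) * cmod (fourier_coeff D (-k))"
      by (simp add: norm_mult)
  qed
  also have "\<dots> = (LINT r:cube|lborel. R r) * (\<Sum>k\<in>uminus ` A. cmod (fourier_coeff D k))"
    by (subst sum.reindex) (auto simp: sum_distrib_left)
  also have "\<dots> \<le> (LINT r:cube|lborel. R r) * B"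
    using B[of "uminus ` A"] A(1) I0 by (intro mult_left_mono) auto
  finally show ?thesis by (simp add: mult.commute)
qed

lemma trig_poly_cos: 
  fixes x :: "real^3"
  shows "trig_poly (\<lambda>r. of_real (cos (pi * (r $ i - x $ i))))"
proof -
  have fd: "freq_dot (axis i 1) r = r $ i" for r
    by (simp add: freq_dot_def axis_def if_distrib if_distribR cong: if_cong)
  \<comment> \<open>Euler's formula; the phase at \<open>x\<close> goes into the scalar, and the
    trailing factor 1 gives each half the shape of \<open>trig_poly_fmode_mult\<close> applied to a
    constant.\<close>
  have "complex_of_real (cos (pi * (r $ i - x $ i))) =
     (1/2 * fmode (- axis i 1) x) * fmode (axis i 1) r * 1 + (1/2 * fmode (axis i 1) x) * fmode (- axis i 1) r * 1" for r
  proof -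
    have "fmode (- axis i 1) x * fmode (axis i 1) r = exp (\<i> * of_real (pi * (r $ i - x $ i)))"
      "fmode (axis i 1) x * fmode (- axis i 1) r = exp (- (\<i> * of_real (pi * (r $ i - x $ i))))"
      unfolding fmode_def exp_add[symmetric]
      by (rule arg_cong[of _ _ exp]; simp add: freq_dot_simps fd algebra_simps)+
    moreover have "complex_of_real (cos (pi * (r $ i - x $ i))) =
      (exp (\<i> * of_real (pi * (r $ i - x $ i))) + exp (- (\<i> * of_real (pi * (r $ i - x $ i)))))/2"
      unfolding cos_of_real[symmetric] cos_exp_eq ..
    ultimately show ?thesis by (simp add: field_simps)
  qed
  then show ?thesis
    using trig_poly_add[OF trig_poly_fmode_mult[OF trig_poly_const] trig_poly_fmode_mult[OF trig_poly_const]]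
    by presburger
qed

text \<open>If \<open>|D x| > B\<close>, integrate \<open>D\<close> against high powers of \<open>Q\<close>, a trigonometric polynomial with values
  in \<open>[0, 1]\<close> that equals 1 only at \<open>x\<close>: by the previous lemma the mean of \<open>D\<close> with respect to
  \<open>Q ^ n\<close> is at most \<open>B\<close>, but this weight concentrates at \<open>x\<close>.\<close>

lemma bound_by_fourier_coeffs:
  fixes x :: "real^3"
  assumes D: "continuous_on UNIV D" and B: "\<And>A. finite A \<Longrightarrow> (\<Sum>k\<in>A. cmod (fourier_coeff D k)) \<le> B"
    and x: "\<And>i. \<bar>x $ i\<bar> < 1"
  shows "cmod (D x) \<le> B"
proof (rule ccontr)
  assume "\<not> cmod (D x) \<le> B"
  then have DB: "cmod (D x) > B" by simp
  have B0: "B \<ge> 0" using B[of "{}"] by simp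
  \<comment> \<open>The unimodular factor that turns \<open>D x\<close> into its modulus, so that
    the real quantity \<open>h\<close> measures the excess over \<open>B\<close>.\<close>
  define u where "u = cnj (D x) / of_real (cmod (D x))"
  have Dx: "D x \<noteq> 0" using DB B0 by (metis norm_zero not_less)
  have nu: "cmod u = 1" using Dx by (simp add: u_def norm_divide)
  define h where "h r = Re (u * D r) - B" for r
  define \<eta> where "\<eta> = (cmod (D x) - B) / 2"
  have eta: "\<eta> > 0" using DB by (simp add: \<eta>_def)
  have "u * D x = of_real (cmod (D x))"
  proof -
    have "u * D x = (D x * cnj (D x)) / of_real (cmod (D x))" by (simp add: u_def mult.commute)
    also have "\<dots> = of_real (cmod (D x))"
      unfolding complex_norm_square[symmetric] using Dx by (simp add: power2_eq_square)
    finally show ?thesis .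
  qed
  then have hx: "h x = 2 * \<eta>" by (simp add: h_def \<eta>_def)
  have hc: "continuous_on UNIV h" unfolding h_def by (intro continuous_intros D)
  have "isCont h x" using hc by (simp add: continuous_on_eq_continuous_at)
  then obtain d where d: "d > 0" "\<And>r. dist r x < d \<Longrightarrow> dist (h r) (h x) < \<eta>"
    using eta unfolding continuous_at_eps_delta by (metis dist_commute)
  have hd: "h r \<ge> \<eta>" if "dist r x < d" for r
    using d(2)[OF that] hx by (simp add: dist_real_def abs_less_iff)
  have Dcb: "cube_bounded D" using D by (rule cube_bounded_continuous)
  obtain K0 where K0: "\<And>r. r \<in> cube \<Longrightarrow> cmod (D r) \<le> K0" using Dcb by (auto simp: cube_bounded_def)
  define K where "K = \<bar>K0\<bar> + B + 1"
  have K: "\<bar>h r\<bar> \<le> K" if "r \<in> cube" for r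
    using K0[OF that] abs_Re_le_cmod[of "u * D r"] B0 by (auto simp: h_def K_def norm_mult nu)
  have K1: "K \<ge> 1" using B0 by (simp add: K_def)
  \<comment> \<open>Each of the three summands is at most 2, so the divisor 6 normalises the maximum
    to 1.\<close>
  define Q where "Q r = (\<Sum>i\<in>UNIV. 1 + cos (pi * (r $ i - x $ i))) / 6" for r :: "real^3"
  have Qc: "continuous_on A Q" for A unfolding Q_def by (intro continuous_intros) auto
  have [measurable]: "Q \<in> borel_measurable borel" by (intro borel_measurable_continuous_onI Qc)
  have Q0: "Q r \<ge> 0" for r unfolding Q_def
    by (intro divide_nonneg_nonneg sum_nonneg) (auto simp: cos_ge_minus_one add_nonneg_eq_0_iff intro: order_trans[OF _ add_left_mono[OF cos_ge_minus_one]])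
  have Qx: "Q x = 1" by (simp add: Q_def)
  have Q1: "Q r < 1" if "r \<in> cube" "r \<noteq> x" for r
  proof -
    from that(2) obtain j where j: "r $ j \<noteq> x $ j" by (auto simp: vec_eq_iff)
    \<comment> \<open>Here \<open>x\<close> must lie in the open cube: every point of the closed
      cube then differs from it by less than one period in each coordinate, and no second peak of
      the cosine is reached.\<close>
    have "\<bar>pi * (r $ j - x $ j)\<bar> < 2 * pi"
      using that(1) x[of j] by (auto simp: mem_cube_iff abs_mult mult.commute[of 2] dest!: spec[of _ j])
    moreover have "pi * (r $ j - x $ j) \<noteq> 0" using j by simp
    ultimately have "cos (pi * (r $ j - x $ j)) \<noteq> 1"
      unfolding cos_one_2pi_int
    proof (intro notI, elim exE)
      fix n :: int
      assume A: "\<bar>pi * (r $ j - x $ j)\<bar> < 2 * pi" "pi * (r $ j - x $ j) \<noteq> 0"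
        and n: "pi * (r $ j - x $ j) = of_int n * 2 * pi"
      then have "\<bar>real_of_int n\<bar> * (2 * pi) < 1 * (2 * pi)" by (simp add: abs_mult)
      then have "\<bar>real_of_int n\<bar> < 1" by (subst (asm) mult_less_cancel_right) auto
      then have "n = 0" by linarith
      with A n show False by simp
    qed
    then have "cos (pi * (r $ j - x $ j)) < 1" using cos_le_one[of "pi * (r $ j - x $ j)"] by linarith
    then have "(\<Sum>i\<in>UNIV. 1 + cos (pi * (r $ i - x $ i))) < (\<Sum>i\<in>(UNIV::3 set). 2)"
      by (intro sum_strict_mono_ex1) (auto intro: order_trans[OF add_left_mono[OF cos_le_one]])
    then show ?thesis by (simp add: Q_def)
  qed
  obtain s where s: "0 \<le> s" "s < 1" "\<And>r. r \<in> cube \<Longrightarrow> \<not> dist r x < d \<Longrightarrow> Q r \<le> s"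
  proof (cases "cube - ball x d = {}")
    case True
    then have "\<And>r. r \<in> cube \<Longrightarrow> \<not> dist r x < d \<Longrightarrow> Q r \<le> 0" by (auto simp: dist_commute)
    then show ?thesis using that[of 0] by simp
  next
    case False
    have "compact (cube - ball x d)" unfolding cube_def by (intro compact_diff compact_cbox open_ball)
    from continuous_attains_sup[OF this False Qc] obtain y where
      y: "y \<in> cube - ball x d" "\<And>r. r \<in> cube - ball x d \<Longrightarrow> Q r \<le> Q y" by blast
    have "y \<noteq> x" using y(1) d(1) by auto
    then show ?thesis using that[of "Q y"] y Q0 Q1 by (auto simp: dist_commute)
  qed
  \<comment> \<open>A level strictly between \<open>s\<close> and 1: the weight exceeds
    \<open>p ^ n\<close> on \<open>V\<close>, a set of positive measure inside the ball around
    \<open>x\<close>, and is at most \<open>s ^ n\<close> on the rest of the cube outside that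
    ball.\<close>
  define p where "p = (1 + s) / 2"
  have p: "s < p" "p < 1" "p > 0" using s by (auto simp: p_def)
  define V where "V = {r \<in> cube. Q r > p}"
  have Vm [measurable]: "V \<in> sets borel" unfolding V_def by measurable
  have Vcube: "V \<subseteq> cube" by (auto simp: V_def)
  have Vfin: "emeasure lborel V < \<infinity>"
    using emeasure_mono[OF Vcube, of lborel] by (simp add: emeasure_cube sets_cube less_top[symmetric] top_unique)
       (auto simp: top_unique)
  have xin: "x \<in> interior cube"
    unfolding cube_def interior_cbox using x by (auto simp: mem_box_cart abs_less_iff)
  have mV: "measure lborel V > 0"
  proof -
    have "open {r. Q r > p}" using Qc by (intro open_Collect_less continuous_intros)
    then have o: "open (interior cube \<inter> {r. Q r > p})" by auto
    have "x \<in> interior cube \<inter> {r. Q r > p}" using xin Qx p by simp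
    with o have "\<not> negligible (interior cube \<inter> {r. Q r > p})" using open_not_negligible by blast
    moreover have "interior cube \<inter> {r. Q r > p} \<subseteq> V" using interior_subset by (auto simp: V_def)
    ultimately have "\<not> negligible V" using negligible_subset by blast
    then have "emeasure lborel V \<noteq> 0"
      by (auto simp: negligible_iff_null_sets null_sets_completionI null_sets_def)
    then show ?thesis using Vfin by (simp add: measure_def enn2real_positive_iff zero_less_iff_neq_zero less_top)
  qed
  \<comment> \<open>The mean of \<open>h\<close> against \<open>Q ^ n\<close> is at most 0, so the
    gain on \<open>V\<close>, where \<open>h\<close> is at least \<eta>, cannot exceed the loss
    outside the ball, at most \<open>K * s ^ n\<close> per unit volume. Large \<open>n\<close>
    contradicts this because \<open>s < p\<close>.\<close>
  have bound: "\<eta> * measure lborel V * p ^ n \<le> 8 * K * s ^ n" for n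
  proof -
    let ?R = "\<lambda>r. Q r ^ n"
    have trigQ: "trig_poly (\<lambda>r. of_real (?R r))"
    proof -
      have "trig_poly (\<lambda>r. (1/6 * (\<Sum>i\<in>UNIV. 1 + of_real (cos (pi * (r $ i - x $ i))))) ^ n)"
        by (intro trig_poly_power trig_poly_mult trig_poly_const trig_poly_sum trig_poly_add trig_poly_cos)
      then show ?thesis by (simp add: Q_def)
    qed
    have 1: "cmod (cint (\<lambda>r. of_real (?R r) * D r)) \<le> B * (LINT r:cube|lborel. ?R r)"
      by (rule trig_poly_integral_bound[OF trigQ _ Dcb B]) (simp add: Q0)
    have Rcb: "cube_bounded (\<lambda>r. of_real (?R r))"
      by (intro cube_bounded_continuous continuous_intros Qc)
    have Rint: "set_integrable lborel cube ?R"
      using cube_bounded_integrable[OF Rcb] by (simp only: set_integrable_complex_of_real_iff)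
    have RDcb: "cube_bounded (\<lambda>r. u * (of_real (?R r) * D r))"
      by (intro cube_bounded_intros Rcb Dcb)
    have ReI: "set_integrable lborel cube (\<lambda>r. Re (u * (of_real (?R r) * D r)))"
      using cube_bounded_integrable[OF RDcb] unfolding set_integrable_def
      by (drule_tac integrable_Re) (simp add: scaleR_conv_of_real)
    have hR: "(LINT r:cube|lborel. h r * ?R r) =
        Re (u * cint (\<lambda>r. of_real (?R r) * D r)) - B * (LINT r:cube|lborel. ?R r)"
    proof -
      have "(LINT r:cube|lborel. h r * ?R r) = (LINT r:cube|lborel. Re (u * (of_real (?R r) * D r)) - B * ?R r)"
        by (intro set_lebesgue_integral_cong) (auto simp: h_def algebra_simps)
      also have "\<dots> = (LINT r:cube|lborel. Re (u * (of_real (?R r) * D r))) - (LINT r:cube|lborel. B * ?R r)"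
        by (rule set_integral_diff[OF ReI]) (use Rint in simp)
      also have "(LINT r:cube|lborel. Re (u * (of_real (?R r) * D r))) = Re (cint (\<lambda>r. u * (of_real (?R r) * D r)))"
        unfolding set_lebesgue_integral_def
        by (subst integral_Re[symmetric]) (use cube_bounded_integrable[OF RDcb] in \<open>auto simp: set_integrable_def scaleR_conv_of_real\<close>)
      finally show ?thesis by simp
    qed
    have "Re (u * cint (\<lambda>r. of_real (?R r) * D r)) \<le> cmod (u * cint (\<lambda>r. of_real (?R r) * D r))"
      by (rule complex_Re_le_cmod)
    then have le0: "(LINT r:cube|lborel. h r * ?R r) \<le> 0" using 1 by (simp add: hR norm_mult nu)
    have I1: "set_integrable lborel cube (\<lambda>r. h r * ?R r)"
      by (intro continuous_set_integrable_cube continuous_intros Qc hc)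
    have IV: "set_integrable lborel cube (\<lambda>r. indicator V r * (\<eta> * p ^ n))"
      unfolding set_integrable_def
      by (rule Bochner_Integration.integrable_cong[THEN iffD1, OF refl _ integrable_mult_left[of "\<eta> * p ^ n", OF integrable_real_indicator[of V]]])
         (use Vcube Vfin in \<open>auto simp: indicator_def\<close>)
    have IC: "set_integrable lborel cube (\<lambda>r. K * s ^ n)"
      by (rule cube_bounded_integrable[OF cube_bounded_const, of "of_real (K * s^n)", unfolded set_integrable_complex_of_real_iff])
    have "(LINT r:cube|lborel. indicator V r * (\<eta> * p ^ n) - K * s ^ n) \<le> (LINT r:cube|lborel. h r * ?R r)"
    proof (rule set_integral_mono[OF set_integral_diff(1)[OF IV IC] I1])
      fix r assume r: "r \<in> cube"
      show "indicator V r * (\<eta> * p ^ n) - K * s ^ n \<le> h r * ?R r"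
      proof (cases "dist r x < d")
        case True
        have "indicator V r * (\<eta> * p ^ n) \<le> h r * ?R r"
        proof (cases "r \<in> V")
          case inV: True
          then show ?thesis using hd[OF True] eta p by (auto simp: V_def intro!: mult_mono power_mono)
        next
          case False
          then show ?thesis using hd[OF True] eta Q0[of r] by simp
        qed
        moreover have "K * s ^ n \<ge> 0" using K1 s by simp
        ultimately show ?thesis by simp
      next
        case False
        have Qs: "Q r \<le> s" using s(3)[OF r False] .
        then have nV: "r \<notin> V" using p by (auto simp: V_def)
        have "- (h r * ?R r) \<le> \<bar>h r\<bar> * ?R r" using Q0[of r]
          by (metis abs_ge_minus_self abs_mult abs_of_nonneg zero_le_power)
        also have "\<dots> \<le> K * s ^ n" using K[OF r] Qs Q0[of r] K1 by (intro mult_mono power_mono) auto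
        finally show ?thesis using nV by simp
      qed
    qed
    also have "(LINT r:cube|lborel. indicator V r * (\<eta> * p ^ n) - K * s ^ n) =
        (LINT r:cube|lborel. indicator V r * (\<eta> * p ^ n)) - (LINT r:cube|lborel. K * s ^ n)"
      by (rule set_integral_diff[OF IV IC])
    also have "(LINT r:cube|lborel. indicator V r * (\<eta> * p ^ n)) = (LINT r|lborel. indicator V r *\<^sub>R (\<eta> * p ^ n))"
      unfolding set_lebesgue_integral_def using Vcube
      by (intro Bochner_Integration.integral_cong) (auto simp: indicator_def)
    also have "\<dots> = measure lborel V * (\<eta> * p ^ n)" by simp
    also have "(LINT r:cube|lborel. K * s ^ n) = 8 * (K * s ^ n)"
      unfolding set_lebesgue_integral_def by (simp add: measure_cube)
    finally show ?thesis using le0 by (simp add: mult_ac)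
  qed
  have "\<exists>n. (s / p) ^ n < \<eta> * measure lborel V / (8 * K)"
    using eta mV K1 p s by (intro real_arch_pow_inv) (auto simp: divide_simps)
  then obtain n where "(s / p) ^ n < \<eta> * measure lborel V / (8 * K)" ..
  then have "8 * K * s ^ n < \<eta> * measure lborel V * p ^ n"
    using K1 p by (simp add: power_divide divide_simps mult_ac)
  with bound[of n] show False by simp
qed

section \<open>Frequency boxes and the truncation error\<close>

lemma Cauchy_Schwarz_sum_sqrt:
  fixes f g :: "'a \<Rightarrow> real"
  shows "(\<Sum>k\<in>A. f k * g k) \<le> sqrt (\<Sum>k\<in>A. (f k)\<^sup>2) * sqrt (\<Sum>k\<in>A. (g k)\<^sup>2)"
  unfolding real_sqrt_mult[symmetric] by (rule real_le_rsqrt) (rule Cauchy_Schwarz_ineq_sum)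

definition box_freqs :: "nat \<Rightarrow> (int^3) set" where
  "box_freqs N = {k. \<forall>i. \<bar>k $ i\<bar> \<le> int N}"

lemma bij_betw_box_freqs: "bij_betw (\<lambda>(a, b, c). vector [a, b, c]) 
   ({-int N..int N} \<times> {-int N..int N} \<times> {-int N..int N}) (box_freqs N)"
proof (rule bij_betwI[where g = "\<lambda>k. (k $ 1, k $ 2, k $ 3)"])
  show "(\<lambda>k. (k $ 1, k $ 2, k $ 3)) \<in> box_freqs N \<rightarrow> {-int N..int N} \<times> {-int N..int N} \<times> {-int N..int N}"
    by (auto simp: box_freqs_def forall_3 abs_le_iff minus_le_iff)
qed (auto simp: box_freqs_def forall_3 abs_le_iff vec_eq_iff)

lemma finite_box_freqs: "finite (box_freqs N)"
  using bij_betw_finite[OF bij_betw_box_freqs[of N]] by simp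

lemma card_box_freqs: "card (box_freqs N) = (2 * N + 1) ^ 3"
proof -
  have "card {- int N..int N} = 2 * N + 1" by simp
  then show ?thesis
    using bij_betw_same_card[OF bij_betw_box_freqs[of N]]
    by (simp only: card_cartesian_product power3_eq_cube mult.assoc)
qed

lemma fourier_truncation_box: "fourier_truncation N F r = (\<Sum>k\<in>box_freqs N. fourier_coeff F k * fmode k r)"
  by (simp add: fourier_truncation_eq box_freqs_def)

definition truncation_error :: "nat \<Rightarrow> (real^3 \<Rightarrow> complex) \<Rightarrow> real^3 \<Rightarrow> complex" where
  "truncation_error N F x = F x - fourier_truncation N F x"

lemma fourier_coeff_truncation_error:
  assumes "cube_bounded F"
  shows "fourier_coeff (truncation_error N F) k = (if k \<in> box_freqs N then 0 else fourier_coeff F k)"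
proof -
  have T: "cint (\<lambda>r. fmode (-k) r * fourier_truncation N F r) = (if k \<in> box_freqs N then 8 * fourier_coeff F k else 0)"
  proof -
    have "cint (\<lambda>r. fmode (-k) r * fourier_truncation N F r) = cint (\<lambda>r. \<Sum>l\<in>box_freqs N. fourier_coeff F l * fmode (l + - k) r)"
      unfolding fourier_truncation_box fmode_add by (simp add: sum_distrib_left mult_ac)
    also have "\<dots> = (\<Sum>l\<in>box_freqs N. fourier_coeff F l * (if l + - k = 0 then 8 else 0))"
      by (subst cint_sum, intro cube_bounded_intros) (simp add: integral_fmode_cube)
    also have "\<dots> = (if k \<in> box_freqs N then 8 * fourier_coeff F k else 0)"
      by (simp add: finite_box_freqs if_distrib sum.delta cong: if_cong)
    finally show ?thesis .
  qed
  have "fourier_coeff (truncation_error N F) k =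
     1/8 * (cint (\<lambda>r. fmode (-k) r * F r) - cint (\<lambda>r. fmode (-k) r * fourier_truncation N F r))"
    unfolding fourier_coeff_eq truncation_error_def right_diff_distrib fourier_truncation_box
    by (subst cint_diff) (intro cube_bounded_intros assms, intro cube_bounded_intros, simp add: right_diff_distrib)
  then show ?thesis unfolding T by (simp add: fourier_coeff_eq)
qed

text \<open>The error is itself continuous, and by orthogonality its coefficients are those of
  \<open>F\<close> outside the box and 0 inside. Hence \<open>bound_by_fourier_coeffs\<close>
  applies to the error directly, without any limit of partial sums.\<close>

lemma truncation_error_bound:
  fixes x :: "real^3"
  assumes F: "continuous_on UNIV F"
    and B: "\<And>A. finite A \<Longrightarrow> A \<inter> box_freqs N = {} \<Longrightarrow> (\<Sum>k\<in>A. cmod (fourier_coeff F k)) \<le> B"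
    and x: "\<And>i. \<bar>x $ i\<bar> < 1"
  shows "cmod (truncation_error N F x) \<le> B"
proof (rule bound_by_fourier_coeffs[OF _ _ x])
  show "continuous_on UNIV (truncation_error N F)"
    unfolding truncation_error_def[abs_def] fourier_truncation_box by (intro continuous_intros F)
  fix A :: "(int^3) set" assume "finite A"
  have "(\<Sum>k\<in>A. cmod (fourier_coeff (truncation_error N F) k)) =
      (\<Sum>k\<in>A - box_freqs N. cmod (fourier_coeff F k))"
    using \<open>finite A\<close> by (intro sum.mono_neutral_cong_right)
      (auto simp: fourier_coeff_truncation_error[OF cube_bounded_continuous[OF F]])
  also have "\<dots> \<le> B" using \<open>finite A\<close> by (intro B) auto
  finally show "(\<Sum>k\<in>A. cmod (fourier_coeff (truncation_error N F) k)) \<le> B" .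
qed

section \<open>Cut-off plane waves\<close>

text \<open>The difference quotients in direction \<open>b\<close> have integral 0 by translation
  invariance, and they converge to the derivative under an integrable majorant given by the mean
  value inequality.\<close>

lemma integral_directional_derivative_eq_0:
  fixes \<phi> \<phi>' :: "'a::euclidean_space \<Rightarrow> complex"
  assumes cont: "continuous_on UNIV \<phi>" and cont': "continuous_on UNIV \<phi>'"
    and b: "norm b = 1"
    and supp: "\<And>r. norm r > R \<Longrightarrow> \<phi> r = 0"
    and deriv: "\<And>r. ((\<lambda>t. \<phi> (r + t *\<^sub>R b)) has_vector_derivative \<phi>' r) (at 0)"
    and bound: "\<And>r. norm (\<phi>' r) \<le> K"
  shows "(LINT r|lborel. \<phi>' r) = 0"
proof -
  have [measurable]: "\<phi> \<in> borel_measurable borel" "\<phi>' \<in> borel_measurable borel"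
    using cont cont' by (auto intro: borel_measurable_continuous_onI)
  have int: "integrable lborel \<phi>"
  proof -
    have "integrable lborel (\<lambda>r. indicator (cball 0 R) r *\<^sub>R \<phi> r)"
      using continuous_on_subset[OF cont, of "cball 0 R"]
      by (intro borel_integrable_compact) auto
    also have "(\<lambda>r. indicator (cball 0 R) r *\<^sub>R \<phi> r) = \<phi>"
      using supp by (auto simp: indicator_def fun_eq_iff not_le)
    finally show ?thesis .
  qed
  \<comment> \<open>Increments of at most 1 keep all quotients supported in the ball of radius
    \<open>R + 1\<close>.\<close>
  define h where "h n = 1 / real (Suc n)" for n
  have h: "0 < h n" "h n \<le> 1" for n by (auto simp: h_def)
  define g where "g n r = (\<phi> (r + h n *\<^sub>R b) - \<phi> r) /\<^sub>R h n" for n r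
  have deriv_t: "((\<lambda>t. \<phi> (r + t *\<^sub>R b)) has_vector_derivative \<phi>' (r + s *\<^sub>R b)) (at s)" for r s
  proof -
    have "((\<lambda>t. \<phi> ((r + s *\<^sub>R b) + t *\<^sub>R b)) has_vector_derivative \<phi>' (r + s *\<^sub>R b)) (at (s - s))"
      using deriv[of "r + s *\<^sub>R b"] by simp
    moreover have "((\<lambda>t. t - s) has_vector_derivative 1) (at s)"
      by (auto intro!: derivative_eq_intros)
    ultimately have "((\<lambda>t. \<phi> ((r + s *\<^sub>R b) + t *\<^sub>R b)) \<circ> (\<lambda>t. t - s) has_vector_derivative 1 *\<^sub>R \<phi>' (r + s *\<^sub>R b)) (at s)"
      by (intro vector_diff_chain_at)
    then show ?thesis by (simp add: o_def algebra_simps)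
  qed
  have quot: "norm (g n r) \<le> K" for n r
  proof -
    have "norm (\<phi> (r + h n *\<^sub>R b) - \<phi> (r + 0 *\<^sub>R b)) \<le> K * norm (h n - 0)"
    proof (rule differentiable_bound[where S = UNIV and f' = "\<lambda>s t. t *\<^sub>R \<phi>' (r + s *\<^sub>R b)" and f = "\<lambda>t. \<phi> (r + t *\<^sub>R b)"])
      fix s :: real
      show "((\<lambda>t. \<phi> (r + t *\<^sub>R b)) has_derivative (\<lambda>t. t *\<^sub>R \<phi>' (r + s *\<^sub>R b))) (at s within UNIV)"
        using deriv_t[of r s] by (simp add: has_vector_derivative_def)
      show "onorm (\<lambda>t. t *\<^sub>R \<phi>' (r + s *\<^sub>R b)) \<le> K"
      proof (rule onorm_le)
        fix t :: real
        show "norm (t *\<^sub>R \<phi>' (r + s *\<^sub>R b)) \<le> K * norm t"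
          using mult_left_mono[OF bound, of "\<bar>t\<bar>"] by (simp add: mult.commute)
      qed
    qed auto
    then show ?thesis using h[of n] by (simp add: g_def divide_simps mult.commute)
  qed
  have g0: "g n r = 0" if "norm r > R + 1" for n r
  proof -
    have "norm r \<le> norm (r + h n *\<^sub>R b) + norm (h n *\<^sub>R b)"
      using norm_triangle_ineq4[of "r + h n *\<^sub>R b" "h n *\<^sub>R b"] by simp
    then have "norm (r + h n *\<^sub>R b) > R" using that h[of n] b by simp
    then show ?thesis using that supp[of r] supp[of "r + h n *\<^sub>R b"] by (simp add: g_def)
  qed
  have K0: "K \<ge> 0" using bound[of 0] norm_ge_zero order_trans by blast
  have lim: "(\<lambda>n. integral\<^sup>L lborel (g n)) \<longlonglongrightarrow> integral\<^sup>L lborel \<phi>'"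
  proof (rule integral_dominated_convergence[where w = "\<lambda>r. indicator (cball 0 (R + 1)) r *\<^sub>R K"])
    show "integrable lborel (\<lambda>r. indicator (cball (0::'a) (R + 1)) r *\<^sub>R K)"
      by (intro borel_integrable_compact) auto
    show "AE r in lborel. (\<lambda>n. g n r) \<longlonglongrightarrow> \<phi>' r"
    proof (rule AE_I2)
      fix r
      have "((\<lambda>t. (\<phi> (r + t *\<^sub>R b) - \<phi> r) /\<^sub>R t) \<longlongrightarrow> \<phi>' r) (at 0)"
      proof (rule Lim_null[THEN iffD2], rule tendsto_norm_zero_cancel)
        have "((\<lambda>t. norm (\<phi> (r + t *\<^sub>R b) - \<phi> r - t *\<^sub>R \<phi>' r) / norm t) \<longlongrightarrow> 0) (at 0)"
          using deriv[of r] by (simp add: has_vector_derivative_def has_derivative_at)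
        then show "((\<lambda>t. norm ((\<phi> (r + t *\<^sub>R b) - \<phi> r) /\<^sub>R t - \<phi>' r)) \<longlongrightarrow> 0) (at 0)"
        proof (rule Lim_transform_eventually)
          show "\<forall>\<^sub>F t in at 0. norm (\<phi> (r + t *\<^sub>R b) - \<phi> r - t *\<^sub>R \<phi>' r) / norm t =
              norm ((\<phi> (r + t *\<^sub>R b) - \<phi> r) /\<^sub>R t - \<phi>' r)"
          proof (rule eventually_at_ball'[of 1, THEN eventually_mono])
            fix t :: real assume "t \<in> ball 0 1 \<and> t \<noteq> 0 \<and> t \<in> UNIV"
            then have "(\<phi> (r + t *\<^sub>R b) - \<phi> r) /\<^sub>R t - \<phi>' r = (\<phi> (r + t *\<^sub>R b) - \<phi> r - t *\<^sub>R \<phi>' r) /\<^sub>R t"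
              by (simp add: scaleR_diff_right)
            then show "norm (\<phi> (r + t *\<^sub>R b) - \<phi> r - t *\<^sub>R \<phi>' r) / norm t =
              norm ((\<phi> (r + t *\<^sub>R b) - \<phi> r) /\<^sub>R t - \<phi>' r)" by (simp add: divide_inverse)
          qed simp
        qed
      qed
      moreover have "filterlim h (at 0) sequentially"
        unfolding h_def
        by (intro filterlim_atI LIMSEQ_inverse_real_of_nat[unfolded inverse_eq_divide]) auto
      ultimately show "(\<lambda>n. g n r) \<longlonglongrightarrow> \<phi>' r"
        unfolding g_def by (rule filterlim_compose)
    qed
    show "AE r in lborel. norm (g n r) \<le> indicator (cball 0 (R + 1)) r *\<^sub>R K" for n
      using quot g0 K0 by (auto simp: indicator_def not_le)
    show "g n \<in> borel_measurable lborel" for n unfolding g_def by measurable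
  qed auto
  have "integral\<^sup>L lborel (g n) = 0" for n
  proof -
    have "integrable lborel (\<lambda>r. \<phi> (h n *\<^sub>R b + r))"
      by (rule integrable_distr[of "(+) (h n *\<^sub>R b)" lborel borel, unfolded lborel_distr_plus]) (use int in auto)
    moreover have "(LINT r|lborel. \<phi> (h n *\<^sub>R b + r)) = integral\<^sup>L lborel \<phi>"
      using integral_distr[of "(+) (h n *\<^sub>R b)" lborel borel \<phi>] by (simp add: lborel_distr_plus)
    ultimately show ?thesis using int by (simp add: g_def[abs_def] add.commute)
  qed
  with lim show ?thesis using LIMSEQ_unique[OF _ tendsto_const] by auto
qed

section \<open>Integration by parts against the cut-off\<close>

definition partial_deriv :: "3 \<Rightarrow> (real^3 \<Rightarrow> real) \<Rightarrow> real^3 \<Rightarrow> real" where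
  "partial_deriv j f x = frechet_derivative f (at x) (axis j 1)"

lemma partial_deriv_outside:
  assumes "closed S" and "\<And>r. r \<notin> S \<Longrightarrow> f r = 0" and "r \<notin> S"
  shows "partial_deriv j f r = 0"
proof -
  have "(f has_derivative (\<lambda>_. 0)) (at r)"
    by (rule has_derivative_transform_within_open[of "\<lambda>_. 0" _ _ _ "- S"]) (use assms in auto)
  then have "frechet_derivative f (at r) = (\<lambda>_. 0)" by (metis frechet_derivative_at)
  then show ?thesis by (simp add: partial_deriv_def)
qed

text \<open>The frequency vector is complex because \<rho> leaves the real axis on the indentation.
  Fourier modes are the case of frequency \<pi> i k, so a mode times a wave is again of this
  form.\<close>

definition cexp :: "complex^3 \<Rightarrow> real^3 \<Rightarrow> complex" where
  "cexp c r = exp (\<Sum>i\<in>UNIV. c $ i * of_real (r $ i))"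

lemma continuous_on_cexp [continuous_intros]: "continuous_on A f \<Longrightarrow> continuous_on A (\<lambda>x. cexp c (f x))"
  unfolding cexp_def by (intro continuous_intros)

lemma cexp_add: "cexp (c + d) r = cexp c r * cexp d r"
  by (simp add: cexp_def exp_add[symmetric] sum.distrib distrib_right)

lemma fmode_cexp: "fmode k r = cexp (\<chi> i. of_real pi * \<i> * of_int (k $ i)) r"
  by (simp add: fmode_def cexp_def freq_dot_def sum_distrib_left mult_ac)

lemma norm_cexp_le:
  assumes "\<And>i. \<bar>Re (c $ i)\<bar> \<le> e" and "r \<in> cube"
  shows "cmod (cexp c r) \<le> exp (3 * e)"
proof -
  have "Re (\<Sum>i\<in>UNIV. c $ i * of_real (r $ i)) \<le> (\<Sum>i\<in>(UNIV::3 set). e)"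
    unfolding Re_sum
  proof (rule sum_mono)
    fix i :: 3
    have "Re (c $ i * of_real (r $ i)) \<le> \<bar>Re (c $ i)\<bar> * \<bar>r $ i\<bar>" by (simp flip: abs_mult)
    also have "\<dots> \<le> e * 1" using assms(1)[of i] assms(2) by (intro mult_mono) (auto simp: mem_cube_iff abs_le_iff minus_le_iff)
    finally show "Re (c $ i * of_real (r $ i)) \<le> e" by simp
  qed
  then show ?thesis by (simp add: cexp_def)
qed

text \<open>The product of \<psi> and the exponential vanishes outside the cube, so its derivative
  along \<open>axis j 1\<close> integrates to 0 and there is no boundary term; the product rule
  gives the two sides.\<close>

lemma cint_partial_deriv_cexp:
  assumes d: "\<And>r. \<psi> differentiable (at r)" and c': "continuous_on UNIV (partial_deriv j \<psi>)"
    and supp: "\<And>r. r \<notin> cube \<Longrightarrow> \<psi> r = 0"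
  shows "cint (\<lambda>r. of_real (partial_deriv j \<psi> r) * cexp c r) = - c $ j * cint (\<lambda>r. of_real (\<psi> r) * cexp c r)"
proof -
  have cl: "closed cube" unfolding cube_def by (rule closed_cbox)
  have supp': "partial_deriv j \<psi> r = 0" if "r \<notin> cube" for r
    by (rule partial_deriv_outside[OF cl supp that])
  have c0: "continuous_on UNIV \<psi>" using d differentiable_imp_continuous_within continuous_on_eq_continuous_within by blast
  let ?\<phi> = "\<lambda>r. of_real (\<psi> r) * cexp c r"
  let ?\<phi>' = "\<lambda>r. of_real (partial_deriv j \<psi> r) * cexp c r + c $ j * (of_real (\<psi> r) * cexp c r)"
  have cb: "cube_bounded (\<lambda>r. of_real (partial_deriv j \<psi> r) * cexp c r)" "cube_bounded (\<lambda>r. of_real (\<psi> r) * cexp c r)"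
    by (intro cube_bounded_continuous continuous_intros c0 c')+
  have cb': "cube_bounded ?\<phi>'" by (intro cube_bounded_add cube_bounded_mult[OF cube_bounded_const] cb)
  then obtain K where K: "\<And>r. r \<in> cube \<Longrightarrow> cmod (?\<phi>' r) \<le> K" by (auto simp: cube_bounded_def)
  have "bounded cube" by (simp add: cube_def)
  then obtain R where R: "\<And>r. r \<in> cube \<Longrightarrow> norm r \<le> R" by (auto simp: bounded_iff)
  have "(LINT r|lborel. ?\<phi>' r) = 0"
  \<comment> \<open>Outside the cube \<psi> and its derivative vanish, so the bound found on the
    cube, made nonnegative, holds everywhere.\<close>
  proof (rule integral_directional_derivative_eq_0[where \<phi> = ?\<phi> and b = "axis j 1" and R = R and K = "max K 0"])
    show "continuous_on UNIV ?\<phi>" "continuous_on UNIV ?\<phi>'" by (intro continuous_intros c0 c')+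
    show "norm (axis j (1::real)) = 1" by simp
    show "?\<phi> r = 0" if "norm r > R" for r
      using R[of r] supp[of r] that by (cases "r \<in> cube") auto
    show "cmod (?\<phi>' r) \<le> max K 0" for r
      using K[of r] supp[of r] supp'[of r] by (cases "r \<in> cube") auto
    fix r
    have "(\<psi> has_derivative frechet_derivative \<psi> (at r)) (at (r + 0 *\<^sub>R axis j 1))"
      using d[of r] by (simp add: frechet_derivative_works)
    then have "(\<psi> \<circ> (\<lambda>t. r + t *\<^sub>R axis j 1) has_derivative frechet_derivative \<psi> (at r) \<circ> (\<lambda>t. t *\<^sub>R axis j 1)) (at 0)"
      by (intro diff_chain_at) (auto intro!: derivative_eq_intros)
    moreover have "frechet_derivative \<psi> (at r) \<circ> (\<lambda>t. t *\<^sub>R axis j 1) = (\<lambda>t. t *\<^sub>R partial_deriv j \<psi> r)"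
      using linear_frechet_derivative[OF d[of r]] by (simp add: fun_eq_iff partial_deriv_def linear_cmul)
    ultimately have 1: "((\<lambda>t. \<psi> (r + t *\<^sub>R axis j 1)) has_vector_derivative partial_deriv j \<psi> r) (at 0)"
      by (simp add: has_vector_derivative_def o_def)
    have ce: "cexp c (r + t *\<^sub>R axis j 1) = cexp c r * exp (c $ j * of_real t)" for t
    proof -
      have "(\<Sum>i\<in>UNIV. c $ i * of_real ((r + t *\<^sub>R axis j 1) $ i)) = (\<Sum>i\<in>UNIV. c $ i * of_real (r $ i)) + (\<Sum>i\<in>UNIV. if i = j then c $ i * of_real t else 0)"
        by (subst sum.distrib[symmetric]) (auto intro!: sum.cong simp: axis_def algebra_simps)
      then show ?thesis by (simp add: cexp_def exp_add)
    qed
    have "((\<lambda>z. exp (c $ j * z)) has_field_derivative exp (c $ j * of_real 0) * c $ j) (at (of_real 0))"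
      by (auto intro!: derivative_eq_intros)
    then have 2: "((\<lambda>t. exp (c $ j * of_real t)) has_vector_derivative exp (c $ j * of_real 0) * c $ j) (at 0)"
      by (rule has_vector_derivative_real_field)
    have "((\<lambda>t. of_real (\<psi> (r + t *\<^sub>R axis j 1))) has_vector_derivative complex_of_real (partial_deriv j \<psi> r)) (at 0)"
      by (rule bounded_linear.has_vector_derivative[OF bounded_linear_of_real 1])
    from has_vector_derivative_mult[OF this has_vector_derivative_mult[OF has_vector_derivative_const[of "cexp c r"] 2]]
    show "((\<lambda>t. ?\<phi> (r + t *\<^sub>R axis j 1)) has_vector_derivative ?\<phi>' r) (at 0)"
      unfolding ce by (simp add: algebra_simps)
  qed
  moreover have "(LINT r|lborel. ?\<phi>' r) = cint ?\<phi>'"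
    unfolding set_lebesgue_integral_def using supp supp'
    by (intro Bochner_Integration.integral_cong) (auto simp: indicator_def)
  moreover have "cint ?\<phi>' = cint (\<lambda>r. of_real (partial_deriv j \<psi> r) * cexp c r) + cint (\<lambda>r. c $ j * ?\<phi> r)"
    by (rule cint_add[OF cb(1) cube_bounded_mult[OF cube_bounded_const cb(2)]])
  ultimately show ?thesis by (simp add: eq_neg_iff_add_eq_0)
qed

text \<open>Mode and wave merge into one exponential of frequency \<open>d\<close>, with
  \<open>j\<close>-th entry the difference of the two frequencies. Every derivative of the cut-off
  moved onto it yields a factor minus this entry, and the cube of the three signs is the minus sign
  in front.\<close>

lemma fourier_coeff_partial_deriv3:
  assumes chi: "C_n_on 3 chi UNIV" and supp: "\<And>r. r \<notin> cube \<Longrightarrow> chi r = 0"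
  shows "continuous_on UNIV (partial_deriv j (partial_deriv j (partial_deriv j chi)))"
    and "fourier_coeff (\<lambda>r. of_real (partial_deriv j (partial_deriv j (partial_deriv j chi)) r) * cexp c r) k =
      - ((c $ j - of_real pi * \<i> * of_int (k $ j)) ^ 3) * fourier_coeff (\<lambda>r. of_real (chi r) * cexp c r) k"
proof -
  have ax: "axis j 1 \<in> (Basis :: (real^3) set)" by (auto simp: Basis_vec_eq)
  have d0: "chi differentiable at r" for r using chi by (simp add: numeral_3_eq_3)
  have d1: "partial_deriv j chi differentiable at r" for r using chi ax by (simp add: numeral_3_eq_3 partial_deriv_def[abs_def])
  have d2: "partial_deriv j (partial_deriv j chi) differentiable at r" for r
    using chi ax by (simp add: numeral_3_eq_3 partial_deriv_def[abs_def])
  show c3: "continuous_on UNIV (partial_deriv j (partial_deriv j (partial_deriv j chi)))"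
    using chi ax by (simp add: numeral_3_eq_3 partial_deriv_def[abs_def])
  have c1: "continuous_on UNIV (partial_deriv j chi)" and c2: "continuous_on UNIV (partial_deriv j (partial_deriv j chi))"
    using d1 d2 differentiable_imp_continuous_within continuous_on_eq_continuous_within by blast+
  have cl: "closed cube" unfolding cube_def by (rule closed_cbox)
  have s1: "partial_deriv j chi r = 0" if "r \<notin> cube" for r
    by (rule partial_deriv_outside[OF cl supp that])
  have s2: "partial_deriv j (partial_deriv j chi) r = 0" if "r \<notin> cube" for r
    by (rule partial_deriv_outside[OF cl s1 that])
  define d where "d = c + (\<chi> i. of_real pi * \<i> * of_int ((- k) $ i))"
  have fc: "fourier_coeff (\<lambda>r. of_real (\<psi> r) * cexp c r) k = 1/8 * cint (\<lambda>r. of_real (\<psi> r) * cexp d r)" for \<psi> :: "real^3 \<Rightarrow> real"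
    unfolding fourier_coeff_eq fmode_cexp d_def cexp_add by (simp only: mult_ac)
  have dj: "d $ j = c $ j - of_real pi * \<i> * of_int (k $ j)" by (simp add: d_def)
  show "fourier_coeff (\<lambda>r. of_real (partial_deriv j (partial_deriv j (partial_deriv j chi)) r) * cexp c r) k =
      - ((c $ j - of_real pi * \<i> * of_int (k $ j)) ^ 3) * fourier_coeff (\<lambda>r. of_real (chi r) * cexp c r) k"
    unfolding fc dj[symmetric]
    by (simp add: cint_partial_deriv_cexp[OF d2 c3 s2] cint_partial_deriv_cexp[OF d1 c2 s1] cint_partial_deriv_cexp[OF d0 c1 supp] power3_eq_cube)
qed

section \<open>Lattice sums over the frequencies outside a box\<close>

definition freq_norm :: "int^3 \<Rightarrow> int" where
  "freq_norm k = max \<bar>k $ 1\<bar> (max \<bar>k $ 2\<bar> \<bar>k $ 3\<bar>)"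

lemma box_freqs_iff: "k \<in> box_freqs N \<longleftrightarrow> freq_norm k \<le> int N"
  by (auto simp: box_freqs_def freq_norm_def forall_3)

lemma freq_norm_attained: obtains j where "\<bar>k $ j\<bar> = freq_norm k"
proof -
  have "freq_norm k = \<bar>k $ 1\<bar> \<or> freq_norm k = \<bar>k $ 2\<bar> \<or> freq_norm k = \<bar>k $ 3\<bar>"
    unfolding freq_norm_def by linarith
  then show ?thesis using that by metis
qed

text \<open>Induction over cubical shells. The shell of sup norm \<open>M + 1\<close> has 24 M^2 +
  48 M + 26 points, at most 26 (M + 1)^2, which leaves 26 / (M + 1) ^ 4 per shell.\<close>

lemma sum_freq_norm_box:
  assumes "0 < N" "N \<le> M"
  shows "(\<Sum>k\<in>box_freqs M - box_freqs N. 1 / real_of_int (freq_norm k) ^ 6) \<le> 26 * (1 / real N ^ 3 - 1 / real M ^ 3)"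
  using assms(2)
proof (induction M rule: dec_induct)
  case base
  then show ?case by simp
next
  case (step M)
  have M: "M > 0" using step assms by simp
  let ?S = "box_freqs (Suc M) - box_freqs M"
  have sub: "box_freqs N \<subseteq> box_freqs M" "box_freqs M \<subseteq> box_freqs (Suc M)"
    using step by (auto simp: box_freqs_iff)
  have "(\<Sum>k\<in>box_freqs (Suc M) - box_freqs N. 1 / real_of_int (freq_norm k) ^ 6) =
      (\<Sum>k\<in>(box_freqs M - box_freqs N) \<union> ?S. 1 / real_of_int (freq_norm k) ^ 6)"
    using sub by (intro sum.cong) auto
  also have "\<dots> = (\<Sum>k\<in>box_freqs M - box_freqs N. 1 / real_of_int (freq_norm k) ^ 6) + (\<Sum>k\<in>?S. 1 / real_of_int (freq_norm k) ^ 6)"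
    using finite_box_freqs by (intro sum.union_disjoint) auto
  also have "(\<Sum>k\<in>?S. 1 / real_of_int (freq_norm k) ^ 6) = (\<Sum>k\<in>?S. 1 / real (Suc M) ^ 6)"
  proof (intro sum.cong refl)
    fix k assume "k \<in> ?S"
    then have "freq_norm k = int (Suc M)" by (auto simp: box_freqs_iff)
    then show "1 / real_of_int (freq_norm k) ^ 6 = 1 / real (Suc M) ^ 6" by simp
  qed
  also have "\<dots> = real (card ?S) * (1 / real (Suc M) ^ 6)" by simp
  also have "real (card ?S) = (2 * real M + 3) ^ 3 - (2 * real M + 1) ^ 3"
  proof -
    have "card ?S = (2 * Suc M + 1) ^ 3 - (2 * M + 1) ^ 3"
      using sub finite_box_freqs by (subst card_Diff_subset) (auto simp: card_box_freqs)
    moreover have "(2 * M + 1) ^ 3 \<le> (2 * Suc M + 1) ^ 3" by (intro power_mono) auto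
    ultimately show ?thesis by (simp add: of_nat_diff add_ac)
  qed
  also have "\<dots> \<le> 26 * (real M + 1) ^ 2"
    by (simp add: power3_eq_cube power2_eq_square algebra_simps)
  then have "((2 * real M + 3) ^ 3 - (2 * real M + 1) ^ 3) * (1 / real (Suc M) ^ 6) \<le> 26 * (real M + 1) ^ 2 * (1 / real (Suc M) ^ 6)"
    by (intro mult_right_mono) auto
  also have "26 * (real M + 1) ^ 2 * (1 / real (Suc M) ^ 6) = 26 * (1 / (real M + 1) ^ 4)"
  proof -
    have "y ^ 2 * (1 / y ^ 6) = 1 / y ^ 4" if "y > 0" for y :: real
    proof -
      have "y ^ 6 = y ^ 2 * y ^ 4" by (simp flip: power_add)
      then show ?thesis using that by (simp only:) (simp add: divide_simps)
    qed
    from this[of "real M + 1"] show ?thesis by (simp add: add_ac)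
  qed
  \<comment> \<open>The contribution of the new shell is dominated by the increment of the
    right-hand side, so the sum telescopes.\<close>
  also have "26 * (1 / (real M + 1) ^ 4) \<le> 26 * (1 / real M ^ 3 - 1 / real (Suc M) ^ 3)"
  proof -
    define x where "x = real M"
    have x: "x > 0" using M by (simp add: x_def)
    have "1 / (x + 1) ^ 4 + 1 / (x + 1) ^ 3 = (x + 2) / (x + 1) ^ 4"
    proof -
      have "1 / z ^ 3 = z / z ^ 4" if "z > 0" for z :: real
        using that by (simp add: power_numeral_reduce)
      from this[of "x + 1"] x show ?thesis by (simp add: add_divide_distrib)
    qed
    also have "\<dots> \<le> 1 / x ^ 3"
    proof -
      have "(x + 2) * x ^ 3 \<le> (x + 1) ^ 4"
        using x by (simp add: algebra_simps power_numeral_reduce)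
      then show ?thesis using x by (simp add: divide_simps)
    qed
    finally show ?thesis unfolding x_def by (simp add: add_ac)
  qed
  finally show ?case using step.IH by (simp add: algebra_simps)
qed

lemma sum_freq_norm_le:
  assumes "finite A" "A \<inter> box_freqs N = {}" "N > 0"
  shows "(\<Sum>k\<in>A. 1 / real_of_int (freq_norm k) ^ 6) \<le> 26 / real N ^ 3"
proof -
  obtain m where m: "\<And>k. k \<in> A \<Longrightarrow> freq_norm k \<le> m"
    using finite_imageI[OF assms(1), of freq_norm] by (metis Max_ge imageI)
  define M where "M = max N (nat m)"
  have "A \<subseteq> box_freqs M - box_freqs N"
    using m assms(2) by (fastforce simp: box_freqs_iff M_def)
  then have "(\<Sum>k\<in>A. 1 / real_of_int (freq_norm k) ^ 6) \<le> (\<Sum>k\<in>box_freqs M - box_freqs N. 1 / real_of_int (freq_norm k) ^ 6)"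
    using finite_box_freqs by (intro sum_mono2) auto
  also have "\<dots> \<le> 26 * (1 / real N ^ 3 - 1 / real M ^ 3)"
    by (rule sum_freq_norm_box) (use assms in \<open>auto simp: M_def\<close>)
  also have "\<dots> \<le> 26 / real N ^ 3" by simp
  finally show ?thesis .
qed

text \<open>Multiplication by the plane wave shifts frequencies, so three integrations by parts gain
  \<open>|c\<^sub>j - \<pi> i k\<^sub>j| ^ 3\<close>, which is at least \<open>|k|\<^sub>\<infinity> ^ 3\<close> since \<open>|c\<^sub>j| \<le> 2 N\<close> and \<open>\<pi> - 2 > 1\<close>. Bessel's inequality
  for the third derivatives makes the gain summable.\<close>

lemma plane_wave_tail:
  assumes chi: "C_n_on 3 chi UNIV" and supp: "\<And>r. r \<notin> cube \<Longrightarrow> chi r = 0"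
  shows "\<exists>C\<ge>0. \<forall>c N x. N > 0 \<longrightarrow> (\<forall>i. cmod (c $ i) \<le> 2 * real N) \<longrightarrow> (\<forall>i. \<bar>Re (c $ i)\<bar> \<le> e) \<longrightarrow>
     (\<forall>i. \<bar>x $ i\<bar> < 1) \<longrightarrow>
     cmod (truncation_error N (\<lambda>r. of_real (chi r) * cexp c r) x) \<le> C / real N powr (3/2)"
proof -
  define D where "D j = partial_deriv j (partial_deriv j (partial_deriv j chi))" for j
  have Dc: "continuous_on UNIV (D j)" for j
    unfolding D_def by (rule fourier_coeff_partial_deriv3(1)[OF chi supp])
  have "cube_bounded (\<lambda>r. of_real (\<Sum>j\<in>UNIV. \<bar>D j r\<bar>))"
    by (intro cube_bounded_continuous continuous_intros Dc)
  then obtain M where M: "\<And>r. r \<in> cube \<Longrightarrow> \<bar>\<Sum>j\<in>UNIV. \<bar>D j r\<bar>\<bar> \<le> M" by (auto simp: cube_bounded_def simp del: of_real_sum)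
  have DM: "\<bar>D j r\<bar> \<le> M" if "r \<in> cube" for j r
    using M[OF that] member_le_sum[of j UNIV "\<lambda>j. \<bar>D j r\<bar>"] by auto
  have M0: "M \<ge> 0" using DM[of 0 1] by (auto simp: mem_cube_iff)
  have chic: "continuous_on UNIV chi"
    using chi by (auto simp: numeral_3_eq_3 intro: differentiable_imp_continuous_on simp: differentiable_on_def)
  \<comment> \<open>The 3 counts the coordinate directions in which derivatives are taken, the 26
    comes from the lattice sum.\<close>
  define C where "C = sqrt (3 * (M * exp (3 * e))\<^sup>2) * sqrt 26"
  show ?thesis
  proof (intro exI[of _ C] conjI allI impI)
    show "C \<ge> 0" by (simp add: C_def)
    fix c :: "complex^3" and N :: nat and x :: "real^3"
    assume N: "N > 0" and c: "\<forall>i. cmod (c $ i) \<le> 2 * real N" and e: "\<forall>i. \<bar>Re (c $ i)\<bar> \<le> e"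
      and x: "\<forall>i. \<bar>x $ i\<bar> < 1"
    let ?F = "\<lambda>r. of_real (chi r) * cexp c r"
    let ?G = "\<lambda>j. fourier_coeff (\<lambda>r. of_real (D j r) * cexp c r)"
    let ?n = "\<lambda>k. real_of_int (freq_norm k)"
    show "cmod (truncation_error N ?F x) \<le> C / real N powr (3/2)"
    proof (rule truncation_error_bound)
      show "continuous_on UNIV ?F" by (intro continuous_intros chic)
      show "\<bar>x $ i\<bar> < 1" for i using x by simp
      fix A assume A: "finite A" "A \<inter> box_freqs N = {}"
      have n: "?n k > N" if "k \<in> A" for k using A that by (auto simp: box_freqs_iff)
      \<comment> \<open>The coordinate \<open>j\<close> that realises the sup norm varies with
        \<open>k\<close>. Summing over all three directions removes this dependence, so that
        Bessel's inequality can be applied for each fixed \<open>j\<close>.\<close>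
      have key: "(?n k ^ 3 * cmod (fourier_coeff ?F k))\<^sup>2 \<le> (\<Sum>j\<in>UNIV. (cmod (?G j k))\<^sup>2)"
        if k: "k \<in> A" for k
      proof -
        obtain j where j: "\<bar>k $ j\<bar> = freq_norm k" by (rule freq_norm_attained)
        have "pi * ?n k = cmod (of_real pi * \<i> * of_int (k $ j))"
          using arg_cong[OF j, of real_of_int] by (simp add: norm_mult)
        also have "\<dots> \<le> cmod (c $ j) + cmod (c $ j - of_real pi * \<i> * of_int (k $ j))"
          using norm_triangle_sub[of "of_real pi * \<i> * of_int (k $ j)" "c $ j"] by (simp add: norm_minus_commute)
        finally have "pi * ?n k - 2 * real N \<le> cmod (c $ j - of_real pi * \<i> * of_int (k $ j))"
          using c[rule_format, of j] by simp
        moreover have "?n k \<le> pi * ?n k - 2 * real N"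
        proof -
          have "3 * ?n k \<le> pi * ?n k" using n[OF k] pi_gt3 by (intro mult_right_mono) auto
          then show ?thesis using n[OF k] by linarith
        qed
        ultimately have *: "?n k \<le> cmod (c $ j - of_real pi * \<i> * of_int (k $ j))" by simp
        have "?n k ^ 3 * cmod (fourier_coeff ?F k) \<le> cmod (c $ j - of_real pi * \<i> * of_int (k $ j)) ^ 3 * cmod (fourier_coeff ?F k)"
          using * n[OF k] by (intro mult_right_mono power_mono) auto
        also have "\<dots> = cmod (?G j k)"
        proof -
          have "?G j k =
              - ((c $ j - of_real pi * \<i> * of_int (k $ j)) ^ 3) * fourier_coeff ?F k"
            unfolding D_def by (rule fourier_coeff_partial_deriv3(2)[OF chi]) (rule supp)
          then show ?thesis by (simp only: norm_mult norm_power norm_minus_cancel)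
        qed
        finally have "(?n k ^ 3 * cmod (fourier_coeff ?F k))\<^sup>2 \<le> (cmod (?G j k))\<^sup>2"
          using n[OF k] by (intro power_mono) auto
        also have "\<dots> \<le> (\<Sum>j\<in>UNIV. (cmod (?G j k))\<^sup>2)"
          by (rule member_le_sum) auto
        finally show ?thesis .
      qed
      \<comment> \<open>The bound does not depend on the frequency \<open>c\<close>: on the cube the
        wave enters only through its modulus, which is at most \<open>exp (3 * e)\<close>.\<close>
      have Bes: "(\<Sum>k\<in>A. (cmod (?G j k))\<^sup>2) \<le> (M * exp (3 * e))\<^sup>2" for j
      proof -
        have cb: "cube_bounded (\<lambda>r. of_real (D j r) * cexp c r)"
          by (intro cube_bounded_continuous continuous_intros Dc)
        have "(\<Sum>k\<in>A. (cmod (?G j k))\<^sup>2) \<le> 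
            1/8 * (LINT r:cube|lborel. (cmod (of_real (D j r) * cexp c r))\<^sup>2)"
          by (rule Bessel_cube[OF cb A(1)])
        also have "(LINT r:cube|lborel. (cmod (of_real (D j r) * cexp c r))\<^sup>2) \<le> (LINT r:cube|lborel. (M * exp (3 * e))\<^sup>2)"
        proof (rule set_integral_mono)
          have "cube_bounded (\<lambda>r. of_real ((cmod (of_real (D j r) * cexp c r))\<^sup>2))"
            by (intro cube_bounded_continuous continuous_intros Dc)
          then show "set_integrable lborel cube (\<lambda>r. (cmod (of_real (D j r) * cexp c r))\<^sup>2)"
            by (drule_tac cube_bounded_integrable) (simp only: set_integrable_complex_of_real_iff)
          show "set_integrable lborel cube (\<lambda>r. (M * exp (3 * e))\<^sup>2)"
            by (rule cube_bounded_integrable[OF cube_bounded_const, of "of_real ((M * exp (3 * e))\<^sup>2)", unfolded set_integrable_complex_of_real_iff])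
          fix r assume r: "r \<in> cube"
          have "cmod (of_real (D j r) * cexp c r) \<le> M * exp (3 * e)"
            unfolding norm_mult using DM[OF r] norm_cexp_le[of c e r] e r M0 by (intro mult_mono) auto
          then show "(cmod (of_real (D j r) * cexp c r))\<^sup>2 \<le> (M * exp (3 * e))\<^sup>2" by (intro power_mono) auto
        qed
        also have "(LINT r:cube|lborel. (M * exp (3 * e))\<^sup>2) = 8 * (M * exp (3 * e))\<^sup>2"
          unfolding set_lebesgue_integral_def by (simp add: measure_cube)
        finally show ?thesis by simp
      qed
      have "(\<Sum>k\<in>A. cmod (fourier_coeff ?F k)) = (\<Sum>k\<in>A. (?n k ^ 3 * cmod (fourier_coeff ?F k)) * (1 / ?n k ^ 3))"
      proof (intro sum.cong refl)
        fix k assume "k \<in> A"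
        then show "cmod (fourier_coeff ?F k) = (?n k ^ 3 * cmod (fourier_coeff ?F k)) * (1 / ?n k ^ 3)"
          using n[of k] by simp
      qed
      also have "\<dots> \<le> sqrt (\<Sum>k\<in>A. (?n k ^ 3 * cmod (fourier_coeff ?F k))\<^sup>2) * sqrt (\<Sum>k\<in>A. (1 / ?n k ^ 3)\<^sup>2)"
        by (rule Cauchy_Schwarz_sum_sqrt)
      also have "\<dots> \<le> sqrt (3 * (M * exp (3 * e))\<^sup>2) * sqrt (26 / real N ^ 3)"
      proof (rule mult_mono[OF real_sqrt_le_mono real_sqrt_le_mono])
        have "(\<Sum>k\<in>A. (?n k ^ 3 * cmod (fourier_coeff ?F k))\<^sup>2) \<le>
           (\<Sum>k\<in>A. \<Sum>j\<in>UNIV. (cmod (?G j k))\<^sup>2)"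
          by (intro sum_mono key)
        also have "\<dots> = (\<Sum>j\<in>UNIV. \<Sum>k\<in>A. (cmod (?G j k))\<^sup>2)"
          by (rule sum.swap)
        also have "\<dots> \<le> (\<Sum>j\<in>(UNIV::3 set). (M * exp (3 * e))\<^sup>2)" by (intro sum_mono Bes)
        finally show "(\<Sum>k\<in>A. (?n k ^ 3 * cmod (fourier_coeff ?F k))\<^sup>2) \<le> 3 * (M * exp (3 * e))\<^sup>2" by simp
        show "(\<Sum>k\<in>A. (1 / ?n k ^ 3)\<^sup>2) \<le> 26 / real N ^ 3"
        proof -
          have "(1 / y ^ 3)\<^sup>2 = 1 / y ^ 6" for y :: real
            unfolding power_divide power_mult[symmetric] by simp
          then show ?thesis using sum_freq_norm_le[OF A N] by simp
        qed
      qed (simp_all add: sum_nonneg)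
      also have "\<dots> = C / real N powr (3/2)"
      proof -
        have "sqrt (real N ^ 3) = real N powr (3/2)"
        proof -
          have "sqrt (real N ^ 3) = (real N powr 3) powr (1/2)"
            using N by (simp only: powr_numeral of_nat_0_less_iff powr_half_sqrt zero_le_power of_nat_0_le_iff)
          then show ?thesis by (simp only: powr_powr) simp
        qed
        then show ?thesis by (simp add: C_def real_sqrt_divide)
      qed
      finally show "(\<Sum>k\<in>A. cmod (fourier_coeff ?F k)) \<le> C / real N powr (3/2)" .
    qed
  qed
qed

section \<open>The spherical Bessel function as an average of plane waves\<close>

lemma has_vector_derivative_of_real':
  assumes "(h has_real_derivative h') (at s)"
  shows "((\<lambda>s. complex_of_real (h s)) has_vector_derivative of_real h') (at s)"
  using assms by (intro bounded_linear.has_vector_derivative[OF bounded_linear_of_real])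
    (simp add: has_real_derivative_iff_has_vector_derivative)

lemma has_vector_derivative_exp_of_real:
  assumes "(h has_real_derivative h') (at s)"
  shows "((\<lambda>s. exp (c * complex_of_real (h s))) has_vector_derivative exp (c * of_real (h s)) * (c * of_real h')) (at s)"
proof -
  have "((\<lambda>s. c * complex_of_real (h s)) has_vector_derivative c * of_real h') (at s)"
    by (intro has_vector_derivative_mult_right has_vector_derivative_of_real' assms)
  from field_vector_diff_chain_at[OF this, of exp "exp (c * of_real (h s))"]
  show ?thesis by (simp add: o_def DERIV_exp mult_ac)
qed

text \<open>The derivative in the shift \<psi> is minus the \<phi>-derivative of the same function,
  so its integral over a full period is a difference of equal endpoint values, and the integral is
  constant in \<psi>.\<close>

lemma integral_cos_shift:
  fixes c :: complex and x y \<psi> :: real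
  shows "integral {0..2*pi} (\<lambda>\<phi>. exp (c * of_real (x * cos (\<phi> - \<psi>) + y))) =
         integral {0..2*pi} (\<lambda>\<phi>. exp (c * of_real (x * cos \<phi> + y)))"
proof -
  let ?f = "\<lambda>\<psi> \<phi>. exp (c * of_real (x * cos (\<phi> - \<psi>) + y))"
  let ?d = "\<lambda>\<psi> \<phi>. exp (c * of_real (x * cos (\<phi> - \<psi>) + y)) * (c * of_real (x * sin (\<phi> - \<psi>)))"
  have d\<psi>: "((\<lambda>\<psi>. ?f \<psi> \<phi>) has_vector_derivative ?d \<psi> \<phi>) (at \<psi>)" for \<phi> \<psi>
    by (rule has_vector_derivative_exp_of_real, rule DERIV_cong, (rule derivative_intros)+) simp
  have d\<phi>: "((\<lambda>\<phi>. - ?f \<psi> \<phi>) has_vector_derivative ?d \<psi> \<phi>) (at \<phi> within S)" for \<phi> \<psi> S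
  proof -
    have "((\<lambda>\<phi>. ?f \<psi> \<phi>) has_vector_derivative ?f \<psi> \<phi> * (c * of_real (- (x * sin (\<phi> - \<psi>))))) (at \<phi>)"
      by (rule has_vector_derivative_exp_of_real, rule DERIV_cong, (rule derivative_intros)+) simp
    from has_vector_derivative_minus[OF this]
    show ?thesis by (simp add: has_vector_derivative_at_within)
  qed
  have zero: "integral (cbox 0 (2*pi)) (?d \<psi>) = 0" for \<psi>
  proof -
    have "(?d \<psi> has_integral - ?f \<psi> (2*pi) - - ?f \<psi> 0) {0..2*pi}"
      by (rule fundamental_theorem_of_calculus) (use d\<phi> in auto)
    moreover have "cos (2*pi - \<psi>) = cos (0 - \<psi>)" by (simp add: cos_diff)
    ultimately have "(?d \<psi> has_integral 0) {0..2*pi}" by simp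
    then show ?thesis by (simp add: integral_unique)
  qed
  have "((\<lambda>\<psi>. integral (cbox 0 (2*pi)) (?f \<psi>)) has_vector_derivative 0) (at \<psi> within UNIV)" for \<psi>
    unfolding zero[of \<psi>, symmetric]
  proof (rule leibniz_rule_vector_derivative)
    show "?f \<psi> integrable_on cbox 0 (2*pi)" for \<psi>
      by (intro integrable_continuous continuous_intros)
    show "continuous_on (UNIV \<times> cbox 0 (2*pi)) (\<lambda>(\<psi>, \<phi>). ?d \<psi> \<phi>)"
      unfolding split_beta by (intro continuous_intros)
    show "((\<lambda>\<psi>. ?f \<psi> \<phi>) has_vector_derivative ?d \<psi> \<phi>) (at \<psi> within UNIV)" for \<psi> \<phi>
      by (rule d\<psi>)
  qed auto
  then have "\<exists>k. \<forall>\<psi>. integral (cbox 0 (2*pi)) (?f \<psi>) = k"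
    using has_vector_derivative_zero_constant[of UNIV "\<lambda>\<psi>. integral (cbox 0 (2*pi)) (?f \<psi>)"] by (metis convex_UNIV UNIV_I)
  then have "integral (cbox 0 (2*pi)) (?f \<psi>) = integral (cbox 0 (2*pi)) (?f 0)" by metis
  then show ?thesis by simp
qed

text \<open>The integrals run over the unit sphere in polar coordinates, against \<open>sin \<alpha> d\<alpha> d\<phi>\<close>. Rotations preserve
  this measure: the \<open>\<theta>\<close>-derivative \<open>d\<close> of the integrand is a divergence \<open>\<partial>\<^sub>\<phi> (\<dots>) - \<partial>\<^sub>\<alpha> (\<dots>)\<close>, with
  \<open>u\<close> and \<open>v\<close> the two terms; the boundary values vanish or cancel.\<close>

lemma integral_sphere_rotate:
  fixes c :: complex and R \<theta> :: real
  defines "f \<equiv> \<lambda>\<theta> (\<alpha>, \<phi>). exp (c * of_real (R * sin \<theta> * (sin \<alpha> * cos \<phi>) + R * cos \<theta> * cos \<alpha>)) * of_real (sin \<alpha>)"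
  shows "integral (cbox (0, 0) (pi, 2*pi)) (f \<theta>) = integral (cbox (0, 0) (pi, 2*pi)) (f 0)"
proof -
  define a b where "a \<theta> = R * sin \<theta>" and "b \<theta> = R * cos \<theta>" for \<theta>
  define g where "g \<theta> \<alpha> \<phi> = exp (c * of_real (a \<theta> * (sin \<alpha> * cos \<phi>) + b \<theta> * cos \<alpha>))" for \<theta> \<alpha> \<phi>
  define d where "d \<theta> t = g \<theta> (fst t) (snd t) * (c * of_real (b \<theta> * (sin (fst t) * cos (snd t)) - a \<theta> * cos (fst t))) * of_real (sin (fst t))" for \<theta> t
  define u where "u \<theta> \<alpha> \<phi> = g \<theta> \<alpha> \<phi> * (c * of_real (a \<theta> * (cos \<alpha> * cos \<phi>) - b \<theta> * sin \<alpha>)) * of_real (sin \<alpha> * cos \<phi>) + g \<theta> \<alpha> \<phi> * of_real (cos \<alpha> * cos \<phi>)" for \<theta> \<alpha> \<phi>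
  define v where "v \<theta> \<alpha> \<phi> = g \<theta> \<alpha> \<phi> * (c * of_real (- a \<theta> * (sin \<alpha> * sin \<phi>))) * of_real (cos \<alpha> * sin \<phi>) + g \<theta> \<alpha> \<phi> * of_real (cos \<alpha> * cos \<phi>)" for \<theta> \<alpha> \<phi>
  have f: "f \<theta> t = g \<theta> (fst t) (snd t) * of_real (sin (fst t))" for \<theta> t
    by (simp add: f_def g_def a_def b_def split_beta)
  note gd = has_vector_derivative_exp_of_real and rd = has_vector_derivative_of_real'
  have d\<theta>: "((\<lambda>\<theta>. f \<theta> t) has_vector_derivative d \<theta> t) (at \<theta>)" for \<theta> t
    unfolding f g_def d_def a_def b_def
    by (rule has_vector_derivative_mult_left, rule gd, rule DERIV_cong, (rule derivative_intros)+) (simp add: algebra_simps)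
  have du: "((\<lambda>\<alpha>. g \<theta> \<alpha> \<phi> * of_real (sin \<alpha> * cos \<phi>)) has_vector_derivative u \<theta> \<alpha> \<phi>) (at \<alpha>)" for \<theta> \<alpha> \<phi>
  proof -
    have "((\<lambda>\<alpha>. a \<theta> * (sin \<alpha> * cos \<phi>) + b \<theta> * cos \<alpha>) has_real_derivative a \<theta> * (cos \<alpha> * cos \<phi>) - b \<theta> * sin \<alpha>) (at \<alpha>)"
      by (rule DERIV_cong, (rule derivative_intros)+) simp
    moreover have "((\<lambda>\<alpha>. sin \<alpha> * cos \<phi>) has_real_derivative cos \<alpha> * cos \<phi>) (at \<alpha>)"
      by (rule DERIV_cong, (rule derivative_intros)+) simp
    ultimately show ?thesis
      using has_vector_derivative_mult[OF gd rd] unfolding g_def u_def by (fastforce simp: add.commute)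
  qed
  have dv: "((\<lambda>\<phi>. g \<theta> \<alpha> \<phi> * of_real (cos \<alpha> * sin \<phi>)) has_vector_derivative v \<theta> \<alpha> \<phi>) (at \<phi>)" for \<theta> \<alpha> \<phi>
  proof -
    have "((\<lambda>\<phi>. a \<theta> * (sin \<alpha> * cos \<phi>) + b \<theta> * cos \<alpha>) has_real_derivative - a \<theta> * (sin \<alpha> * sin \<phi>)) (at \<phi>)"
      by (rule DERIV_cong, (rule derivative_intros)+) simp
    moreover have "((\<lambda>\<phi>. cos \<alpha> * sin \<phi>) has_real_derivative cos \<alpha> * cos \<phi>) (at \<phi>)"
      by (rule DERIV_cong, (rule derivative_intros)+) simp
    ultimately show ?thesis
      using has_vector_derivative_mult[OF gd rd] unfolding g_def v_def by (fastforce simp: add.commute)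
  qed
  \<comment> \<open>The terms linear in \<open>c\<close> combine through sin^2 + cos^2 = 1 in the
    azimuth; the terms free of \<open>c\<close> are the same in \<open>u\<close> and
    \<open>v\<close> and cancel.\<close>
  have duv: "d \<theta> t = v \<theta> (fst t) (snd t) - u \<theta> (fst t) (snd t)" for \<theta> t
  proof -
    have s: "complex_of_real (sin (snd t)) ^ 2 = 1 - of_real (cos (snd t)) ^ 2"
      by (metis of_real_1 of_real_diff of_real_power sin_squared_eq)
    have "v \<theta> (fst t) (snd t) - u \<theta> (fst t) (snd t) - d \<theta> t = g \<theta> (fst t) (snd t) * c * of_real (a \<theta> * sin (fst t) * cos (fst t)) *
       (1 - of_real (cos (snd t)) ^ 2 - of_real (sin (snd t)) ^ 2)"
      unfolding d_def u_def v_def by (simp add: algebra_simps power2_eq_square)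
    then show ?thesis by (simp add: s)
  qed
  have gc: "continuous_on S (\<lambda>x. g (p x) (q x) (r x))" if "continuous_on S p" "continuous_on S q" "continuous_on S r"
    for S :: "'x::t2_space set" and p q r
    unfolding g_def a_def b_def using that by (intro continuous_intros)
  have abc: "continuous_on S (\<lambda>x. a (p x))" "continuous_on S (\<lambda>x. b (p x))" if "continuous_on S p"
    for S :: "'x::t2_space set" and p
    unfolding a_def b_def using that by (auto intro!: continuous_intros)
  have uc: "continuous_on S (\<lambda>x. u \<theta> (q x) (r x))" and vc: "continuous_on S (\<lambda>x. v \<theta> (q x) (r x))"
    if "continuous_on S q" "continuous_on S r"
    for S :: "(real \<times> real) set" and \<theta> q r
    unfolding u_def v_def using that by (auto intro!: continuous_intros gc)
  have zero: "integral (cbox (0, 0) (pi, 2*pi)) (d \<theta>) = 0" for \<theta>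
  proof -
    have "integral (cbox (0, 0) (pi, 2*pi)) (d \<theta>) =
      integral (cbox (0, 0) (pi, 2*pi)) (\<lambda>t. v \<theta> (fst t) (snd t)) - integral (cbox (0, 0) (pi, 2*pi)) (\<lambda>t. u \<theta> (fst t) (snd t))"
      unfolding duv by (intro Henstock_Kurzweil_Integration.integral_diff integrable_continuous uc vc continuous_intros)
    moreover have "integral (cbox (0, 0) (pi, 2*pi)) (\<lambda>t. v \<theta> (fst t) (snd t)) = 0"
    proof -
      have "integral (cbox (0, 0) (pi, 2*pi)) (\<lambda>(x, y). v \<theta> x y) = integral (cbox 0 pi) (\<lambda>\<alpha>. integral (cbox 0 (2*pi)) (\<lambda>\<phi>. v \<theta> \<alpha> \<phi>))"
        by (subst integral_prod_continuous) (auto simp: split_beta intro!: vc continuous_intros)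
      moreover have "integral (cbox 0 (2*pi)) (\<lambda>\<phi>. v \<theta> \<alpha> \<phi>) = 0" for \<alpha>
      proof -
        have "((\<lambda>\<phi>. v \<theta> \<alpha> \<phi>) has_integral g \<theta> \<alpha> (2*pi) * of_real (cos \<alpha> * sin (2*pi)) - g \<theta> \<alpha> 0 * of_real (cos \<alpha> * sin 0)) {0..2*pi}"
          by (rule fundamental_theorem_of_calculus[OF _ has_vector_derivative_at_within[OF dv]]) simp
        then show ?thesis by (simp add: integral_unique)
      qed
      ultimately show ?thesis unfolding case_prod_unfold by simp
    qed
    moreover have "integral (cbox (0, 0) (pi, 2*pi)) (\<lambda>t. u \<theta> (fst t) (snd t)) = 0"
    proof -
      have "integral (cbox (0, 0) (pi, 2*pi)) (\<lambda>(x, y). u \<theta> x y) = integral (cbox 0 pi) (\<lambda>\<alpha>. integral (cbox 0 (2*pi)) (\<lambda>\<phi>. u \<theta> \<alpha> \<phi>))"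
        by (subst integral_prod_continuous) (auto simp: split_beta intro!: uc continuous_intros)
      \<comment> \<open>\<open>u\<close> is an exact derivative in the polar angle, so that variable
        has to become the inner one.\<close>
      also have "\<dots> = integral (cbox 0 (2*pi)) (\<lambda>\<phi>. integral (cbox 0 pi) (\<lambda>\<alpha>. u \<theta> \<alpha> \<phi>))"
        by (rule integral_swap_continuous) (auto simp: split_beta intro!: uc continuous_intros)
      finally have "integral (cbox (0, 0) (pi, 2*pi)) (\<lambda>(x, y). u \<theta> x y) = integral (cbox 0 (2*pi)) (\<lambda>\<phi>. integral (cbox 0 pi) (\<lambda>\<alpha>. u \<theta> \<alpha> \<phi>))" .
      moreover have "integral (cbox 0 pi) (\<lambda>\<alpha>. u \<theta> \<alpha> \<phi>) = 0" for \<phi>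
      proof -
        have "((\<lambda>\<alpha>. u \<theta> \<alpha> \<phi>) has_integral g \<theta> pi \<phi> * of_real (sin pi * cos \<phi>) - g \<theta> 0 \<phi> * of_real (sin 0 * cos \<phi>)) {0..pi}"
          by (rule fundamental_theorem_of_calculus[OF _ has_vector_derivative_at_within[OF du]]) simp
        then show ?thesis by (simp add: integral_unique)
      qed
      ultimately show ?thesis unfolding case_prod_unfold by simp
    qed
    ultimately show ?thesis by simp
  qed
  have "((\<lambda>\<theta>. integral (cbox (0, 0) (pi, 2*pi)) (f \<theta>)) has_vector_derivative 0) (at \<theta> within UNIV)" for \<theta>
    unfolding zero[of \<theta>, symmetric]
  proof (rule leibniz_rule_vector_derivative)
    show "f \<theta> integrable_on cbox (0, 0) (pi, 2 * pi)" for \<theta>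
      unfolding f by (intro integrable_continuous continuous_intros gc)
    show "continuous_on (UNIV \<times> cbox (0, 0) (pi, 2 * pi)) (\<lambda>(\<theta>, t). d \<theta> t)"
      unfolding split_beta d_def by (intro continuous_intros gc abc)
  qed (use d\<theta> in auto)
  then have "\<exists>k. \<forall>\<theta>. integral (cbox (0, 0) (pi, 2*pi)) (f \<theta>) = k"
    using has_vector_derivative_zero_constant[of UNIV "\<lambda>\<theta>. integral (cbox (0, 0) (pi, 2*pi)) (f \<theta>)"] by (metis convex_UNIV UNIV_I)
  then show ?thesis by metis
qed

text \<open>With the wave travelling along the polar axis the azimuth contributes 2 \<pi>, and the
  sine in the surface element makes the remaining integral elementary: - exp (z cos \<alpha>) / z is
  an antiderivative, with z = i \<rho> R. The case z = 0 is separate and matches the value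
  \<open>j0 0 = 1\<close>.\<close>

lemma integral_sphere_axis:
  fixes \<rho> :: complex and R :: real
  shows "integral (cbox (0, 0) (pi, 2*pi)) (\<lambda>(\<alpha>, \<phi>). exp (\<i> * \<rho> * of_real (R * cos \<alpha>)) * of_real (sin \<alpha>)) =
     4 * of_real pi * j0 (\<rho> * of_real R)"
proof -
  have "integral (cbox (0, 0) (pi, 2*pi)) (\<lambda>(\<alpha>, \<phi>). exp (\<i> * \<rho> * of_real (R * cos \<alpha>)) * of_real (sin \<alpha>)) =
    integral (cbox 0 pi) (\<lambda>\<alpha>. integral (cbox 0 (2*pi)) (\<lambda>\<phi>. exp (\<i> * \<rho> * of_real (R * cos \<alpha>)) * of_real (sin \<alpha>)))"
    by (subst integral_prod_continuous) (auto simp: split_beta intro!: continuous_intros)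
  also have "\<dots> = 2 * of_real pi * integral {0..pi} (\<lambda>\<alpha>. exp (\<i> * \<rho> * of_real (R * cos \<alpha>)) * of_real (sin \<alpha>))"
  proof -
    have "integral (cbox 0 (2*pi)) (\<lambda>\<phi>. w) = 2 * of_real pi * w" for w :: complex
      by (simp add: scaleR_conv_of_real)
    from this show ?thesis unfolding cbox_interval[symmetric] by (simp only:) (rule integral_mult_right)
  qed
  also have "integral {0..pi} (\<lambda>\<alpha>. exp (\<i> * \<rho> * of_real (R * cos \<alpha>)) * of_real (sin \<alpha>)) = 2 * j0 (\<rho> * of_real R)"
  proof (cases "\<rho> * of_real R = 0")
    case True
    then have z: "\<i> * \<rho> * of_real (R * x) = 0" for x by auto
    have "((\<lambda>\<alpha>. complex_of_real (sin \<alpha>)) has_integral (- of_real (cos pi)) - (- of_real (cos 0))) {0..pi}"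
      by (rule fundamental_theorem_of_calculus[where f = "\<lambda>\<alpha>. - of_real (cos \<alpha>)"])
         (auto intro!: derivative_eq_intros bounded_linear.has_vector_derivative[OF bounded_linear_of_real]
            simp: of_real_minus[symmetric] has_real_derivative_iff_has_vector_derivative[symmetric] simp del: of_real_minus)
    then show ?thesis using True by (simp only: z exp_zero mult_1 integral_unique) (simp add: j0_def)
  next
    case False
    define z where "z = \<i> * (\<rho> * of_real R)"
    have z0: "z \<noteq> 0" using False by (simp add: z_def)
    have e: "\<i> * \<rho> * of_real (R * x) = z * of_real x" for x by (simp add: z_def)
    have "((\<lambda>\<alpha>. exp (z * of_real (cos \<alpha>)) * of_real (sin \<alpha>)) has_integral
       (- exp (z * of_real (cos pi)) / z) - (- exp (z * of_real (cos 0)) / z)) {0..pi}"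
    proof (rule fundamental_theorem_of_calculus[where f = "\<lambda>\<alpha>. - exp (z * of_real (cos \<alpha>)) / z"])
      fix \<alpha> :: real
      have "((\<lambda>w. - exp (z * cos w) / z) has_field_derivative exp (z * cos (of_real \<alpha>)) * sin (of_real \<alpha>)) (at (of_real \<alpha>))"
        using z0 by (auto intro!: derivative_eq_intros)
      from has_vector_derivative_real_field[OF this]
      show "((\<lambda>\<alpha>. - exp (z * of_real (cos \<alpha>)) / z) has_vector_derivative exp (z * of_real (cos \<alpha>)) * of_real (sin \<alpha>)) (at \<alpha> within {0..pi})"
        by (simp add: cos_of_real sin_of_real)
    qed simp
    then have "integral {0..pi} (\<lambda>\<alpha>. exp (z * of_real (cos \<alpha>)) * of_real (sin \<alpha>)) = (exp z - exp (- z)) / z"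
      by (simp add: integral_unique diff_divide_distrib)
    also have "\<dots> = 2 * j0 (\<rho> * of_real R)"
      using False by (simp add: j0_def sin_exp_eq z_def field_simps)
    finally show ?thesis unfolding e .
  qed
  finally show ?thesis by simp
qed

definition sphere_pt :: "real \<times> real \<Rightarrow> real^3" where
  "sphere_pt t = vector [sin (fst t) * cos (snd t), sin (fst t) * sin (snd t), cos (fst t)]"

lemma sphere_pt_nth: "sphere_pt t $ 1 = sin (fst t) * cos (snd t)" "sphere_pt t $ 2 = sin (fst t) * sin (snd t)"
   "sphere_pt t $ 3 = cos (fst t)"
  by (simp_all add: sphere_pt_def)

lemma abs_sphere_pt_le: "\<bar>sphere_pt t $ i\<bar> \<le> 1"
proof -
  have "\<bar>sin x * cos y\<bar> \<le> 1" "\<bar>sin x * sin y\<bar> \<le> 1" for x y :: real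
    unfolding abs_mult by (simp_all add: mult_le_one)
  then have "\<forall>i. \<bar>sphere_pt t $ i\<bar> \<le> 1" by (simp add: forall_3 sphere_pt_nth)
  then show ?thesis by simp
qed

lemma norm_vec3_sq: "(norm (r :: real^3))\<^sup>2 = (r $ 1)\<^sup>2 + (r $ 2)\<^sup>2 + (r $ 3)\<^sup>2"
  unfolding power2_norm_eq_inner by (simp add: inner_vec_def sum_3 power2_eq_square)

text \<open>Rotation of \<open>r\<close> to the polar axis in two one-parameter steps:
  \<open>integral_cos_shift\<close> removes the azimuth \<psi> of \<open>r\<close>, then
  \<open>integral_sphere_rotate\<close> removes its polar angle \<theta>. Both angles are obtained
  as arguments of complex numbers.\<close>

lemma j0_sphere_average:
  fixes \<rho> :: complex and r :: "real^3"
  shows "j0 (\<rho> * of_real (norm r)) = (LINT t:cbox (0, 0) (pi, 2*pi)|lborel.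
     of_real (sin (fst t) / (4 * pi)) * cexp (\<chi> i. \<i> * \<rho> * of_real (sphere_pt t $ i)) r)"
proof -
  \<comment> \<open>The distance of \<open>r\<close> from the polar axis.\<close>
  define A where "A = sqrt ((r $ 1)\<^sup>2 + (r $ 2)\<^sup>2)"
  obtain \<psi> where \<psi>: "r $ 1 = A * cos \<psi>" "r $ 2 = A * sin \<psi>"
  proof -
    let ?z = "Complex (r $ 1) (r $ 2)"
    have "cmod ?z = A" by (simp add: A_def cmod_def)
    then show ?thesis
      using that[of "Arg ?z"] arg_cong[OF rcis_cmod_Arg[of ?z], of Re] arg_cong[OF rcis_cmod_Arg[of ?z], of Im] by simp
  qed
  obtain \<theta> where \<theta>: "A = norm r * sin \<theta>" "r $ 3 = norm r * cos \<theta>"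
  proof -
    let ?z = "Complex (r $ 3) A"
    have "(cmod ?z)\<^sup>2 = (norm r)\<^sup>2" unfolding norm_vec3_sq cmod_power2 by (simp add: A_def)
    then have "cmod ?z = norm r" by (rule power2_eq_imp_eq) simp_all
    then show ?thesis
      using that[of "Arg ?z"] arg_cong[OF rcis_cmod_Arg[of ?z], of Re] arg_cong[OF rcis_cmod_Arg[of ?z], of Im] by simp
  qed
  let ?C = "cbox (0, 0) (pi, 2*pi)"
  have ce: "cexp (\<chi> i. \<i> * \<rho> * of_real (sphere_pt t $ i)) r =
      exp (\<i> * \<rho> * of_real (A * sin (fst t) * cos (snd t - \<psi>) + r $ 3 * cos (fst t)))" for t
    unfolding cexp_def by (rule arg_cong[of _ _ exp]) (simp add: sum_3 sphere_pt_nth \<psi> cos_diff algebra_simps)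
  have "(LINT t:?C|lborel. of_real (sin (fst t) / (4 * pi)) * cexp (\<chi> i. \<i> * \<rho> * of_real (sphere_pt t $ i)) r) =
     (LINT t:?C|lborel. of_real (1 / (4 * pi)) * (exp (\<i> * \<rho> * of_real (A * sin (fst t) * cos (snd t - \<psi>) + r $ 3 * cos (fst t))) * of_real (sin (fst t))))"
    unfolding ce by (simp add: mult_ac)
  also have "\<dots> = of_real (1 / (4 * pi)) * (LINT t:?C|lborel. exp (\<i> * \<rho> * of_real (A * sin (fst t) * cos (snd t - \<psi>) + r $ 3 * cos (fst t))) * of_real (sin (fst t)))"
    by (rule set_integral_mult_right)
  also have "(LINT t:?C|lborel. exp (\<i> * \<rho> * of_real (A * sin (fst t) * cos (snd t - \<psi>) + r $ 3 * cos (fst t))) * of_real (sin (fst t))) =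
     integral ?C (\<lambda>t. exp (\<i> * \<rho> * of_real (A * sin (fst t) * cos (snd t - \<psi>) + r $ 3 * cos (fst t))) * of_real (sin (fst t)))"
    by (intro set_borel_integral_eq_integral, unfold set_integrable_def) (intro borel_integrable_compact continuous_intros compact_cbox)
  also have "\<dots> = integral (cbox 0 pi) (\<lambda>\<alpha>. integral (cbox 0 (2*pi)) (\<lambda>\<phi>. exp (\<i> * \<rho> * of_real (A * sin \<alpha> * cos (\<phi> - \<psi>) + r $ 3 * cos \<alpha>)) * of_real (sin \<alpha>)))"
    by (subst integral_prod_continuous) (auto simp: split_beta intro!: continuous_intros)
  also have "\<dots> = integral (cbox 0 pi) (\<lambda>\<alpha>. integral (cbox 0 (2*pi)) (\<lambda>\<phi>. exp (\<i> * \<rho> * of_real (A * sin \<alpha> * cos \<phi> + r $ 3 * cos \<alpha>)) * of_real (sin \<alpha>)))"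
    by (simp only: integral_mult_left integral_cos_shift cbox_interval)
  also have "\<dots> = integral ?C (\<lambda>t. exp (\<i> * \<rho> * of_real (A * sin (fst t) * cos (snd t) + r $ 3 * cos (fst t))) * of_real (sin (fst t)))"
    by (subst integral_prod_continuous) (auto simp: split_beta intro!: continuous_intros)
  also have "\<dots> = integral ?C (\<lambda>(\<alpha>, \<phi>). exp (\<i> * \<rho> * of_real (norm r * sin \<theta> * (sin \<alpha> * cos \<phi>) + norm r * cos \<theta> * cos \<alpha>)) * of_real (sin \<alpha>))"
    unfolding case_prod_unfold \<theta> by (simp only: mult.assoc)
  also have "\<dots> = integral ?C (\<lambda>(\<alpha>, \<phi>). exp (\<i> * \<rho> * of_real (norm r * sin 0 * (sin \<alpha> * cos \<phi>) + norm r * cos 0 * cos \<alpha>)) * of_real (sin \<alpha>))"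
    by (rule integral_sphere_rotate)
  also have "\<dots> = 4 * of_real pi * j0 (\<rho> * of_real (norm r))"
    using integral_sphere_axis[of \<rho> "norm r"] by simp
  finally show ?thesis by simp
qed

section \<open>Superpositions\<close>

text \<open>Truncation is linear, so by Fubini it commutes with the integral over \<open>p\<close>;
  the error is then at most the uniform error of the members times the L1 norm of \<open>W\<close>.
  The hypotheses on \<open>E p\<close> are limited to \<open>W p \<noteq> 0\<close> because the
  weights used for contour pieces carry the indicator of their parameter range.\<close>

lemma truncation_error_superposition:
  fixes W :: "'p::euclidean_space \<Rightarrow> complex" and E :: "'p \<Rightarrow> real^3 \<Rightarrow> complex"
  assumes W: "integrable lborel W"
    and E [measurable]: "(\<lambda>(p, r). E p r) \<in> borel_measurable (borel \<Otimes>\<^sub>M borel)"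
    and K: "\<And>p r. W p \<noteq> 0 \<Longrightarrow> r \<in> cube \<Longrightarrow> cmod (E p r) \<le> K"
    and B: "\<And>p x. W p \<noteq> 0 \<Longrightarrow> (\<And>i. \<bar>x $ i\<bar> < 1) \<Longrightarrow> cmod (truncation_error N (E p) x) \<le> B"
  shows "cube_bounded (\<lambda>r. LINT p|lborel. W p * E p r)" (is "cube_bounded ?F")
    and "(\<And>i. \<bar>x $ i\<bar> < 1) \<Longrightarrow> cmod (truncation_error N (\<lambda>r. LINT p|lborel. W p * E p r) x)
            \<le> B * (LINT p|lborel. cmod (W p))"
proof -
  have [measurable]: "W \<in> borel_measurable borel" using W by auto
  have Ep [measurable]: "E p \<in> borel_measurable borel" for p
    using measurable_compose[OF measurable_Pair1'[of p borel borel] E] by simp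
  \<comment> \<open>If \<open>W\<close> vanishes identically, nothing forces \<open>K\<close> to be
    nonnegative.\<close>
  define K' where "K' = max K 0"
  have K': "cmod (W p * E p r) \<le> K' * cmod (W p)" if "r \<in> cube" for p r
    using K[of p r] that unfolding norm_mult K'_def
    by (cases "W p = 0") (auto simp: mult.commute intro!: mult_left_mono)
  have K'0: "K' \<ge> 0" by (simp add: K'_def)
  have int_p: "integrable lborel (\<lambda>p. W p * E p r)" if "r \<in> cube" for r
  proof (rule Bochner_Integration.integrable_bound[where f = "\<lambda>p. K' * cmod (W p)"])
    show "integrable lborel (\<lambda>p. K' * cmod (W p))" using W by (intro integrable_mult_right integrable_norm)
    show "AE p in lborel. norm (W p * E p r) \<le> norm (K' * cmod (W p))"
      using K'[OF that] K'0 by (intro AE_I2) (simp add: abs_mult)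
  qed measurable
  show "cube_bounded ?F"
  proof (rule cube_boundedI)
    show "?F \<in> borel_measurable borel" by measurable
    fix r assume r: "r \<in> cube"
    have "cmod (?F r) \<le> (LINT p|lborel. norm (W p * E p r))" by (rule integral_norm_bound)
    also have "\<dots> \<le> (LINT p|lborel. K' * cmod (W p))"
      using int_p[OF r] W K'[OF r] by (intro integral_mono) (auto intro!: integrable_norm)
    finally show "cmod (?F r) \<le> (LINT p|lborel. K' * cmod (W p))" .
  qed
  \<comment> \<open>The indicator of the cube is part of the integrand, so that Fubini runs over the
    full spaces.\<close>
  let ?f = "\<lambda>k p r. W p * (indicator cube r *\<^sub>R (fmode (-k) r * E p r))"
  have f_le: "cmod (?f k p r) \<le> K' * cmod (W p) * indicator cube r" for k p r
    using K'[of r p] by (auto simp: indicator_def norm_mult)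
  have pint: "integrable (lborel \<Otimes>\<^sub>M lborel) (\<lambda>(p, r). ?f k p r)" for k
  proof (rule lborel_pair.Fubini_integrable)
    show "(\<lambda>(p, r). ?f k p r) \<in> borel_measurable (lborel \<Otimes>\<^sub>M lborel)" by measurable
    have ind: "integrable lborel (\<lambda>r. K' * cmod (W p) * indicator cube r)" for p
      by (intro integrable_mult_right) (simp add: emeasure_cube)
    show ae: "AE p in lborel. integrable lborel (\<lambda>r. case (p, r) of (p, r) \<Rightarrow> ?f k p r)"
    proof (rule AE_I2)
      fix p
      show "integrable lborel (\<lambda>r. case (p, r) of (p, r) \<Rightarrow> ?f k p r)"
      proof (rule Bochner_Integration.integrable_bound[OF ind[of p]])
        show "AE r in lborel. norm (case (p, r) of (p, r) \<Rightarrow> ?f k p r) \<le> norm (K' * cmod (W p) * indicator cube r)"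
          using f_le[where k = k and p = p] K'0 by (intro AE_I2) (simp add: abs_mult)
        show "(\<lambda>r. case (p, r) of (p, r) \<Rightarrow> ?f k p r) \<in> borel_measurable lborel"
          unfolding prod.case by measurable
      qed
    qed
    show "integrable lborel (\<lambda>p. LINT r|lborel. norm (case (p, r) of (p, r) \<Rightarrow> ?f k p r))"
    proof (rule Bochner_Integration.integrable_bound[where f = "\<lambda>p. K' * cmod (W p) * 8"])
      show "integrable lborel (\<lambda>p. K' * cmod (W p) * 8)" using W by (intro integrable_mult_right integrable_mult_left integrable_norm)
      show "AE p in lborel. norm (LINT r|lborel. norm (case (p, r) of (p, r) \<Rightarrow> ?f k p r)) \<le> norm (K' * cmod (W p) * 8)"
        using ae
      proof eventually_elim
        case (elim p)
        from integrable_norm[OF elim] have "integrable lborel (\<lambda>r. norm (?f k p r))"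
          unfolding prod.case .
        then have "(LINT r|lborel. norm (?f k p r)) \<le> (LINT r|lborel. K' * cmod (W p) * indicator cube r)"
          by (rule integral_mono[OF _ ind f_le])
        also have "\<dots> = K' * cmod (W p) * 8" by (simp add: measure_cube)
        finally show ?case using K'0 by (simp add: abs_mult)
      qed
    qed measurable
  qed
  have coeff: "fourier_coeff ?F k = (LINT p|lborel. W p * fourier_coeff (E p) k)"
    and coeff_int: "integrable lborel (\<lambda>p. W p * fourier_coeff (E p) k)" for k
  proof -
    have eq: "1/8 * (LINT r|lborel. ?f k p r) = W p * fourier_coeff (E p) k" for p
      unfolding fourier_coeff_eq set_lebesgue_integral_def integral_mult_right_zero by (rule mult.left_commute)
    have fr: "(LINT p|lborel. ?f k p r) = indicator cube r *\<^sub>R (fmode (-k) r * ?F r)" for r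
    proof -
      have "?f k p r = (of_real (indicator cube r) * fmode (-k) r) * (W p * E p r)" for p
        by (simp add: scaleR_conv_of_real mult_ac)
      then show ?thesis by (simp only: integral_mult_right_zero scaleR_conv_of_real mult.assoc)
    qed
    have "fourier_coeff ?F k = 1/8 * (LINT r|lborel. LINT p|lborel. ?f k p r)"
      unfolding fourier_coeff_eq set_lebesgue_integral_def fr ..
    also have "(LINT r|lborel. LINT p|lborel. ?f k p r) = (LINT p|lborel. LINT r|lborel. ?f k p r)"
      by (rule lborel_pair.Fubini_integral[OF pint])
    also have "1/8 * (LINT p|lborel. LINT r|lborel. ?f k p r) = (LINT p|lborel. 1/8 * (LINT r|lborel. ?f k p r))"
      by simp
    finally show "fourier_coeff ?F k = (LINT p|lborel. W p * fourier_coeff (E p) k)" unfolding eq .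
    have "integrable lborel (\<lambda>p. 1/8 * (LINT r|lborel. ?f k p r))"
      using lborel_pair.integrable_fst[OF pint[of k]] by (intro integrable_mult_right)
    then show "integrable lborel (\<lambda>p. W p * fourier_coeff (E p) k)" unfolding eq .
  qed
  assume x: "\<And>i. \<bar>x $ i\<bar> < 1"
  have xc: "x \<in> cube" using x by (auto simp: mem_cube_iff abs_less_iff less_imp_le minus_le_iff)
  have trunc: "fourier_truncation N ?F x = (LINT p|lborel. W p * fourier_truncation N (E p) x)"
    and trunc_int: "integrable lborel (\<lambda>p. W p * fourier_truncation N (E p) x)"
  proof -
    have i: "integrable lborel (\<lambda>p. W p * fourier_coeff (E p) k * fmode k x)" for k
      by (intro integrable_mult_left coeff_int)
    have "fourier_truncation N ?F x = (\<Sum>k\<in>box_freqs N. (LINT p|lborel. W p * fourier_coeff (E p) k * fmode k x))"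
      unfolding fourier_truncation_box coeff by simp
    also have "\<dots> = (LINT p|lborel. (\<Sum>k\<in>box_freqs N. W p * fourier_coeff (E p) k * fmode k x))"
      by (rule Bochner_Integration.integral_sum[symmetric]) (rule i)
    finally show "fourier_truncation N ?F x = (LINT p|lborel. W p * fourier_truncation N (E p) x)"
      unfolding fourier_truncation_box by (simp add: sum_distrib_left mult.assoc)
    have "integrable lborel (\<lambda>p. \<Sum>k\<in>box_freqs N. W p * fourier_coeff (E p) k * fmode k x)"
      by (intro Bochner_Integration.integrable_sum i)
    then show "integrable lborel (\<lambda>p. W p * fourier_truncation N (E p) x)"
      unfolding fourier_truncation_box by (simp add: sum_distrib_left mult.assoc)
  qed
  have "truncation_error N ?F x = (LINT p|lborel. W p * truncation_error N (E p) x)"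
    unfolding truncation_error_def trunc right_diff_distrib
    by (rule Bochner_Integration.integral_diff[symmetric]) (intro int_p xc trunc_int)+
  also have "cmod \<dots> \<le> (LINT p|lborel. cmod (W p * truncation_error N (E p) x))"
    by (rule integral_norm_bound)
  also have "\<dots> \<le> (LINT p|lborel. B * cmod (W p))"
  proof (rule integral_mono)
    show "integrable lborel (\<lambda>p. cmod (W p * truncation_error N (E p) x))"
      unfolding truncation_error_def right_diff_distrib
      by (intro integrable_norm Bochner_Integration.integrable_diff int_p xc trunc_int)
    show "integrable lborel (\<lambda>p. B * cmod (W p))" using W by (intro integrable_mult_right integrable_norm)
    fix p
    show "cmod (W p * truncation_error N (E p) x) \<le> B * cmod (W p)"
      using B[of p x] x by (cases "W p = 0") (auto simp: norm_mult mult.commute[of B] intro!: mult_left_mono)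
  qed
  finally show "cmod (truncation_error N ?F x) \<le> B * (LINT p|lborel. cmod (W p))" by simp
qed

lemma truncation_error_add:
  assumes F: "cube_bounded F" and G: "cube_bounded G"
  shows "truncation_error N (\<lambda>r. F r + G r) x = truncation_error N F x + truncation_error N G x"
proof -
  have "fourier_coeff (\<lambda>r. F r + G r) k = fourier_coeff F k + fourier_coeff G k" for k
    unfolding fourier_coeff_eq distrib_left
    by (subst cint_add) (auto intro!: cube_bounded_intros F G simp: distrib_left)
  then show ?thesis
    unfolding truncation_error_def fourier_truncation_box by (simp add: distrib_right sum.distrib)
qed

lemma truncation_error_cmult: "truncation_error N (\<lambda>r. c * F r) x = c * truncation_error N F x"
proof -
  have "fourier_coeff (\<lambda>r. c * F r) k = c * fourier_coeff F k" for k
    unfolding fourier_coeff_eq mult.left_commute[of _ c] by simp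
  then show ?thesis
    unfolding truncation_error_def fourier_truncation_box
    by (simp add: right_diff_distrib sum_distrib_left mult.assoc)
qed

text \<open>For functions without usable decay of coefficients: the value at \<open>x\<close> and
  the truncated sum are bounded separately, the latter by Cauchy-Schwarz over the (2 N + 1)^3 modes
  and Bessel's inequality.\<close>

lemma truncation_error_L2:
  assumes F: "cube_bounded F" and x: "cmod (F x) \<le> s" and L: "(LINT r:cube|lborel. (cmod (F r))\<^sup>2) \<le> L"
  shows "cmod (truncation_error N F x) \<le> s + sqrt (real ((2 * N + 1) ^ 3)) * sqrt (L / 8)"
proof -
  have "cmod (fourier_truncation N F x) \<le> (\<Sum>k\<in>box_freqs N. 1 * cmod (fourier_coeff F k))"
    unfolding fourier_truncation_box by (rule order_trans[OF norm_sum]) (simp add: norm_mult)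
  also have "\<dots> \<le> sqrt (\<Sum>k\<in>box_freqs N. 1\<^sup>2) * sqrt (\<Sum>k\<in>box_freqs N. (cmod (fourier_coeff F k))\<^sup>2)"
    by (rule Cauchy_Schwarz_sum_sqrt)
  also have "(\<Sum>k\<in>box_freqs N. (1::real)\<^sup>2) = real ((2 * N + 1) ^ 3)" by (simp add: card_box_freqs)
  also have "sqrt (real ((2 * N + 1) ^ 3)) * sqrt (\<Sum>k\<in>box_freqs N. (cmod (fourier_coeff F k))\<^sup>2) \<le>
      sqrt (real ((2 * N + 1) ^ 3)) * sqrt (L / 8)"
    using Bessel_cube[OF F finite_box_freqs[of N]] L by (intro mult_left_mono real_sqrt_le_mono) auto
  finally show ?thesis using x norm_triangle_ineq4[of "F x" "fourier_truncation N F x"] unfolding truncation_error_def by linarith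
qed

lemma mem_cubeI: "(\<forall>i. \<bar>x $ i\<bar> < 1) \<Longrightarrow> (x::real^3) \<in> cube"
  by (auto simp: mem_cube_iff abs_less_iff less_imp_le minus_le_iff)

section \<open>Waves averaged over the sphere and along a path\<close>

definition sphere_weight :: "real \<times> real \<Rightarrow> complex" where
  "sphere_weight t = indicator (cbox (0, 0) (pi, 2*pi)) t *\<^sub>R of_real (sin (fst t) / (4 * pi))"

lemma integrable_sphere_weight: "integrable lborel sphere_weight"
  unfolding sphere_weight_def by (intro borel_integrable_compact continuous_intros compact_cbox) auto

definition sphere_wave :: "complex \<Rightarrow> real \<times> real \<Rightarrow> complex^3" where
  "sphere_wave \<rho> t = (\<chi> i. \<i> * \<rho> * of_real (sphere_pt t $ i))"

lemma j0_eq_sphere: "j0 (\<rho> * of_real (norm r)) = (LINT t|lborel. sphere_weight t * cexp (sphere_wave \<rho> t) r)"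
  unfolding j0_sphere_average set_lebesgue_integral_def sphere_weight_def sphere_wave_def by simp

text \<open>The weight is nonnegative, so its mass is the average of the wave with \<rho> = 0, which
  is \<open>j0 0\<close>.\<close>

lemma integral_norm_sphere_weight: "(LINT t|lborel. cmod (sphere_weight t)) = 1"
proof -
  have "complex_of_real (LINT t|lborel. cmod (sphere_weight t)) = (LINT t|lborel. complex_of_real (cmod (sphere_weight t)))"
    by simp
  also have "\<dots> = (LINT t|lborel. sphere_weight t * cexp (sphere_wave 0 t) 0)"
  proof (intro Bochner_Integration.integral_cong refl)
    fix t :: "real \<times> real"
    have "t \<in> cbox (0, 0) (pi, 2*pi) \<Longrightarrow> sin (fst t) \<ge> 0"
      by (cases t) (auto simp: sin_ge_zero)
    then show "complex_of_real (cmod (sphere_weight t)) = sphere_weight t * cexp (sphere_wave 0 t) 0"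
      by (simp add: sphere_weight_def cexp_def indicator_def scaleR_conv_of_real norm_divide)
  qed
  also have "\<dots> = 1" unfolding j0_eq_sphere[symmetric] by (simp add: j0_def)
  finally show ?thesis by (simp only: of_real_eq_1_iff)
qed

lemma sphere_wave_bounds:
  "cmod (sphere_wave \<rho> t $ i) \<le> cmod \<rho>" "\<bar>Re (sphere_wave \<rho> t $ i)\<bar> \<le> \<bar>Im \<rho>\<bar>"
  using abs_sphere_pt_le[of t i] mult_left_mono[of "\<bar>sphere_pt t $ i\<bar>" 1 "cmod \<rho>"]
    mult_left_mono[of "\<bar>sphere_pt t $ i\<bar>" 1 "\<bar>Im \<rho>\<bar>"]
  by (auto simp: sphere_wave_def norm_mult abs_mult)

lemma measurable_sphere_pt [measurable]: "(\<lambda>t. sphere_pt t $ i) \<in> borel_measurable borel"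
proof -
  have "\<forall>i. (\<lambda>t. sphere_pt t $ i) \<in> borel_measurable borel"
    unfolding forall_3 sphere_pt_nth
    by (intro conjI borel_measurable_continuous_onI continuous_intros)
  then show ?thesis by simp
qed

lemma continuous_vec_nth_measurable [measurable]: "(\<lambda>r::real^3. r $ i) \<in> borel_measurable borel"
  by (intro borel_measurable_continuous_onI continuous_intros)

lemma measurable_sphere_cexp [measurable]:
  "(\<lambda>(t, r). cexp (sphere_wave \<rho> t) r) \<in> borel_measurable (borel \<Otimes>\<^sub>M borel)"
  unfolding cexp_def sphere_wave_def vec_lambda_beta by measurable

text \<open>Each wave in the average has modulus at most this bound: three coordinates of
  \<open>r\<close>, each at most 1 on the cube, meet real parts of the frequency of size at most |Im
  \<rho>|.\<close>

lemma norm_j0_le: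
  fixes r :: "real^3"
  assumes r: "r \<in> cube" shows "cmod (j0 (\<rho> * of_real (norm r))) \<le> exp (3 * \<bar>Im \<rho>\<bar>)"
proof -
  have [measurable]: "sphere_weight \<in> borel_measurable borel" using integrable_sphere_weight by auto
  have m [measurable]: "(\<lambda>t. cexp (sphere_wave \<rho> t) r) \<in> borel_measurable borel"
    unfolding cexp_def sphere_wave_def vec_lambda_beta by measurable
  have le: "cmod (sphere_weight t * cexp (sphere_wave \<rho> t) r) \<le> exp (3 * \<bar>Im \<rho>\<bar>) * cmod (sphere_weight t)" for t
    using norm_cexp_le[of "sphere_wave \<rho> t" "\<bar>Im \<rho>\<bar>" r] sphere_wave_bounds(2)[of \<rho> t] r
    unfolding norm_mult mult.commute[of "cmod (sphere_weight t)"] by (intro mult_right_mono) auto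
  have i: "integrable lborel (\<lambda>t. exp (3 * \<bar>Im \<rho>\<bar>) * cmod (sphere_weight t))"
    using integrable_sphere_weight by (intro integrable_mult_right integrable_norm)
  have "cmod (j0 (\<rho> * of_real (norm r))) \<le> (LINT t|lborel. cmod (sphere_weight t * cexp (sphere_wave \<rho> t) r))"
    unfolding j0_eq_sphere by (rule integral_norm_bound)
  also have "\<dots> \<le> (LINT t|lborel. exp (3 * \<bar>Im \<rho>\<bar>) * cmod (sphere_weight t))"
  proof (rule integral_mono[OF _ i le])
    show "integrable lborel (\<lambda>t. cmod (sphere_weight t * cexp (sphere_wave \<rho> t) r))"
      by (rule Bochner_Integration.integrable_bound[OF i]) (use le in auto)
  qed
  finally show ?thesis by (simp add: integral_norm_sphere_weight)
qed

lemma measurable_j0 [measurable]: "j0 \<in> borel_measurable borel"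
proof -
  have "(\<lambda>z::complex. sin z / z) \<in> borel_measurable borel"
    by (intro borel_measurable_divide borel_measurable_continuous_onI continuous_intros)
  then show ?thesis unfolding j0_def[abs_def] by measurable
qed

locale smooth_cutoff =
  fixes chi :: "real^3 \<Rightarrow> real"
  assumes C3: "C_n_on 3 chi UNIV" and outside_cube: "\<And>r. r \<notin> cube \<Longrightarrow> chi r = 0"
begin

lemma continuous_chi: "continuous_on UNIV chi"
  using C3 by (auto simp: numeral_3_eq_3 continuous_on_eq_continuous_within intro: differentiable_imp_continuous_within)

lemma measurable_chi [measurable]: "chi \<in> borel_measurable borel"
  by (intro borel_measurable_continuous_onI continuous_chi)

lemma chi_bounded: obtains X where "X \<ge> 0" "\<And>r. \<bar>chi r\<bar> \<le> X"
proof -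
  have "cube_bounded (\<lambda>r. of_real (chi r))" by (intro cube_bounded_continuous continuous_intros continuous_chi)
  then obtain K where K: "\<And>r. r \<in> cube \<Longrightarrow> cmod (of_real (chi r)) \<le> K" by (auto simp: cube_bounded_def)
  show ?thesis
  proof (rule that[of "max K 0"])
    show "\<bar>chi r\<bar> \<le> max K 0" for r using K[of r] outside_cube[of r] by (cases "r \<in> cube") auto
  qed simp
qed

text \<open>\<gamma> parametrises a piece of the path of integration, and \<open>W\<close> is the
  weight on it including the derivative of the parametrisation.\<close>

definition superpose :: "(real \<Rightarrow> complex) \<Rightarrow> (real \<Rightarrow> complex) \<Rightarrow> real^3 \<Rightarrow> complex" where
  "superpose W \<gamma> r = (LINT p|lborel. W p * (of_real (chi r) * j0 (\<gamma> p * of_real (norm r))))"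

text \<open>The superposition estimate is used twice, for fixed \<open>p\<close> over the sphere
  with a weight of mass 1 and then over \<open>p\<close>. The bound \<open>e\<close> on the
  imaginary part makes the constant uniform over all admissible paths.\<close>

lemma superpose_tail:
  "\<exists>C\<ge>0. \<forall>N W \<gamma>. N > 0 \<longrightarrow> integrable lborel W \<longrightarrow> \<gamma> \<in> borel_measurable borel \<longrightarrow>
     (\<forall>p. W p \<noteq> 0 \<longrightarrow> cmod (\<gamma> p) \<le> 2 * real N \<and> \<bar>Im (\<gamma> p)\<bar> \<le> e) \<longrightarrow>
     cube_bounded (superpose W \<gamma>) \<and>
     (\<forall>x. (\<forall>i. \<bar>x $ i\<bar> < 1) \<longrightarrow>
       cmod (truncation_error N (superpose W \<gamma>) x) \<le> C / real N powr (3/2) * (LINT p|lborel. cmod (W p)))"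
proof -
  obtain C where C: "C \<ge> 0" and tail: "\<And>c N x. N > 0 \<Longrightarrow> (\<And>i. cmod (c $ i) \<le> 2 * real N) \<Longrightarrow> (\<And>i. \<bar>Re (c $ i)\<bar> \<le> e) \<Longrightarrow>
     (\<And>i. \<bar>x $ i\<bar> < 1) \<Longrightarrow> cmod (truncation_error N (\<lambda>r. of_real (chi r) * cexp c r) x) \<le> C / real N powr (3/2)"
    using plane_wave_tail[OF C3, of e] outside_cube by blast
  obtain X where X: "X \<ge> 0" "\<And>r. \<bar>chi r\<bar> \<le> X" using chi_bounded by blast
  show ?thesis
  proof (intro exI[of _ C] conjI allI impI)
    show "C \<ge> 0" by (rule C)
  next
    fix N :: nat and W \<gamma> :: "real \<Rightarrow> complex"
    assume N: "N > 0" and W: "integrable lborel W" and [measurable]: "\<gamma> \<in> borel_measurable borel"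
      and \<gamma>: "\<forall>p. W p \<noteq> 0 \<longrightarrow> cmod (\<gamma> p) \<le> 2 * real N \<and> \<bar>Im (\<gamma> p)\<bar> \<le> e"
    let ?E = "\<lambda>p r. of_real (chi r) * j0 (\<gamma> p * of_real (norm r))"
    have mE: "(\<lambda>(p, r). ?E p r) \<in> borel_measurable (borel \<Otimes>\<^sub>M borel)" by measurable
    have bE: "cmod (?E p r) \<le> X * exp (3 * e)" if "W p \<noteq> 0" "r \<in> cube" for p r
    proof -
      have "exp (3 * \<bar>Im (\<gamma> p)\<bar>) \<le> exp (3 * e)" using \<gamma> that by simp
      then show ?thesis unfolding norm_mult using X norm_j0_le[OF that(2), of "\<gamma> p"]
        by (intro mult_mono) (auto intro: order_trans)
    qed
    have tE: "cmod (truncation_error N (?E p) x) \<le> C / real N powr (3/2)"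
      if p: "W p \<noteq> 0" and x: "\<And>i. \<bar>x $ i\<bar> < 1" for p x
    proof -
      let ?P = "\<lambda>t r. of_real (chi r) * cexp (sphere_wave (\<gamma> p) t) r"
      have eq: "?E p r = (LINT t|lborel. sphere_weight t * ?P t r)" for r
        unfolding j0_eq_sphere mult.left_commute[of "sphere_weight _"] by simp
      have "cmod (truncation_error N (\<lambda>r. LINT t|lborel. sphere_weight t * ?P t r) x)
          \<le> C / real N powr (3/2) * (LINT t|lborel. cmod (sphere_weight t))"
      proof (rule truncation_error_superposition(2)[OF integrable_sphere_weight, where K = "X * exp (3 * e)"])
        show "(\<lambda>(t, r). ?P t r) \<in> borel_measurable (borel \<Otimes>\<^sub>M borel)" by measurable
        show "cmod (?P t r) \<le> X * exp (3 * e)" if "r \<in> cube" for t r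
          unfolding norm_mult using X that \<gamma> p
          by (intro mult_mono norm_cexp_le) (auto intro: order_trans[OF sphere_wave_bounds(2)])
        show "cmod (truncation_error N (?P t) y) \<le> C / real N powr (3/2)"
          if "\<And>i. \<bar>y $ i\<bar> < 1" for t y
          using \<gamma> p that by (intro tail N) (auto intro: order_trans[OF sphere_wave_bounds(1)] order_trans[OF sphere_wave_bounds(2)])
      qed (use x in auto)
      then show ?thesis unfolding eq[symmetric] integral_norm_sphere_weight by simp
    qed
    show "cube_bounded (superpose W \<gamma>)"
      unfolding superpose_def[abs_def] by (rule truncation_error_superposition(1)[OF W mE bE tE])
    fix x :: "real^3" assume "\<forall>i. \<bar>x $ i\<bar> < 1"
    then show "cmod (truncation_error N (superpose W \<gamma>) x) \<le> C / real N powr (3/2) * (LINT p|lborel. cmod (W p))"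
      unfolding superpose_def[abs_def] by (intro truncation_error_superposition(2)[OF W mE bE tE]) auto
  qed
qed

end

section \<open>Contours and integrals\<close>

text \<open>The slit runs from \<kappa> vertically upwards, so it contains the pole and is avoided
  by every path passing below. On the semicircle the real part equals \<kappa> only where the cosine
  vanishes, and there the sine is negative.\<close>

lemma lower_semicircle_in_slit_plane:
  fixes \<kappa> s t :: real
  assumes s: "0 < s" "s < \<kappa>" and t: "t \<in> {pi..2*pi}"
  shows "of_real \<kappa> + of_real s * cis t \<in> {z. Re z > 0} - {z. Re z = \<kappa> \<and> Im z \<ge> 0}"
proof -
  have "s * (- cos t) \<le> s * 1" using s by (intro mult_left_mono) (auto simp: minus_le_iff)
  moreover have "sin t < 0" if "cos t = 0"
  proof -
    have "sin t \<noteq> 0" using sin_cos_squared_add[of t] that by auto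
    moreover have "sin t \<le> 0" using sin_ge_zero[of "t - pi"] t by (simp add: sin_diff)
    ultimately show ?thesis by simp
  qed
  ultimately show ?thesis using s by (auto simp: mult_pos_neg not_le)
qed

text \<open>On the slit half-plane the integrand has a primitive \<open>g\<close>. Every integral in
  the identity is a difference of values of \<open>g\<close> at real points, and the right-hand side
  telescopes.\<close>

lemma shrink_indentation:
  fixes \<kappa> e R :: real
  assumes R: "0 < e" "e \<le> R" "R < \<kappa>"
    and f: "f holomorphic_on ({z. Re z > 0} - {z. Re z = \<kappa> \<and> Im z \<ge> 0})"
  shows "contour_integral (part_circlepath (of_real \<kappa>) R pi (2*pi)) f =
     integral {\<kappa> - R..\<kappa> - e} (\<lambda>t. f (of_real t)) +
     contour_integral (part_circlepath (of_real \<kappa>) e pi (2*pi)) f +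
     integral {\<kappa> + e..\<kappa> + R} (\<lambda>t. f (of_real t))"
proof -
  define S where "S = {z. Re z > 0} - {z. Re z = \<kappa> \<and> Im z \<ge> 0}"
  have oS: "open S"
  proof -
    have "closed ({z. Re z = \<kappa>} \<inter> {z. 0 \<le> Im z})"
      by (intro closed_Int closed_Collect_eq closed_Collect_le continuous_intros)
    moreover have "open {z. Re z > 0}" by (intro open_Collect_less continuous_intros)
    ultimately show ?thesis unfolding S_def Collect_conj_eq by (rule open_Diff[rotated])
  qed
  \<comment> \<open>The centre is \<kappa> - i. A segment from there to a point off the line Re z =
    \<kappa> meets that line only at the centre; if the other end is on the line, the whole segment
    lies below the real axis.\<close>
  have star: "starlike S"
  proof -
    have "closed_segment (Complex \<kappa> (-1)) x \<subseteq> S" if x: "x \<in> S" for x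
    proof
      fix y assume "y \<in> closed_segment (Complex \<kappa> (-1)) x"
      then obtain u where u: "0 \<le> u" "u \<le> 1" "y = (1 - u) *\<^sub>R Complex \<kappa> (-1) + u *\<^sub>R x"
        by (auto simp: in_segment)
      have Re: "Re y = (1 - u) * \<kappa> + u * Re x" and Im: "Im y = u * Im x - (1 - u)"
        by (simp_all add: u(3))
      have xS: "Re x > 0" "Re x = \<kappa> \<Longrightarrow> Im x < 0" using x by (auto simp: S_def)
      have "Re y > 0"
      proof (cases "u = 0")
        case False
        then have "u * Re x > 0" using u xS by simp
        moreover have "(1 - u) * \<kappa> \<ge> 0" using u R by simp
        ultimately show ?thesis by (simp add: Re)
      qed (use Re R in auto)
      moreover have "Im y < 0" if "Re y = \<kappa>"
      proof (cases "u = 0")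
        case False
        have "u * (Re x - \<kappa>) = 0" using that by (simp add: Re algebra_simps)
        then have "Im x < 0" using False xS by simp
        then have "u * Im x < 0" using u False by (simp add: mult_pos_neg)
        then show ?thesis using u by (simp add: Im)
      qed (use Im in auto)
      ultimately show "y \<in> S" by (auto simp: S_def)
    qed
    moreover have "Complex \<kappa> (-1) \<in> S" using R by (simp add: S_def)
    ultimately show ?thesis by (auto simp: starlike_def)
  qed
  have fS: "f holomorphic_on S" using f by (simp add: S_def)
  have "\<exists>g. \<forall>x\<in>S. (g has_field_derivative f x) (at x)"
  proof (rule holomorphic_starlike_primitive[OF _ star oS])
    show "continuous_on S f" using fS by (rule holomorphic_on_imp_continuous_on)
    show "finite {}" by simp
    show "f field_differentiable at x" if "x \<in> S - {}" for x
      using holomorphic_on_imp_differentiable_at[OF fS oS] that by simp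
  qed
  then obtain g where g: "\<And>x. x \<in> S \<Longrightarrow> (g has_field_derivative f x) (at x)" by blast
  have circ: "contour_integral (part_circlepath (of_real \<kappa>) s pi (2*pi)) f = g (of_real (\<kappa> + s)) - g (of_real (\<kappa> - s))"
    if s: "0 < s" "s < \<kappa>" for s
  proof -
    have "path_image (part_circlepath (of_real \<kappa>) s pi (2*pi)) \<subseteq> S"
      unfolding S_def path_image_part_circlepath'
      by (intro image_subsetI lower_semicircle_in_slit_plane[OF s]) (simp add: closed_segment_eq_real_ivl)
    then have "(f has_contour_integral (g (pathfinish (part_circlepath (of_real \<kappa>) s pi (2*pi))) -
        g (pathstart (part_circlepath (of_real \<kappa>) s pi (2*pi))))) (part_circlepath (of_real \<kappa>) s pi (2*pi))"
      by (intro contour_integral_primitive[of S g f]) (auto intro: has_field_derivative_at_within g)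
    moreover have "pathfinish (part_circlepath (of_real \<kappa>) s pi (2*pi)) = of_real (\<kappa> + s)"
      by (simp add: exp_eq_polar)
    moreover have "pathstart (part_circlepath (of_real \<kappa>) s pi (2*pi)) = of_real (\<kappa> - s)"
      by (simp add: exp_eq_polar)
    ultimately show ?thesis by (metis contour_integral_unique)
  qed
  have line: "integral {x..y} (\<lambda>t. f (of_real t)) = g (of_real y) - g (of_real x)"
    if "x \<le> y" "\<And>t. t \<in> {x..y} \<Longrightarrow> t > 0 \<and> t \<noteq> \<kappa>" for x y
  proof (rule integral_unique, rule fundamental_theorem_of_calculus[OF that(1)])
    fix t assume "t \<in> {x..y}"
    then have "of_real t \<in> S" using that by (auto simp: S_def)
    from has_vector_derivative_real_field[OF g[OF this]]
    show "((\<lambda>t. g (of_real t)) has_vector_derivative f (of_real t)) (at t within {x..y})" .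
  qed
  show ?thesis
    using R circ[of R] circ[of e] line[of "\<kappa> - R" "\<kappa> - e"] line[of "\<kappa> + e" "\<kappa> + R"] by simp
qed

lemma set_integral_inverse_power:
  fixes b :: real
  assumes "n > 1" "b > 0"
  shows "set_integrable lborel {b<..} (\<lambda>x. 1 / x ^ n)"
    and "(LINT x:{b<..}|lborel. 1 / x ^ n) \<le> 1 / (real (n - 1) * b ^ (n - 1))"
proof -
  let ?I = "1 / (real (n - 1) * b ^ (n - 1))"
  have I0: "?I \<ge> 0" using assms by simp
  have "((\<lambda>x. if x \<in> {b..} then 1 / x ^ n else 0) has_integral ?I) UNIV"
    unfolding has_integral_restrict_UNIV by (rule has_integral_inverse_power_to_inf[OF assms])
  then have nn: "(\<integral>\<^sup>+x. ennreal (if x \<in> {b..} then 1 / x ^ n else 0) \<partial>lborel) = ennreal ?I"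
    by (intro nn_integral_has_integral_lborel) (use assms in auto)
  have nn': "(\<integral>\<^sup>+x. ennreal (indicator {b<..} x *\<^sub>R (1 / x ^ n)) \<partial>lborel) \<le> ennreal ?I"
    unfolding nn[symmetric] using assms by (intro nn_integral_mono) (auto simp: indicator_def)
  show int: "set_integrable lborel {b<..} (\<lambda>x. 1 / x ^ n)"
    unfolding set_integrable_def
  proof (rule integrableI_nonneg)
    show "AE x in lborel. 0 \<le> indicator {b<..} x *\<^sub>R (1 / x ^ n)"
      using assms by (intro AE_I2) (auto simp: indicator_def)
    show "(\<integral>\<^sup>+x. ennreal (indicator {b<..} x *\<^sub>R (1 / x ^ n)) \<partial>lborel) < \<infinity>"
      using nn' by (rule order_le_less_trans) simp
  qed measurable
  have "ennreal (LINT x:{b<..}|lborel. 1 / x ^ n) = (\<integral>\<^sup>+x. ennreal (indicator {b<..} x *\<^sub>R (1 / x ^ n)) \<partial>lborel)"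
    unfolding set_lebesgue_integral_def using int assms
    by (intro nn_integral_eq_integral[symmetric]) (auto simp: set_integrable_def indicator_def)
  also note nn'
  finally show "(LINT x:{b<..}|lborel. 1 / x ^ n) \<le> ?I" using I0 by (simp add: ennreal_le_iff)
qed

text \<open>Dyadic boxes: \<open>1 / |r|\<^sup>2\<close> is at most \<open>4 ^ (n + 1)\<close> outside the box of half-width \<open>1 / 2 ^ (n + 1)\<close>.\<close>

lemma inverse_norm_square_integrable: "set_integrable lborel cube (\<lambda>r. 1 / (norm r)\<^sup>2)"
proof -
  define Q where "Q n = (cbox (vec (- ((1/2) ^ n))) (vec ((1/2) ^ n)) :: (real^3) set)" for n
  have Q: "r \<in> Q n \<longleftrightarrow> (\<forall>i. \<bar>r $ i\<bar> \<le> (1/2) ^ n)" for r n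
    unfolding Q_def by (auto simp: mem_box_cart abs_le_iff) (metis minus_le_iff)+
  have eQ: "emeasure lborel (Q n) = ennreal (8 * (1/8) ^ n)" for n
  proof -
    have "emeasure lborel (Q n) = (\<Prod>b\<in>Basis. (vec ((1/2) ^ n) - vec (- ((1/2) ^ n)) :: real^3) \<bullet> b)"
      unfolding Q_def by (rule emeasure_lborel_cbox) (auto simp: Basis_vec_eq inner_axis)
    also have "(\<Prod>b\<in>Basis. (vec ((1/2) ^ n) - vec (- ((1/2) ^ n)) :: real^3) \<bullet> b) = 8 * (1/8) ^ n"
    proof -
      have "((1/2::real) ^ n) ^ 3 = ((1/2) ^ 3) ^ n" by (simp only: power_mult[symmetric] mult.commute)
      also have "(1/2::real) ^ 3 = 1/8" by (simp add: power3_eq_cube)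
      finally show ?thesis by (subst prod_Basis_vec) (simp add: inner_axis power_mult_distrib)
    qed
    finally show ?thesis .
  qed
  have le: "ennreal (indicator cube r *\<^sub>R (1 / (norm r)\<^sup>2)) \<le> (\<Sum>n. ennreal (4 ^ (n + 1)) * indicator (Q n) r)" for r :: "real^3"
  proof (cases "r \<in> cube \<and> r \<noteq> 0")
    case False
    then show ?thesis by (auto simp: indicator_def)
  next
    case True
    obtain j where j: "\<And>i. \<bar>r $ i\<bar> \<le> \<bar>r $ j\<bar>"
    proof -
      have "Max (range (\<lambda>i. \<bar>r $ i\<bar>)) \<in> range (\<lambda>i. \<bar>r $ i\<bar>)" by (intro Max_in) auto
      then obtain j where "Max (range (\<lambda>i. \<bar>r $ i\<bar>)) = \<bar>r $ j\<bar>" by (rule imageE)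
      then have "\<bar>r $ i\<bar> \<le> \<bar>r $ j\<bar>" for i using Max_ge[of "range (\<lambda>i. \<bar>r $ i\<bar>)" "\<bar>r $ i\<bar>"] by simp
      then show ?thesis by (rule that)
    qed
    have rj: "0 < \<bar>r $ j\<bar>" "\<bar>r $ j\<bar> \<le> 1"
    proof -
      from True obtain i where "r $ i \<noteq> 0" by (auto simp: vec_eq_iff)
      then show "0 < \<bar>r $ j\<bar>" using j[of i] by simp
      show "\<bar>r $ j\<bar> \<le> 1" using True by (auto simp: mem_cube_iff abs_le_iff minus_le_iff)
    qed
    \<comment> \<open>The least \<open>n\<close> with this property places the largest coordinate
      between two consecutive powers of 1/2, which gives both membership in \<open>Q n\<close> and
      the lower bound for the norm.\<close>
    define n where "n = (LEAST n. (1/2) ^ Suc n < \<bar>r $ j\<bar>)"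
    have "\<exists>n. (1/2::real) ^ n < \<bar>r $ j\<bar>" using rj by (intro real_arch_pow_inv) auto
    then obtain n0 where "(1/2::real) ^ n0 < \<bar>r $ j\<bar>" by blast
    moreover have "(1/2::real) ^ Suc n0 \<le> (1/2) ^ n0" by (intro power_decreasing) auto
    ultimately have "(1/2) ^ Suc n0 < \<bar>r $ j\<bar>" by linarith
    then have n1: "(1/2) ^ Suc n < \<bar>r $ j\<bar>" unfolding n_def by (rule LeastI)
    have n2: "\<bar>r $ j\<bar> \<le> (1/2) ^ n"
    proof (cases n)
      case (Suc m)
      then have "\<not> (1/2) ^ Suc m < \<bar>r $ j\<bar>" unfolding n_def by (metis not_less_Least lessI)
      then show ?thesis using Suc by simp
    qed (use rj in simp)
    have "r \<in> Q n" unfolding Q using j n2 order_trans by blast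
    have "((1/2) ^ Suc n)\<^sup>2 \<le> (norm r)\<^sup>2"
      using n1 component_le_norm_cart[of r j] by (intro power_mono) auto
    moreover have "((1/2) ^ Suc n)\<^sup>2 = 1 / (4::real) ^ (n + 1)"
      by (simp add: power_divide power2_eq_square flip: power_mult_distrib)
    ultimately have "1 / (norm r)\<^sup>2 \<le> 4 ^ (n + 1)" using True by (simp add: divide_simps mult.commute)
    then have "ennreal (indicator cube r *\<^sub>R (1 / (norm r)\<^sup>2)) \<le> ennreal (4 ^ (n + 1)) * indicator (Q n) r"
      using True \<open>r \<in> Q n\<close> by (simp add: ennreal_leI)
    also have "\<dots> \<le> (\<Sum>n. ennreal (4 ^ (n + 1)) * indicator (Q n) r)"
    proof -
      have "u n \<le> suminf u" for u :: "nat \<Rightarrow> ennreal" using sum_le_suminf[of u "{n}"] by simp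
      then show ?thesis .
    qed
    finally show ?thesis .
  qed
  have "(\<integral>\<^sup>+r. ennreal (indicator cube r *\<^sub>R (1 / (norm r)\<^sup>2)) \<partial>lborel) \<le>
      (\<integral>\<^sup>+r. (\<Sum>n. ennreal (4 ^ (n + 1)) * indicator (Q n) r) \<partial>lborel)"
    by (intro nn_integral_mono le)
  also have "\<dots> = (\<Sum>n. \<integral>\<^sup>+r. ennreal (4 ^ (n + 1)) * indicator (Q n) r \<partial>lborel)"
    by (rule nn_integral_suminf) (simp add: Q_def)
  \<comment> \<open>Volume 8 / 8 ^ n against the value 4 ^ (n + 1) leaves a convergent geometric
    series; three dimensions beat the exponent 2.\<close>
  also have "\<dots> = (\<Sum>n. ennreal (32 * (1/2) ^ n))"
  proof (rule suminf_cong)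
    fix n
    have "(4::real) ^ (n + 1) * (8 * (1/8) ^ n) = 32 * (1/2) ^ n"
      using power_mult_distrib[of "4::real" "1/8" n] by simp
    then show "(\<integral>\<^sup>+r. ennreal (4 ^ (n + 1)) * indicator (Q n) r \<partial>lborel) = ennreal (32 * (1/2) ^ n)"
    proof -
      have "(\<integral>\<^sup>+r. ennreal (4 ^ (n + 1)) * indicator (Q n) r \<partial>lborel) = ennreal (4 ^ (n + 1)) * emeasure lborel (Q n)"
        by (rule nn_integral_cmult_indicator) (simp add: Q_def)
      also have "\<dots> = ennreal (4 ^ (n + 1) * (8 * (1/8) ^ n))"
        unfolding eQ by (rule ennreal_mult[symmetric]) auto
      also note \<open>4 ^ (n + 1) * (8 * (1/8) ^ n) = 32 * (1/2) ^ n\<close>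
      finally show ?thesis .
    qed
  qed
  also have "\<dots> = ennreal (\<Sum>n. 32 * (1/2) ^ n)"
    by (rule suminf_ennreal2) (auto intro!: summable_mult summable_geometric)
  also have "\<dots> < \<infinity>" by simp
  finally show ?thesis
    unfolding set_integrable_def by (intro integrableI_nonneg) (auto simp: indicator_def)
qed

section \<open>The mollified kernel\<close>

locale filtered_kernel =
  fixes q :: nat and a :: "nat \<Rightarrow> complex" and w :: "nat \<Rightarrow> real" and C\<^sub>H \<kappa>\<^sub>0 \<gamma> \<theta> :: real
    and H :: "complex \<Rightarrow> complex"
  assumes q: "q \<ge> 1" and w: "\<forall>k\<in>{1..q}. w k \<noteq> 0" and H: "H = rational_filter q a w"
    and H_decay: "\<forall>z::real. z > 0 \<longrightarrow> cmod (H (of_real z)) \<le> C\<^sub>H * min 1 (1 / z ^ q)"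
    and pos: "\<kappa>\<^sub>0 > 0" "\<gamma> > 0" "0 < \<theta>" "\<theta> < 1"
begin

definition wmin :: real where "wmin = Min ((\<lambda>k. (w k)\<^sup>2) ` {1..q})"

lemma wmin_pos: "wmin > 0" and wmin_le: "k \<in> {1..q} \<Longrightarrow> wmin \<le> (w k)\<^sup>2"
proof -
  have "wmin \<in> (\<lambda>k. (w k)\<^sup>2) ` {1..q}" unfolding wmin_def using q by (intro Min_in) auto
  then show "wmin > 0" using w by auto
  show "k \<in> {1..q} \<Longrightarrow> wmin \<le> (w k)\<^sup>2" unfolding wmin_def by (intro Min_le) auto
qed

lemma C\<^sub>H_nonneg: "C\<^sub>H \<ge> 0"
proof -
  have "0 \<le> cmod (H (of_real 1))" by simp
  also have "\<dots> \<le> C\<^sub>H * min 1 (1 / 1 ^ q)" using H_decay[rule_format, of 1] by (simp only: zero_less_one)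
  finally show ?thesis by simp
qed

lemma H_le: "z > 0 \<Longrightarrow> cmod (H (of_real z)) \<le> C\<^sub>H" "z > 0 \<Longrightarrow> cmod (H (of_real z)) \<le> C\<^sub>H / z ^ q"
  using H_decay[rule_format, of z] C\<^sub>H_nonneg
    mult_left_mono[of "min 1 (1 / z ^ q)" 1 C\<^sub>H] mult_left_mono[of "min 1 (1 / z ^ q)" "1 / z ^ q" C\<^sub>H] by auto

lemma H_apply: "H z = rational_filter q a w z"
  by (simp add: H)

text \<open>A bound for \<open>H\<close> on the disc of radius \<theta> \<open>wmin\<close>, which
  keeps distance (1 - \<theta>) \<open>wmin\<close> from all poles. It serves below \<kappa> and on
  the indentation, where the argument of the filter is negative or complex and the decay hypothesis
  for z > 0 says nothing.\<close>

definition near_bound :: real where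
  "near_bound = (\<Sum>k=1..q. cmod (a k) / ((1 - \<theta>) * wmin) ^ card {j \<in> {1..k}. (w j)\<^sup>2 = (w k)\<^sup>2})"

lemma near_bound_nonneg: "near_bound \<ge> 0"
  unfolding near_bound_def using pos wmin_pos by (intro sum_nonneg) auto

lemma H_near: assumes "cmod z \<le> \<theta> * wmin" shows "cmod (H z) \<le> near_bound"
  unfolding H_apply rational_filter_def near_bound_def
proof (rule sum_norm_le)
  fix k assume k: "k \<in> {1..q}"
  have "(1 - \<theta>) * wmin \<le> (w k)\<^sup>2 - cmod z" using wmin_le[OF k] assms by (simp add: algebra_simps)
  also have "\<dots> \<le> cmod (of_real ((w k)\<^sup>2) + z)"
    using norm_diff_ineq[of "of_real ((w k)\<^sup>2)" z] by (simp del: of_real_power)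
  finally have "(1 - \<theta>) * wmin \<le> cmod (z + of_real ((w k)\<^sup>2))" by (simp add: add.commute)
  then show "cmod (a k / (z + of_real ((w k)\<^sup>2)) ^ card {j \<in> {1..k}. (w j)\<^sup>2 = (w k)\<^sup>2})
      \<le> cmod (a k) / ((1 - \<theta>) * wmin) ^ card {j \<in> {1..k}. (w j)\<^sup>2 = (w k)\<^sup>2}"
    unfolding norm_divide norm_power using pos wmin_pos
    by (intro frac_le power_mono zero_less_power mult_pos_pos norm_ge_zero order_refl mult_nonneg_nonneg) auto
qed

end

locale filtered_kernel_params = filtered_kernel +
  fixes \<kappa> \<delta> :: real
  assumes \<kappa>: "\<kappa> \<ge> \<kappa>\<^sub>0" and \<delta>_lower: "\<gamma> \<le> \<delta> * \<kappa>\<^sup>2" and \<delta>_upper: "\<delta> * \<kappa>\<^sup>2 \<le> \<theta> * wmin"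
begin

lemma \<kappa>_pos: "\<kappa> > 0" using \<kappa> pos by simp

lemma \<delta>_pos: "\<delta> > 0"
  using \<delta>_lower pos \<kappa>_pos by (metis zero_less_mult_pos2 zero_less_power less_le_trans)

section \<open>Size of the weight along the path\<close>

definition weight :: "complex \<Rightarrow> complex" where
  "weight \<rho> = H (of_real \<delta> * (\<rho>\<^sup>2 - (of_real \<kappa>)\<^sup>2)) * (\<rho>\<^sup>2 / (\<rho>\<^sup>2 - (of_real \<kappa>)\<^sup>2))"

lemma kernel_integrand_eq: "kernel_integrand H \<delta> \<kappa> r \<rho> = weight \<rho> * j0 (\<rho> * of_real (norm r))"
  by (simp add: kernel_integrand_def weight_def)

text \<open>At a pole the square of \<open>z\<close> would be \<kappa>^2 - (w k)^2 / \<delta>, which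
  is negative because \<delta> \<kappa>^2 < (w k)^2; so \<open>z\<close> would be purely imaginary
  and nonzero.\<close>

lemma filter_pole_free:
  assumes k: "k \<in> {1..q}" and z: "Re z > 0 \<or> Im z = 0"
  shows "of_real \<delta> * (z\<^sup>2 - (of_real \<kappa>)\<^sup>2) + of_real ((w k)\<^sup>2) \<noteq> 0"
proof
  assume 0: "of_real \<delta> * (z\<^sup>2 - (of_real \<kappa>)\<^sup>2) + of_real ((w k)\<^sup>2) = 0"
  have "(w k)\<^sup>2 > \<delta> * \<kappa>\<^sup>2"
    using wmin_le[OF k] \<delta>_upper wmin_pos pos mult_strict_right_mono[of \<theta> 1 wmin] by linarith
  moreover have "\<delta> * ((Re z)\<^sup>2 - (Im z)\<^sup>2 - \<kappa>\<^sup>2) + (w k)\<^sup>2 = 0"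
    using arg_cong[OF 0, of Re] by (simp add: Re_power2)
  ultimately have lt: "\<delta> * ((Re z)\<^sup>2 - (Im z)\<^sup>2) < 0" by (simp add: algebra_simps)
  have "\<delta> * (2 * Re z * Im z) = 0"
    using arg_cong[OF 0, of Im] by (simp add: Im_power2)
  then have "Re z = 0 \<or> Im z = 0" using \<delta>_pos by simp
  then have "Im z = 0" using z by auto
  then show False using lt \<delta>_pos by (simp add: mult_less_0_iff not_less)
qed

lemma holomorphic_weight:
  assumes "\<And>z. z \<in> T \<Longrightarrow> (Re z > 0 \<or> Im z = 0) \<and> z\<^sup>2 \<noteq> (of_real \<kappa>)\<^sup>2"
  shows "weight holomorphic_on T"
  unfolding weight_def[abs_def] H_apply rational_filter_def
  using assms filter_pole_free by (intro holomorphic_intros) auto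

lemma continuous_on_weight:
  assumes "continuous_on A f" and "\<And>x. x \<in> A \<Longrightarrow> (Re (f x) > 0 \<or> Im (f x) = 0) \<and> (f x)\<^sup>2 \<noteq> (of_real \<kappa>)\<^sup>2"
  shows "continuous_on A (\<lambda>x. weight (f x))"
proof -
  have "weight holomorphic_on (f ` A)" by (rule holomorphic_weight) (use assms(2) in auto)
  then show ?thesis
    by (intro continuous_on_compose2[OF holomorphic_on_imp_continuous_on assms(1)]) auto
qed

text \<open>A fixed radius keeps \<open>|Im \<rho>|\<close>, hence the exponential growth of \<open>j0 (\<rho> |r|)\<close>, bounded uniformly in \<open>\<kappa>\<close>.\<close>

definition indent :: real where "indent = \<kappa>\<^sub>0 / 3"

lemma indent: "0 < indent" "indent \<le> \<kappa> / 3"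
  using pos \<kappa> by (auto simp: indent_def)

lemma holomorphic_kernel_integrand:
  "kernel_integrand H \<delta> \<kappa> r holomorphic_on ({z. Re z > 0} - {z. Re z = \<kappa> \<and> Im z \<ge> 0})"
proof -
  let ?S = "{z. Re z > 0} - {z. Re z = \<kappa> \<and> Im z \<ge> 0}"
  have sq: "z\<^sup>2 \<noteq> (of_real \<kappa>)\<^sup>2" if "z \<in> ?S" for z
  proof
    assume "z\<^sup>2 = (of_real \<kappa>)\<^sup>2"
    then have "z = of_real \<kappa> \<or> z = - of_real \<kappa>" by (simp add: power2_eq_iff)
    then show False using that \<kappa>_pos by auto
  qed
  have w: "weight holomorphic_on ?S" by (rule holomorphic_weight) (use sq in auto)
  have j: "(\<lambda>z. j0 (z * of_real (norm r))) holomorphic_on ?S"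
  proof (cases "r = 0")
    case False
    have "(\<lambda>z. sin (z * of_real (norm r)) / (z * of_real (norm r))) holomorphic_on ?S"
      using False by (intro holomorphic_intros) auto
    then show ?thesis
      by (rule holomorphic_transform) (use False in \<open>auto simp: j0_def\<close>)
  qed (simp add: j0_def)
  show ?thesis unfolding kernel_integrand_eq[abs_def] by (intro holomorphic_on_mult w j)
qed

lemma measurable_weight [measurable]: "(\<lambda>\<rho>. weight (of_real \<rho>)) \<in> borel_measurable borel"
proof -
  have [measurable]: "complex_of_real \<in> borel_measurable borel"
    by (intro borel_measurable_continuous_onI continuous_intros)
  show ?thesis unfolding weight_def H_apply rational_filter_def by measurable
qed

lemma weight_integrable:
  assumes "\<And>\<rho>. \<rho> \<in> {x..y} \<Longrightarrow> \<rho> \<ge> 0 \<and> \<rho> \<noteq> \<kappa>"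
  shows "set_integrable lborel {x..y} (\<lambda>\<rho>. weight (of_real \<rho>))"
proof (rule borel_integrable_atLeastAtMost', rule continuous_on_weight)
  fix \<rho> assume "\<rho> \<in> {x..y}"
  then have "\<rho> \<ge> 0" "\<rho> \<noteq> \<kappa>" using assms by auto
  then have "(complex_of_real \<rho>)\<^sup>2 \<noteq> (of_real \<kappa>)\<^sup>2" using \<kappa>_pos
    by (metis less_imp_le of_real_eq_iff of_real_power power2_eq_imp_eq)
  then show "(Re (of_real \<rho>) > 0 \<or> Im (of_real \<rho>) = 0) \<and> (complex_of_real \<rho>)\<^sup>2 \<noteq> (of_real \<kappa>)\<^sup>2" by simp
qed (intro continuous_intros)

lemma norm_weight_real:
  assumes "\<rho> \<ge> 0" "\<rho> \<noteq> \<kappa>"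
  shows "cmod (weight (of_real \<rho>)) = cmod (H (of_real (\<delta> * (\<rho>\<^sup>2 - \<kappa>\<^sup>2)))) * (\<rho>\<^sup>2 / (\<bar>\<rho> - \<kappa>\<bar> * (\<rho> + \<kappa>)))"
proof -
  have "complex_of_real \<rho> ^ 2 - of_real \<kappa> ^ 2 = of_real (\<rho>\<^sup>2 - \<kappa>\<^sup>2)" by simp
  then have "weight (of_real \<rho>) = H (of_real (\<delta> * (\<rho>\<^sup>2 - \<kappa>\<^sup>2))) * of_real (\<rho>\<^sup>2 / (\<rho>\<^sup>2 - \<kappa>\<^sup>2))"
    unfolding weight_def by (simp only: of_real_mult of_real_divide of_real_power)
  then have "cmod (weight (of_real \<rho>)) = cmod (H (of_real (\<delta> * (\<rho>\<^sup>2 - \<kappa>\<^sup>2)))) * \<bar>\<rho>\<^sup>2 / (\<rho>\<^sup>2 - \<kappa>\<^sup>2)\<bar>"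
    by (simp only: norm_mult norm_of_real)
  also have "\<bar>\<rho>\<^sup>2 / (\<rho>\<^sup>2 - \<kappa>\<^sup>2)\<bar> = \<rho>\<^sup>2 / (\<bar>\<rho> - \<kappa>\<bar> * (\<rho> + \<kappa>))"
  proof -
    have "\<rho>\<^sup>2 - \<kappa>\<^sup>2 = (\<rho> - \<kappa>) * (\<rho> + \<kappa>)" by (simp add: power2_eq_square algebra_simps)
    then show ?thesis using assms \<kappa>_pos by (simp add: abs_mult)
  qed
  finally show ?thesis .
qed

text \<open>The argument of the filter stays between - \<delta> \<kappa>^2 and 0, inside the disc of
  \<open>H_near\<close>. What remains is the simple pole at \<kappa>, with residue of order
  \<kappa>.\<close>

lemma weight_below:
  assumes "0 \<le> \<rho>" "\<rho> < \<kappa>"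
  shows "cmod (weight (of_real \<rho>)) \<le> near_bound * (\<kappa> / (\<kappa> - \<rho>))"
proof -
  have "\<rho>\<^sup>2 \<le> \<kappa>\<^sup>2" using assms by (intro power_mono) auto
  then have "cmod (of_real (\<delta> * (\<rho>\<^sup>2 - \<kappa>\<^sup>2))) = \<delta> * (\<kappa>\<^sup>2 - \<rho>\<^sup>2)"
    unfolding norm_of_real using \<delta>_pos by (simp add: abs_mult)
  also have "\<dots> \<le> \<delta> * \<kappa>\<^sup>2" using \<delta>_pos by simp
  also note \<delta>_upper
  finally have Hb: "cmod (H (of_real (\<delta> * (\<rho>\<^sup>2 - \<kappa>\<^sup>2)))) \<le> near_bound" by (rule H_near)
  have "\<rho>\<^sup>2 / (\<kappa> + \<rho>) \<le> \<kappa>"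
  proof -
    have "\<rho>\<^sup>2 \<le> \<kappa> * (\<kappa> + \<rho>)"
      using \<open>\<rho>\<^sup>2 \<le> \<kappa>\<^sup>2\<close> assms by (simp add: power2_eq_square algebra_simps) (smt (verit) mult_nonneg_nonneg)
    then show ?thesis using assms by (simp add: divide_simps)
  qed
  then have le: "\<rho>\<^sup>2 / (\<kappa> + \<rho>) / (\<kappa> - \<rho>) \<le> \<kappa> / (\<kappa> - \<rho>)" using assms by (intro divide_right_mono) auto
  have "\<rho>\<^sup>2 / (\<bar>\<rho> - \<kappa>\<bar> * (\<rho> + \<kappa>)) = \<rho>\<^sup>2 / (\<kappa> + \<rho>) / (\<kappa> - \<rho>)" using assms by (simp add: field_simps)
  also note le
  finally have "\<rho>\<^sup>2 / (\<bar>\<rho> - \<kappa>\<bar> * (\<rho> + \<kappa>)) \<le> \<kappa> / (\<kappa> - \<rho>)" .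
  from mult_mono[OF Hb this near_bound_nonneg] show ?thesis
    using norm_weight_real[of \<rho>] assms by simp
qed

text \<open>Besides the simple pole a constant term survives; integrated up to 2 N, it produces the
  contribution of order \<open>N\<close>.\<close>

lemma weight_above:
  assumes "\<kappa> < \<rho>"
  shows "cmod (weight (of_real \<rho>)) \<le> C\<^sub>H * (1 + \<kappa> / (\<rho> - \<kappa>))"
proof -
  have "\<kappa>\<^sup>2 < \<rho>\<^sup>2" using assms \<kappa>_pos by (intro power_strict_mono) auto
  then have Hb: "cmod (H (of_real (\<delta> * (\<rho>\<^sup>2 - \<kappa>\<^sup>2)))) \<le> C\<^sub>H" using \<delta>_pos by (intro H_le(1)) simp
  have "\<rho>\<^sup>2 / (\<bar>\<rho> - \<kappa>\<bar> * (\<rho> + \<kappa>)) = (\<rho> / (\<rho> + \<kappa>)) * (\<rho> / (\<rho> - \<kappa>))"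
    using assms by (simp add: power2_eq_square mult_ac)
  also have "\<dots> \<le> 1 * (\<rho> / (\<rho> - \<kappa>))" using assms \<kappa>_pos by (intro mult_right_mono) (auto simp: divide_simps)
  also have "\<dots> = 1 + \<kappa> / (\<rho> - \<kappa>)" using assms by (simp add: field_simps)
  finally have "\<rho>\<^sup>2 / (\<bar>\<rho> - \<kappa>\<bar> * (\<rho> + \<kappa>)) \<le> 1 + \<kappa> / (\<rho> - \<kappa>)" .
  from mult_mono[OF Hb this C\<^sub>H_nonneg] show ?thesis
    using norm_weight_real[of \<rho>] assms \<kappa>_pos by simp
qed

text \<open>For \<rho> \<ge> 2 \<kappa> one has \<rho>^2 - \<kappa>^2 \<ge> 3/4 \<rho>^2. This gives
  the last factor 4/3 for the quotient and, with \<delta> \<ge> \<gamma> / \<kappa>^2, the q-th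
  power from the decay of the filter.\<close>

definition far_const :: real where "far_const = C\<^sub>H * (4 / (3 * \<gamma>)) ^ q * (4 / 3)"

lemma far_const_nonneg: "far_const \<ge> 0"
  unfolding far_const_def using C\<^sub>H_nonneg pos by simp

lemma weight_far:
  assumes "2 * \<kappa> \<le> \<rho>"
  shows "cmod (weight (of_real \<rho>)) \<le> far_const * (\<kappa> / \<rho>) ^ (2 * q)"
proof -
  have \<rho>: "\<rho> > 0" using assms \<kappa>_pos by simp
  have "(2 * \<kappa>)\<^sup>2 \<le> \<rho>\<^sup>2" using assms \<kappa>_pos by (intro power_mono) auto
  then have d: "\<rho>\<^sup>2 - \<kappa>\<^sup>2 \<ge> 3/4 * \<rho>\<^sup>2" by (simp add: power_mult_distrib)
  have "(3 * \<gamma> / 4) * (\<rho> / \<kappa>)\<^sup>2 = (\<gamma> / \<kappa>\<^sup>2) * (3/4 * \<rho>\<^sup>2)" by (simp add: power_divide)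
  also have "\<dots> \<le> \<delta> * (\<rho>\<^sup>2 - \<kappa>\<^sup>2)"
    using d \<delta>_lower \<kappa>_pos \<delta>_pos by (intro mult_mono) (auto simp: divide_simps)
  finally have z: "(3 * \<gamma> / 4) * (\<rho> / \<kappa>)\<^sup>2 \<le> \<delta> * (\<rho>\<^sup>2 - \<kappa>\<^sup>2)" .
  have z0: "0 < (3 * \<gamma> / 4) * (\<rho> / \<kappa>)\<^sup>2" using pos \<rho> \<kappa>_pos by simp
  have "cmod (H (of_real (\<delta> * (\<rho>\<^sup>2 - \<kappa>\<^sup>2)))) \<le> C\<^sub>H / (\<delta> * (\<rho>\<^sup>2 - \<kappa>\<^sup>2)) ^ q"
    using z z0 by (intro H_le(2)) simp
  also have "\<dots> \<le> C\<^sub>H / ((3 * \<gamma> / 4) * (\<rho> / \<kappa>)\<^sup>2) ^ q"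
    using z z0 by (intro frac_le[OF C\<^sub>H_nonneg order_refl] power_mono zero_less_power) auto
  also have "\<dots> = C\<^sub>H * (4 / (3 * \<gamma>)) ^ q * (\<kappa> / \<rho>) ^ (2 * q)"
    unfolding power_mult[of "\<kappa> / \<rho>"] using \<rho> \<kappa>_pos by (simp add: power_mult_distrib power_divide field_simps)
  finally have Hb: "cmod (H (of_real (\<delta> * (\<rho>\<^sup>2 - \<kappa>\<^sup>2)))) \<le> C\<^sub>H * (4 / (3 * \<gamma>)) ^ q * (\<kappa> / \<rho>) ^ (2 * q)" .
  have "\<rho>\<^sup>2 / (\<bar>\<rho> - \<kappa>\<bar> * (\<rho> + \<kappa>)) = \<rho>\<^sup>2 / (\<rho>\<^sup>2 - \<kappa>\<^sup>2)"
    using assms \<kappa>_pos by (simp add: power2_eq_square algebra_simps)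
  also have "\<dots> \<le> 4 / 3" using d \<rho> by (simp add: divide_simps) (smt (verit) zero_less_power)
  finally have r: "\<rho>\<^sup>2 / (\<bar>\<rho> - \<kappa>\<bar> * (\<rho> + \<kappa>)) \<le> 4 / 3" .
  have "0 \<le> C\<^sub>H * (4 / (3 * \<gamma>)) ^ q * (\<kappa> / \<rho>) ^ (2 * q)" using C\<^sub>H_nonneg pos \<rho> \<kappa>_pos by simp
  from mult_mono[OF Hb r this]
  have "cmod (weight (of_real \<rho>)) \<le> (C\<^sub>H * (4 / (3 * \<gamma>)) ^ q * (\<kappa> / \<rho>) ^ (2 * q)) * (4 / 3)"
    using norm_weight_real[of \<rho>] assms \<kappa>_pos by simp
  then show ?thesis by (simp add: far_const_def mult_ac)
qed

text \<open>The factor \<open>indent\<close> is the speed of the arc; it cancels the pole, so the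
  estimate is of order \<kappa> even though the radius does not grow with \<kappa>.\<close>

lemma weight_indentation:
  assumes "Re z \<ge> \<kappa> - indent" "cmod (z - of_real \<kappa>) = indent"
  shows "cmod (weight z) * indent \<le> near_bound * (2 * \<kappa>)"
proof -
  have cz: "cmod z \<le> \<kappa> + indent"
    using norm_triangle_sub[of z "of_real \<kappa>"] assms \<kappa>_pos by simp
  have dec: "z\<^sup>2 - (of_real \<kappa>)\<^sup>2 = (z - of_real \<kappa>) * (z + of_real \<kappa>)"
    by (simp add: power2_eq_square algebra_simps)
  have up: "cmod (z + of_real \<kappa>) \<le> 2 * \<kappa> + indent"
    using norm_triangle_ineq[of z "of_real \<kappa>"] cz \<kappa>_pos by simp
  have low: "cmod (z + of_real \<kappa>) \<ge> \<kappa> + 2/3 * \<kappa>"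
    using complex_Re_le_cmod[of "z + of_real \<kappa>"] assms indent by simp
  have "cmod (of_real \<delta> * (z\<^sup>2 - (of_real \<kappa>)\<^sup>2)) = \<delta> * (indent * cmod (z + of_real \<kappa>))"
    unfolding dec using \<delta>_pos assms by (simp add: norm_mult)
  \<comment> \<open>This product is 7/9 \<delta> \<kappa>^2, so a radius of at most \<kappa> / 3
    keeps the argument of the filter inside the disc of \<open>H_near\<close>.\<close>
  also have "\<dots> \<le> \<delta> * (\<kappa> / 3 * (2 * \<kappa> + \<kappa> / 3))"
    using up indent \<delta>_pos \<kappa>_pos by (intro mult_left_mono mult_mono) auto
  also have "\<dots> \<le> \<delta> * \<kappa>\<^sup>2" using \<delta>_pos \<kappa>_pos by (simp add: power2_eq_square)
  also note \<delta>_upper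
  finally have Hb: "cmod (H (of_real \<delta> * (z\<^sup>2 - (of_real \<kappa>)\<^sup>2))) \<le> near_bound" by (rule H_near)
  have "cmod (z\<^sup>2 / (z\<^sup>2 - (of_real \<kappa>)\<^sup>2)) * indent = (cmod z)\<^sup>2 / cmod (z + of_real \<kappa>)"
    unfolding dec using assms indent by (simp add: norm_divide norm_mult norm_power)
  also have "\<dots> \<le> (\<kappa> + \<kappa>/3)\<^sup>2 / (\<kappa> + 2/3 * \<kappa>)"
    using cz indent low \<kappa>_pos by (intro frac_le power_mono) auto
  also have "\<dots> \<le> 2 * \<kappa>" using \<kappa>_pos by (simp add: divide_simps power2_eq_square)
  finally have "cmod (z\<^sup>2 / (z\<^sup>2 - (of_real \<kappa>)\<^sup>2)) * indent \<le> 2 * \<kappa>" .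
  from mult_mono[OF Hb this near_bound_nonneg]
  have "cmod (H (of_real \<delta> * (z\<^sup>2 - (of_real \<kappa>)\<^sup>2))) * (cmod (z\<^sup>2 / (z\<^sup>2 - (of_real \<kappa>)\<^sup>2)) * indent) \<le> near_bound * (2 * \<kappa>)"
    using indent by simp
  then show ?thesis unfolding weight_def norm_mult by (simp only: mult.assoc)
qed

end

lemma norm_j0_real:
  "cmod (j0 (of_real x)) \<le> 1" "x \<noteq> 0 \<Longrightarrow> cmod (j0 (of_real x)) \<le> 1 / \<bar>x\<bar>"
proof -
  have eq: "cmod (j0 (of_real x)) = \<bar>sin x\<bar> / \<bar>x\<bar>" if "x \<noteq> 0"
    using that by (simp add: j0_def sin_of_real norm_divide)
  show "cmod (j0 (of_real x)) \<le> 1"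
    using abs_sin_x_le_abs_x[of x] by (cases "x = 0") (simp_all add: eq j0_def[of 0])
  show "x \<noteq> 0 \<Longrightarrow> cmod (j0 (of_real x)) \<le> 1 / \<bar>x\<bar>"
    by (simp add: eq divide_right_mono)
qed

lemma integral_norm_le_antiderivative:
  fixes W :: "real \<Rightarrow> complex"
  assumes xy: "x \<le> y" and W: "set_integrable lborel {x..y} W"
    and le: "\<And>\<rho>. \<rho> \<in> {x..y} \<Longrightarrow> cmod (W \<rho>) \<le> F' \<rho>"
    and F: "\<And>\<rho>. \<rho> \<in> {x..y} \<Longrightarrow> (F has_real_derivative F' \<rho>) (at \<rho>)" and F': "continuous_on {x..y} F'"
  shows "(LINT \<rho>|lborel. cmod (indicator {x..y} \<rho> *\<^sub>R W \<rho>)) \<le> F y - F x"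
proof -
  have "(LINT \<rho>|lborel. cmod (indicator {x..y} \<rho> *\<^sub>R W \<rho>)) \<le> (LINT \<rho>|lborel. indicator {x..y} \<rho> *\<^sub>R F' \<rho>)"
  proof (rule integral_mono)
    show "integrable lborel (\<lambda>\<rho>. cmod (indicator {x..y} \<rho> *\<^sub>R W \<rho>))"
      using W unfolding set_integrable_def by (rule integrable_norm)
    show "integrable lborel (\<lambda>\<rho>. indicator {x..y} \<rho> *\<^sub>R F' \<rho>)"
      using borel_integrable_atLeastAtMost'[OF F'] unfolding set_integrable_def .
    show "cmod (indicator {x..y} \<rho> *\<^sub>R W \<rho>) \<le> indicator {x..y} \<rho> *\<^sub>R F' \<rho>" for \<rho>
      using le[of \<rho>] by (cases "\<rho> \<in> {x..y}") auto
  qed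
  also have "\<dots> = F y - F x"
    by (rule integral_FTC_atLeastAtMost[OF xy _ F'])
       (use F in \<open>auto simp: has_real_derivative_iff_has_vector_derivative intro: has_vector_derivative_at_within\<close>)
  finally show ?thesis .
qed

context filtered_kernel_params
begin

section \<open>The four pieces of the path\<close>

definition arc :: "real \<Rightarrow> complex" where "arc t = of_real \<kappa> + of_real indent * cis t"

lemma arc_bounds:
  "Re (arc t) \<ge> \<kappa> - indent" "cmod (arc t - of_real \<kappa>) = indent" "\<bar>Im (arc t)\<bar> \<le> indent"
  "cmod (arc t) \<le> \<kappa> + indent"
proof -
  have c: "- cos t \<le> 1" by (simp add: minus_le_iff)
  from mult_left_mono[OF this, of indent] indent show "Re (arc t) \<ge> \<kappa> - indent" by (simp add: arc_def)
  show n: "cmod (arc t - of_real \<kappa>) = indent" using indent by (simp add: arc_def norm_mult)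
  show "\<bar>Im (arc t)\<bar> \<le> indent" using abs_Im_le_cmod[of "arc t - of_real \<kappa>"] n by simp
  show "cmod (arc t) \<le> \<kappa> + indent"
    using norm_triangle_sub[of "arc t" "of_real \<kappa>"] n \<kappa>_pos by simp
qed

lemma arc_slit:
  assumes "t \<in> {pi..2*pi}" shows "arc t \<in> {z. Re z > 0} - {z. Re z = \<kappa> \<and> Im z \<ge> 0}"
  unfolding arc_def using indent \<kappa>_pos by (intro lower_semicircle_in_slit_plane assms) auto

text \<open>Densities for \<open>superpose\<close> on the four pieces, extended by 0 to the whole
  line. \<open>W_arc\<close> contains the derivative of \<open>arc\<close>. The far interval is
  half-open so that it is disjoint from the one before it.\<close>

definition W_below :: "real \<Rightarrow> complex" where "W_below \<rho> = indicator {0..\<kappa> - indent} \<rho> *\<^sub>R weight (of_real \<rho>)"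
definition W_above :: "nat \<Rightarrow> real \<Rightarrow> complex" where "W_above N \<rho> = indicator {\<kappa> + indent..2 * real N} \<rho> *\<^sub>R weight (of_real \<rho>)"
definition W_arc :: "real \<Rightarrow> complex" where "W_arc t = indicator {pi..2*pi} t *\<^sub>R (weight (arc t) * of_real indent * \<i> * cis t)"
definition W_far :: "nat \<Rightarrow> real \<Rightarrow> complex" where "W_far N \<rho> = indicator {2 * real N<..} \<rho> *\<^sub>R weight (of_real \<rho>)"

lemma integrable_W_below: "integrable lborel W_below"
  unfolding W_below_def set_integrable_def[symmetric]
  by (rule weight_integrable) (use indent in auto)

lemma integrable_W_above: "integrable lborel (W_above N)"
  unfolding W_above_def set_integrable_def[symmetric]
  by (rule weight_integrable) (use indent \<kappa>_pos in auto)

lemma continuous_arc_weight: "continuous_on {pi..2*pi} (\<lambda>t. weight (arc t) * of_real indent * \<i> * cis t)"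
proof -
  have "continuous_on {pi..2*pi} (\<lambda>t. weight (arc t))"
  proof (rule continuous_on_weight)
    show "continuous_on {pi..2*pi} arc" unfolding arc_def[abs_def] by (intro continuous_intros)
    fix t assume t: "t \<in> {pi..2*pi}"
    have "(arc t)\<^sup>2 \<noteq> (of_real \<kappa>)\<^sup>2"
    proof
      assume "(arc t)\<^sup>2 = (of_real \<kappa>)\<^sup>2"
      then have "arc t = of_real \<kappa> \<or> arc t = - of_real \<kappa>" by (simp add: power2_eq_iff)
      then show False using arc_slit[OF t] \<kappa>_pos by auto
    qed
    then show "(Re (arc t) > 0 \<or> Im (arc t) = 0) \<and> (arc t)\<^sup>2 \<noteq> (of_real \<kappa>)\<^sup>2"
      using arc_slit[OF t] by auto
  qed
  then show ?thesis by (intro continuous_intros)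
qed

lemma integrable_W_arc: "integrable lborel W_arc"
  unfolding W_arc_def set_integrable_def[symmetric]
  by (rule borel_integrable_atLeastAtMost'[OF continuous_arc_weight])

text \<open>Two of the 2 q powers of \<kappa> / \<rho> are kept for integrability at infinity; in
  the others \<rho> is replaced by the smaller \<open>N\<close>.\<close>

lemma weight_far_le:
  assumes "\<kappa> \<le> real N" and "\<rho> > 2 * real N"
  shows "cmod (weight (of_real \<rho>)) \<le> far_const * (\<kappa> / real N) ^ (2 * q - 2) * \<kappa>\<^sup>2 * (1 / \<rho> ^ 2)"
proof -
  have \<rho>: "\<rho> > 0" and N: "real N > 0" using assms \<kappa>_pos by linarith+
  have "2 * q = (2 * q - 2) + 2" using q by simp
  then have "(\<kappa> / \<rho>) ^ (2 * q) = (\<kappa> / \<rho>) ^ (2 * q - 2) * (\<kappa> / \<rho>) ^ 2" by (metis power_add)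
  also have "\<dots> \<le> (\<kappa> / real N) ^ (2 * q - 2) * (\<kappa> / \<rho>) ^ 2"
    using \<kappa>_pos \<rho> N assms by (intro mult_right_mono power_mono divide_left_mono) auto
  finally have "(\<kappa> / \<rho>) ^ (2 * q) \<le> (\<kappa> / real N) ^ (2 * q - 2) * (\<kappa>\<^sup>2 * (1 / \<rho> ^ 2))" by (simp add: power_divide)
  from mult_left_mono[OF this far_const_nonneg] show ?thesis
    using weight_far[of \<rho>] assms by (simp add: mult.assoc)
qed

lemma integrable_W_far:
  assumes "\<kappa> \<le> real N" shows "integrable lborel (W_far N)"
proof -
  have "set_integrable lborel {2 * real N<..} (\<lambda>\<rho>. 1 / \<rho> ^ 2)"
    by (rule set_integral_inverse_power) (use assms \<kappa>_pos in auto)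
  then have i: "integrable lborel (\<lambda>\<rho>. far_const * (\<kappa> / real N) ^ (2 * q - 2) * \<kappa>\<^sup>2 * (indicator {2 * real N<..} \<rho> *\<^sub>R (1 / \<rho> ^ 2)))"
    unfolding set_integrable_def by (intro integrable_mult_right)
  have m: "W_far N \<in> borel_measurable lborel" unfolding W_far_def[abs_def] by measurable
  show ?thesis
  proof (rule Bochner_Integration.integrable_bound[OF i m], rule AE_I2)
    fix \<rho>
    show "norm (W_far N \<rho>) \<le> norm (far_const * (\<kappa> / real N) ^ (2 * q - 2) * \<kappa>\<^sup>2 * (indicator {2 * real N<..} \<rho> *\<^sub>R (1 / \<rho> ^ 2)))"
    proof (cases "\<rho> > 2 * real N")
      case True
      have "norm (W_far N \<rho>) = cmod (weight (of_real \<rho>))" using True by (simp add: W_far_def)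
      also note weight_far_le[OF assms True]
      also have "far_const * (\<kappa> / real N) ^ (2 * q - 2) * \<kappa>\<^sup>2 * (1 / \<rho> ^ 2) \<le>
          norm (far_const * (\<kappa> / real N) ^ (2 * q - 2) * \<kappa>\<^sup>2 * (indicator {2 * real N<..} \<rho> *\<^sub>R (1 / \<rho> ^ 2)))"
        using True by (simp only: indicator_simps greaterThan_iff scaleR_one real_norm_def abs_ge_self)
      finally show ?thesis .
    qed (simp add: W_far_def)
  qed
qed

lemma set_integrable_kernel_integrand:
  assumes [measurable]: "A \<in> sets borel" and A: "set_integrable lborel A (\<lambda>\<rho>. weight (of_real \<rho>))"
  shows "set_integrable lborel A (\<lambda>\<rho>. kernel_integrand H \<delta> \<kappa> r (of_real \<rho>))"
proof -
  have [measurable]: "complex_of_real \<in> borel_measurable borel"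
    by (intro borel_measurable_continuous_onI continuous_intros)
  show ?thesis
    unfolding set_integrable_def
  proof (rule Bochner_Integration.integrable_bound[OF A[unfolded set_integrable_def]])
    show "(\<lambda>\<rho>. indicator A \<rho> *\<^sub>R kernel_integrand H \<delta> \<kappa> r (of_real \<rho>)) \<in> borel_measurable lborel"
      unfolding kernel_integrand_eq by measurable
    show "AE \<rho> in lborel. norm (indicator A \<rho> *\<^sub>R kernel_integrand H \<delta> \<kappa> r (of_real \<rho>)) \<le> norm (indicator A \<rho> *\<^sub>R weight (of_real \<rho>))"
    proof (rule AE_I2)
      fix \<rho>
      have "cmod (weight (of_real \<rho>)) * cmod (j0 (of_real (\<rho> * norm r))) \<le> cmod (weight (of_real \<rho>))"
        by (rule mult_left_le[OF norm_j0_real(1) norm_ge_zero])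
      then show "norm (indicator A \<rho> *\<^sub>R kernel_integrand H \<delta> \<kappa> r (of_real \<rho>)) \<le> norm (indicator A \<rho> *\<^sub>R weight (of_real \<rho>))"
        unfolding kernel_integrand_eq by (simp add: norm_mult mult_left_mono)
    qed
  qed
qed

text \<open>Shrinking the semicircle from radius \<kappa> / 2 to \<open>indent\<close> creates two
  real segments, which join the neighbouring real integrals; the upper real part is then cut at 2
  N.\<close>

lemma mollified_kernel_split:
  assumes N: "\<kappa> \<le> real N"
  shows "mollified_kernel H \<delta> \<kappa> r = 1 / (2 * (of_real pi)\<^sup>2) *
     ((LINT \<rho>|lborel. W_below \<rho> * j0 (of_real \<rho> * of_real (norm r))) +
      (LINT \<rho>|lborel. W_above N \<rho> * j0 (of_real \<rho> * of_real (norm r))) +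
      (LINT t|lborel. W_arc t * j0 (arc t * of_real (norm r))) +
      (LINT \<rho>|lborel. W_far N \<rho> * j0 (of_real \<rho> * of_real (norm r))))"
proof -
  let ?f = "\<lambda>\<rho>. kernel_integrand H \<delta> \<kappa> r (of_real \<rho>)"
  have e: "indent > 0" "indent \<le> \<kappa> / 2" "\<kappa> / 2 < \<kappa>" using indent \<kappa>_pos by auto
  have si: "set_integrable lborel {x..y} ?f" if "\<And>\<rho>. \<rho> \<in> {x..y} \<Longrightarrow> \<rho> \<ge> 0 \<and> \<rho> \<noteq> \<kappa>" for x y
    by (rule set_integrable_kernel_integrand[OF _ weight_integrable[OF that]]) auto
  have circ: "contour_integral (part_circlepath (of_real \<kappa>) (\<kappa>/2) pi (2*pi)) (kernel_integrand H \<delta> \<kappa> r) =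
     integral {\<kappa>/2..\<kappa> - indent} ?f +
     contour_integral (part_circlepath (of_real \<kappa>) indent pi (2*pi)) (kernel_integrand H \<delta> \<kappa> r) +
     integral {\<kappa> + indent..3*\<kappa>/2} ?f"
    using shrink_indentation[OF e holomorphic_kernel_integrand[of r]] by simp
  have below: "(LINT \<rho>:{0..\<kappa>/2}|lborel. ?f \<rho>) + integral {\<kappa>/2..\<kappa> - indent} ?f = (LINT \<rho>:{0..\<kappa> - indent}|lborel. ?f \<rho>)"
  proof -
    have i: "set_integrable lborel {0..\<kappa>/2} ?f" "set_integrable lborel {0..\<kappa> - indent} ?f"
      by (rule si, use e in auto)+
    show ?thesis
      unfolding set_borel_integral_eq_integral(2)[OF i(1)] set_borel_integral_eq_integral(2)[OF i(2)]
      by (rule Henstock_Kurzweil_Integration.integral_combine) (use e set_borel_integral_eq_integral(1)[OF i(2)] in auto)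
  qed
  \<comment> \<open>Since \<kappa> \<le> N, the new cut at 2 N lies to the right of 3 \<kappa> /
    2.\<close>
  have above: "integral {\<kappa> + indent..3*\<kappa>/2} ?f + (LINT \<rho>:{3*\<kappa>/2..}|lborel. ?f \<rho>) =
     (LINT \<rho>:{\<kappa> + indent..2 * real N}|lborel. ?f \<rho>) + (LINT \<rho>:{2 * real N<..}|lborel. ?f \<rho>)"
  proof -
    have i: "set_integrable lborel {3*\<kappa>/2..2 * real N} ?f" "set_integrable lborel {\<kappa> + indent..2 * real N} ?f"
      by (rule si, use e in auto)+
    have far: "set_integrable lborel {2 * real N<..} ?f"
      by (rule set_integrable_kernel_integrand) (use integrable_W_far[OF N] in \<open>auto simp: set_integrable_def W_far_def[abs_def]\<close>)
    have "{3*\<kappa>/2..} = {3*\<kappa>/2..2 * real N} \<union> {2 * real N<..}" using N \<kappa>_pos by auto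
    then have "(LINT \<rho>:{3*\<kappa>/2..}|lborel. ?f \<rho>) = (LINT \<rho>:{3*\<kappa>/2..2 * real N}|lborel. ?f \<rho>) + (LINT \<rho>:{2 * real N<..}|lborel. ?f \<rho>)"
    proof -
      have "{3*\<kappa>/2..2 * real N} \<inter> {2 * real N<..} = {}" by auto
      from set_integral_Un[OF this i(1) far] show ?thesis
        using \<open>{3*\<kappa>/2..} = {3*\<kappa>/2..2 * real N} \<union> {2 * real N<..}\<close> by simp
    qed
    moreover have "integral {\<kappa> + indent..3*\<kappa>/2} ?f + (LINT \<rho>:{3*\<kappa>/2..2 * real N}|lborel. ?f \<rho>) = (LINT \<rho>:{\<kappa> + indent..2 * real N}|lborel. ?f \<rho>)"
      unfolding set_borel_integral_eq_integral(2)[OF i(1)] set_borel_integral_eq_integral(2)[OF i(2)]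
      by (rule Henstock_Kurzweil_Integration.integral_combine) (use e N \<kappa>_pos set_borel_integral_eq_integral(1)[OF i(2)] in auto)
    ultimately show ?thesis by (simp add: add.assoc)
  qed
  have arc: "contour_integral (part_circlepath (of_real \<kappa>) indent pi (2*pi)) (kernel_integrand H \<delta> \<kappa> r) =
     (LINT t|lborel. W_arc t * j0 (arc t * of_real (norm r)))"
  proof -
    have c: "continuous_on {pi..2*pi} (\<lambda>t. kernel_integrand H \<delta> \<kappa> r (arc t) * of_real indent * \<i> * cis t)"
    proof -
      have "continuous_on {pi..2*pi} arc" unfolding arc_def[abs_def] by (intro continuous_intros)
      then have "continuous_on {pi..2*pi} (\<lambda>t. kernel_integrand H \<delta> \<kappa> r (arc t))"
        by (rule continuous_on_compose2[OF holomorphic_on_imp_continuous_on[OF holomorphic_kernel_integrand]])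
           (rule image_subsetI[OF arc_slit])
      then show ?thesis by (intro continuous_intros)
    qed
    have "contour_integral (part_circlepath (of_real \<kappa>) indent pi (2*pi)) (kernel_integrand H \<delta> \<kappa> r) =
       integral {pi..2*pi} (\<lambda>t. kernel_integrand H \<delta> \<kappa> r (arc t) * of_real indent * \<i> * cis t)"
      by (subst contour_integral_part_circlepath_eq) (simp_all add: arc_def)
    also have "\<dots> = (LINT t:{pi..2*pi}|lborel. kernel_integrand H \<delta> \<kappa> r (arc t) * of_real indent * \<i> * cis t)"
      by (rule set_borel_integral_eq_integral(2)[symmetric, OF borel_integrable_atLeastAtMost'[OF c]])
    also have "\<dots> = (LINT t|lborel. W_arc t * j0 (arc t * of_real (norm r)))"
      unfolding set_lebesgue_integral_def W_arc_def kernel_integrand_eq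
      by (intro Bochner_Integration.integral_cong) (simp_all add: mult_ac)
    finally show ?thesis .
  qed
  have real: "(LINT \<rho>:A|lborel. ?f \<rho>) = (LINT \<rho>|lborel. (indicator A \<rho> *\<^sub>R weight (of_real \<rho>)) * j0 (of_real \<rho> * of_real (norm r)))" for A
    unfolding set_lebesgue_integral_def kernel_integrand_eq by simp
  have "(LINT \<rho>:{0..\<kappa>/2}|lborel. ?f \<rho>) +
      contour_integral (part_circlepath (of_real \<kappa>) (\<kappa>/2) pi (2*pi)) (kernel_integrand H \<delta> \<kappa> r) +
      (LINT \<rho>:{3*\<kappa>/2..}|lborel. ?f \<rho>) =
      ((LINT \<rho>:{0..\<kappa>/2}|lborel. ?f \<rho>) + integral {\<kappa>/2..\<kappa> - indent} ?f) +
      (integral {\<kappa> + indent..3*\<kappa>/2} ?f + (LINT \<rho>:{3*\<kappa>/2..}|lborel. ?f \<rho>)) +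
      contour_integral (part_circlepath (of_real \<kappa>) indent pi (2*pi)) (kernel_integrand H \<delta> \<kappa> r)"
    unfolding circ by (simp only: add_ac)
  also note below
  also note above
  also note arc
  finally show ?thesis
    unfolding mollified_kernel_def real W_below_def W_above_def W_far_def by (simp only: add_ac)
qed

text \<open>The majorant with its simple pole has a logarithmic antiderivative; stopping at distance
  \<open>indent\<close> from \<kappa> makes the logarithm finite.\<close>

lemma integral_norm_W_below: "(LINT \<rho>|lborel. cmod (W_below \<rho>)) \<le> near_bound * \<kappa> * ln (\<kappa> / indent)"
proof -
  have "(LINT \<rho>|lborel. cmod (W_below \<rho>)) \<le> - near_bound * \<kappa> * ln (\<kappa> - (\<kappa> - indent)) - - near_bound * \<kappa> * ln (\<kappa> - 0)"
    unfolding W_below_def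
  proof (rule integral_norm_le_antiderivative[where F' = "\<lambda>\<rho>. near_bound * (\<kappa> / (\<kappa> - \<rho>))"])
    show "set_integrable lborel {0..\<kappa> - indent} (\<lambda>\<rho>. weight (of_real \<rho>))"
      using integrable_W_below by (simp add: set_integrable_def W_below_def[abs_def])
    fix \<rho> assume \<rho>: "\<rho> \<in> {0..\<kappa> - indent}"
    then show "cmod (weight (of_real \<rho>)) \<le> near_bound * (\<kappa> / (\<kappa> - \<rho>))"
      using indent by (intro weight_below) auto
    show "((\<lambda>\<rho>. - near_bound * \<kappa> * ln (\<kappa> - \<rho>)) has_real_derivative near_bound * (\<kappa> / (\<kappa> - \<rho>))) (at \<rho>)"
      using \<rho> indent by (auto intro!: derivative_eq_intros)
  qed (use indent \<kappa>_pos in \<open>auto intro!: continuous_intros\<close>)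
  also have "\<dots> = near_bound * \<kappa> * ln (\<kappa> / indent)"
    using indent \<kappa>_pos by (simp add: ln_div algebra_simps)
  finally show ?thesis .
qed

lemma integral_norm_W_above:
  assumes "\<kappa> \<le> real N"
  shows "(LINT \<rho>|lborel. cmod (W_above N \<rho>)) \<le> C\<^sub>H * (2 * real N + \<kappa> * ln (2 * real N / indent))"
proof -
  have lt: "\<kappa> + indent < 2 * real N" using assms indent \<kappa>_pos by linarith
  have "(LINT \<rho>|lborel. cmod (W_above N \<rho>)) \<le> C\<^sub>H * (2 * real N + \<kappa> * ln (2 * real N - \<kappa>)) - C\<^sub>H * ((\<kappa> + indent) + \<kappa> * ln ((\<kappa> + indent) - \<kappa>))"
    unfolding W_above_def
  proof (rule integral_norm_le_antiderivative[where F' = "\<lambda>\<rho>. C\<^sub>H * (1 + \<kappa> / (\<rho> - \<kappa>))"])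
    show "set_integrable lborel {\<kappa> + indent..2 * real N} (\<lambda>\<rho>. weight (of_real \<rho>))"
      using integrable_W_above[of N] by (simp add: set_integrable_def W_above_def[abs_def])
    fix \<rho> assume \<rho>: "\<rho> \<in> {\<kappa> + indent..2 * real N}"
    then show "cmod (weight (of_real \<rho>)) \<le> C\<^sub>H * (1 + \<kappa> / (\<rho> - \<kappa>))"
      using indent by (intro weight_above) auto
    show "((\<lambda>\<rho>. C\<^sub>H * (\<rho> + \<kappa> * ln (\<rho> - \<kappa>))) has_real_derivative C\<^sub>H * (1 + \<kappa> / (\<rho> - \<kappa>))) (at \<rho>)"
      using \<rho> indent by (auto intro!: derivative_eq_intros)
  qed (use indent lt in \<open>auto intro!: continuous_intros\<close>)
  also have "\<dots> = C\<^sub>H * (2 * real N - (\<kappa> + indent) + \<kappa> * (ln (2 * real N - \<kappa>) - ln indent))"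
    by (simp add: algebra_simps)
  also have "\<dots> \<le> C\<^sub>H * (2 * real N + \<kappa> * (ln (2 * real N) - ln indent))"
    using indent \<kappa>_pos lt C\<^sub>H_nonneg by (intro mult_left_mono add_mono diff_mono ln_mono) auto
  also have "ln (2 * real N) - ln indent = ln (2 * real N / indent)"
    using indent \<kappa>_pos assms by (simp add: ln_div)
  finally show ?thesis .
qed

lemma integral_norm_W_arc: "(LINT t|lborel. cmod (W_arc t)) \<le> near_bound * (2 * \<kappa>) * pi"
proof -
  have "(LINT t|lborel. cmod (W_arc t)) \<le> near_bound * (2 * \<kappa>) * (2 * pi) - near_bound * (2 * \<kappa>) * pi"
    unfolding W_arc_def
  proof (rule integral_norm_le_antiderivative[where F' = "\<lambda>t. near_bound * (2 * \<kappa>)"])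
    show "set_integrable lborel {pi..2*pi} (\<lambda>t. weight (arc t) * of_real indent * \<i> * cis t)"
      by (rule borel_integrable_atLeastAtMost'[OF continuous_arc_weight])
    show "cmod (weight (arc t) * of_real indent * \<i> * cis t) \<le> near_bound * (2 * \<kappa>)" for t
      using weight_indentation[OF arc_bounds(1,2)[of t]] indent by (simp add: norm_mult)
  qed (auto intro!: derivative_eq_intros continuous_intros)
  then show ?thesis by (simp add: mult_ac)
qed

end

section \<open>Truncation error of the cut-off kernel\<close>

text \<open>With \<open>x = t * n powr s\<close>, \<open>s = 2 / (q - 1)\<close>, this is \<open>x \<le> 1 + x ^ (q - 1)\<close>: the logarithm costs
  nothing because the two terms of the error bound balance at \<open>x = 1\<close>.\<close>

lemma log_absorb:
  fixes n t :: real
  assumes n: "n \<ge> 1" and t: "0 \<le> t" and p: "p \<ge> (1::nat)"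
  shows "t * ln n * n powr (-1/2) \<le> real p / 2 * (n powr (3/2) * t ^ p + n powr (-1/2))"
proof -
  define s where "s = 2 / real p"
  have s: "s > 0" using p by (simp add: s_def)
  have "ln n \<le> n powr s / s" by (rule ln_powr_bound[OF n s])
  then have "t * ln n * n powr (-1/2) \<le> t * (n powr s / s) * n powr (-1/2)"
    using t by (intro mult_right_mono mult_left_mono) auto
  also have "\<dots> = 1 / s * n powr (-1/2) * (t * n powr s)" by simp
  also have "\<dots> \<le> 1 / s * n powr (-1/2) * (1 + (t * n powr s) ^ p)"
  proof (rule mult_left_mono)
    have x: "t * n powr s \<ge> 0" using t by simp
    show "t * n powr s \<le> 1 + (t * n powr s) ^ p"
    proof (cases "t * n powr s \<le> 1")
      case True
      then show ?thesis using zero_le_power[OF x, of p] by linarith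
    next
      case False
      then show ?thesis using self_le_power[of "t * n powr s" p] p by simp
    qed
  qed (use s in simp)
  also have "(t * n powr s) ^ p = t ^ p * n powr 2"
    using n p by (simp add: power_mult_distrib powr_power s_def)
  also have "1 / s * n powr (-1/2) * (1 + t ^ p * n powr 2) = 1 / s * (n powr (-1/2) + t ^ p * (n powr (-1/2) * n powr 2))"
    by (simp add: algebra_simps)
  also have "n powr (-1/2) * n powr 2 = n powr (3/2)" by (simp add: powr_add[symmetric])
  finally show ?thesis by (simp add: s_def mult_ac add_ac)
qed

lemma truncation_error_linear4:
  assumes F: "cube_bounded F1" "cube_bounded F2" "cube_bounded F3" "cube_bounded F4"
  shows "truncation_error N (\<lambda>r. K * (F1 r + F2 r + F3 r + F4 r)) x =
    K * (truncation_error N F1 x + truncation_error N F2 x + truncation_error N F3 x + truncation_error N F4 x)"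
  unfolding truncation_error_cmult
  by (simp only: truncation_error_add F cube_bounded_add)

locale filtered_cutoff = filtered_kernel + smooth_cutoff
begin

text \<open>\<kappa> and \<delta> are quantified inside, through the locale predicate, so that one
  constant serves all of them. The L2 norm is smaller than the sup norm by a factor
  \<open>N\<close>, which pays for most of the square root of the number of modes.\<close>

lemma far_part_error:
  assumes X: "X \<ge> 0" "\<And>r. \<bar>chi r\<bar> \<le> X"
  shows "\<exists>c\<ge>0. \<forall>\<kappa> \<delta> N x. filtered_kernel_params q a w C\<^sub>H \<kappa>\<^sub>0 \<gamma> \<theta> H \<kappa> \<delta> \<longrightarrow> \<kappa> \<le> real N \<longrightarrow>
     cube_bounded (superpose (filtered_kernel_params.W_far H \<kappa> \<delta> N) of_real) \<and>
     cmod (truncation_error N (superpose (filtered_kernel_params.W_far H \<kappa> \<delta> N) of_real) x)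
     \<le> c * (\<kappa> / real N) ^ (2 * q) * real N powr (3/2)"
proof -
  define J where "J = (LINT r:cube|lborel. 1 / (norm r)\<^sup>2)"
  have J: "J \<ge> 0" unfolding J_def set_lebesgue_integral_def by (intro Bochner_Integration.integral_nonneg) auto
  define A where "A = X * (C\<^sub>H * (4 / (3 * \<gamma>)) ^ q * (4 / 3))"
  have A: "A \<ge> 0" unfolding A_def using X C\<^sub>H_nonneg pos by simp
  define c where "c = A / 2 + 6 * (A * sqrt (J / 8))"
  show ?thesis
  proof (intro exI[of _ c] conjI allI impI)
    show "c \<ge> 0" unfolding c_def using A J by simp
    fix \<kappa> \<delta> :: real and N :: nat and x :: "real^3"
    assume "filtered_kernel_params q a w C\<^sub>H \<kappa>\<^sub>0 \<gamma> \<theta> H \<kappa> \<delta>" and N: "\<kappa> \<le> real N"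
    then interpret filtered_kernel_params q a w C\<^sub>H \<kappa>\<^sub>0 \<gamma> \<theta> H \<kappa> \<delta> by simp
    have N0: "real N > 0" using N \<kappa>_pos by linarith
    have [measurable]: "complex_of_real \<in> borel_measurable borel"
      by (intro borel_measurable_continuous_onI continuous_intros)
    have [measurable]: "W_far N \<in> borel_measurable borel" using integrable_W_far[OF N] by auto
    define t where "t = \<kappa> / real N"
    have t: "t > 0" using N0 \<kappa>_pos by (simp add: t_def)
    define M where "M = X * (far_const * t ^ (2 * q - 2) * \<kappa>\<^sup>2)"
    have M: "M \<ge> 0" using X far_const_nonneg t by (simp add: M_def)
    let ?g = "\<lambda>r \<rho>. W_far N \<rho> * (of_real (chi r) * j0 (of_real \<rho> * of_real (norm r)))"
    define F where "F = superpose (W_far N) of_real"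
    have F_eq: "F r = (LINT \<rho>|lborel. ?g r \<rho>)" for r by (simp add: F_def superpose_def)
    \<comment> \<open>Both estimates of \<open>j0\<close> are covered: \<open>n = 2\<close> with
      \<open>y = 1\<close> uses that its modulus is at most 1, and \<open>n = 3\<close> with
      \<open>y = 1 / norm r\<close> uses the decay.\<close>
    have bound: "cmod (F r) \<le> M * y * (1 / (real (n - 1) * (2 * real N) ^ (n - 1)))"
      if n: "n > 1" and y: "y \<ge> 0" and j: "\<And>\<rho>. \<rho> > 2 * real N \<Longrightarrow> cmod (j0 (of_real \<rho> * of_real (norm r))) * (1 / \<rho> ^ 2) \<le> y * (1 / \<rho> ^ n)"
      for r y n
    proof -
      have N2: "2 * real N > 0" using N0 by simp
      have "cmod (F r) \<le> (LINT \<rho>|lborel. cmod (?g r \<rho>))" unfolding F_eq by (rule integral_norm_bound)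
      also have "\<dots> \<le> (LINT \<rho>|lborel. M * y * (indicator {2 * real N<..} \<rho> *\<^sub>R (1 / \<rho> ^ n)))"
      proof (rule integral_mono')
        show "integrable lborel (\<lambda>\<rho>. M * y * (indicator {2 * real N<..} \<rho> *\<^sub>R (1 / \<rho> ^ n)))"
          using set_integral_inverse_power(1)[OF n N2] unfolding set_integrable_def by (rule integrable_mult_right)
        fix \<rho>
        show "cmod (?g r \<rho>) \<le> M * y * (indicator {2 * real N<..} \<rho> *\<^sub>R (1 / \<rho> ^ n))"
        proof (cases "\<rho> > 2 * real N")
          case True
          have "cmod (?g r \<rho>) = cmod (weight (of_real \<rho>)) * (\<bar>chi r\<bar> * cmod (j0 (of_real \<rho> * of_real (norm r))))"
            using True by (simp add: W_far_def norm_mult)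
          also have "\<dots> \<le> (far_const * t ^ (2 * q - 2) * \<kappa>\<^sup>2 * (1 / \<rho> ^ 2)) * (X * cmod (j0 (of_real \<rho> * of_real (norm r))))"
            using weight_far_le[OF N True] X far_const_nonneg t unfolding t_def[symmetric]
            by (intro mult_mono) auto
          also have "\<dots> = M * (cmod (j0 (of_real \<rho> * of_real (norm r))) * (1 / \<rho> ^ 2))" by (simp add: M_def)
          also have "\<dots> \<le> M * (y * (1 / \<rho> ^ n))" by (rule mult_left_mono[OF j[OF True] M])
          finally show ?thesis using True by simp
        qed (simp add: W_far_def)
        show "0 \<le> M * y * (indicator {2 * real N<..} \<rho> *\<^sub>R (1 / \<rho> ^ n))"
          using M y N0 by (auto simp: indicator_def)
      qed
      also have "\<dots> = M * y * (LINT \<rho>:{2 * real N<..}|lborel. 1 / \<rho> ^ n)"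
        unfolding set_lebesgue_integral_def by (rule integral_mult_right_zero)
      also have "\<dots> \<le> M * y * (1 / (real (n - 1) * (2 * real N) ^ (n - 1)))"
        using M y by (intro mult_left_mono set_integral_inverse_power(2)[OF n N2]) auto
      finally show ?thesis .
    qed
    have Mt: "M = A * t ^ (2 * q) * (real N)\<^sup>2"
    proof -
      have "2 * q = (2 * q - 2) + 2" using q by simp
      then have "t ^ (2 * q) = t ^ (2 * q - 2) * t ^ 2" by (metis power_add)
      then show ?thesis using N0 by (simp add: M_def A_def far_const_def t_def power_divide)
    qed
    have sup: "cmod (F r) \<le> A * t ^ (2 * q) * real N / 2" for r
    proof -
      have "cmod (F r) \<le> M * 1 * (1 / (real (2 - 1) * (2 * real N) ^ (2 - 1)))"
      proof (rule bound)
        fix \<rho> assume "\<rho> > 2 * real N"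
        have "cmod (j0 (of_real \<rho> * of_real (norm r))) \<le> 1" using norm_j0_real(1)[of "\<rho> * norm r"] by simp
        then show "cmod (j0 (of_real \<rho> * of_real (norm r))) * (1 / \<rho> ^ 2) \<le> 1 * (1 / \<rho> ^ 2)"
          by (intro mult_right_mono) auto
      qed auto
      also have "\<dots> = A * t ^ (2 * q) * real N / 2" using N0 by (simp add: Mt power2_eq_square)
      finally show ?thesis .
    qed
    \<comment> \<open>The gain of one power of \<open>N\<close> over the sup bound costs a
      singularity 1 / |r|, whose square is still integrable over the cube.\<close>
    have pt: "cmod (F r) \<le> A * t ^ (2 * q) * (1 / norm r)" if r: "r \<noteq> 0" for r
    proof -
      have "cmod (F r) \<le> M * (1 / norm r) * (1 / (real (3 - 1) * (2 * real N) ^ (3 - 1)))"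
      proof (rule bound)
        fix \<rho> assume \<rho>: "\<rho> > 2 * real N"
        then have \<rho>0: "\<rho> > 0" using N0 by linarith
        have "cmod (j0 (of_real \<rho> * of_real (norm r))) \<le> 1 / \<bar>\<rho> * norm r\<bar>"
          using norm_j0_real(2)[of "\<rho> * norm r"] \<rho>0 r by simp
        then have "cmod (j0 (of_real \<rho> * of_real (norm r))) * (1 / \<rho> ^ 2) \<le> 1 / \<bar>\<rho> * norm r\<bar> * (1 / \<rho> ^ 2)"
          by (intro mult_right_mono) auto
        also have "\<dots> = 1 / norm r * (1 / \<rho> ^ 3)" using \<rho>0 by (simp add: abs_mult power3_eq_cube power2_eq_square)
        finally show "cmod (j0 (of_real \<rho> * of_real (norm r))) * (1 / \<rho> ^ 2) \<le> 1 / norm r * (1 / \<rho> ^ 3)" .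
      qed auto
      also have "\<dots> = A * t ^ (2 * q) * (1 / norm r) / 8" using N0 by (simp add: Mt power2_eq_square)
      also have "\<dots> \<le> A * t ^ (2 * q) * (1 / norm r)"
      proof -
        have le: "z / 8 \<le> z" if "z \<ge> 0" for z :: real using that by simp
        show ?thesis by (rule le) (use A t in simp)
      qed
      finally show ?thesis .
    qed
    have Fm: "F \<in> borel_measurable borel" unfolding F_eq[abs_def] by measurable
    have Fcb: "cube_bounded F" by (rule cube_boundedI[OF Fm sup])
    then show "cube_bounded (superpose (W_far N) of_real)" unfolding F_def .
    have L: "(LINT r:cube|lborel. (cmod (F r))\<^sup>2) \<le> (A * t ^ (2 * q))\<^sup>2 * J"
    proof -
      have i: "set_integrable lborel cube (\<lambda>r. (A * t ^ (2 * q))\<^sup>2 * (1 / (norm r)\<^sup>2))"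
        using inverse_norm_square_integrable by (rule set_integrable_mult_right)
      have "(LINT r:cube|lborel. (cmod (F r))\<^sup>2) \<le> (LINT r:cube|lborel. (A * t ^ (2 * q))\<^sup>2 * (1 / (norm r)\<^sup>2))"
        unfolding set_lebesgue_integral_def
      proof (rule integral_mono_AE')
        show "integrable lborel (\<lambda>r. indicator cube r *\<^sub>R ((A * t ^ (2 * q))\<^sup>2 * (1 / (norm r)\<^sup>2)))"
          using i unfolding set_integrable_def .
        show "AE r in lborel. indicator cube r *\<^sub>R (cmod (F r))\<^sup>2 \<le> indicator cube r *\<^sub>R ((A * t ^ (2 * q))\<^sup>2 * (1 / (norm r)\<^sup>2))"
          using AE_lborel_singleton[of 0]
        proof eventually_elim
          case (elim r)
          have "(cmod (F r))\<^sup>2 \<le> (A * t ^ (2 * q) * (1 / norm r))\<^sup>2" by (intro power_mono pt elim norm_ge_zero)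
          also have "\<dots> = (A * t ^ (2 * q))\<^sup>2 * (1 / (norm r)\<^sup>2)" by (simp add: power_mult_distrib power_divide)
          finally show ?case by (rule scaleR_left_mono) simp
        qed
        show "AE r in lborel. 0 \<le> indicator cube r *\<^sub>R ((A * t ^ (2 * q))\<^sup>2 * (1 / (norm r)\<^sup>2))" by (intro AE_I2) simp
      qed
      also have "\<dots> = (A * t ^ (2 * q))\<^sup>2 * J" unfolding J_def by (rule set_integral_mult_right)
      finally show ?thesis .
    qed
    have N1: "real N \<ge> 1" using N0 by simp
    have At: "A * t ^ (2 * q) \<ge> 0" using A t by simp
    have "cmod (truncation_error N F x) \<le> A * t ^ (2 * q) * real N / 2 +
        sqrt (real ((2 * N + 1) ^ 3)) * sqrt ((A * t ^ (2 * q))\<^sup>2 * J / 8)"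
      by (rule truncation_error_L2[OF Fcb sup L])
    also have "\<dots> \<le> A * t ^ (2 * q) * real N powr (3/2) / 2 + (6 * real N powr (3/2)) * (A * t ^ (2 * q) * sqrt (J / 8))"
    proof (intro add_mono mult_mono)
      have "real N powr 1 \<le> real N powr (3/2)" using N1 by (intro powr_mono) auto
      then show "A * t ^ (2 * q) * real N / 2 \<le> A * t ^ (2 * q) * real N powr (3/2) / 2"
        using At N0 by (intro divide_right_mono mult_left_mono) auto
      have "sqrt ((A * t ^ (2 * q))\<^sup>2 * J / 8) = sqrt ((A * t ^ (2 * q))\<^sup>2) * sqrt (J / 8)"
        unfolding real_sqrt_mult[symmetric] by simp
      then show "sqrt ((A * t ^ (2 * q))\<^sup>2 * J / 8) \<le> A * t ^ (2 * q) * sqrt (J / 8)" using At by simp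
      have "real ((2 * N + 1) ^ 3) \<le> (3 * real N) ^ 3"
        unfolding of_nat_power using N1 by (intro power_mono) auto
      \<comment> \<open>27 is enlarged to the perfect square 36, which is where the 6 in
        \<open>c\<close> comes from.\<close>
      also have "\<dots> \<le> 6\<^sup>2 * real N ^ 3" by (simp add: power_mult_distrib)
      finally have "sqrt (real ((2 * N + 1) ^ 3)) \<le> sqrt (6\<^sup>2 * real N ^ 3)" by (rule real_sqrt_le_mono)
      also have "\<dots> = 6 * sqrt (real N ^ 3)" by (simp add: real_sqrt_mult)
      also have "sqrt (real N ^ 3) = real N powr (3/2)"
      proof -
        have "sqrt (real N ^ 3) = (real N powr 3) powr (1/2)"
          using N0 by (simp only: powr_numeral powr_half_sqrt zero_le_power of_nat_0_le_iff)
        then show ?thesis by (simp only: powr_powr) simp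
      qed
      finally show "sqrt (real ((2 * N + 1) ^ 3)) \<le> 6 * real N powr (3/2)" .
    qed (use J in auto)
    also have "\<dots> = c * t ^ (2 * q) * real N powr (3/2)" by (simp add: c_def algebra_simps)
    finally show "cmod (truncation_error N (superpose (W_far N) of_real) x) \<le> c * (\<kappa> / real N) ^ (2 * q) * real N powr (3/2)"
      unfolding F_def t_def .
  qed
qed

text \<open>The three near pieces share the plane-wave rate, multiplied by the sum of their L1
  norms; the far piece brings its own bound. The hypothesis q \<ge> 2 makes \<open>q - 1\<close> an
  admissible exponent in \<open>log_absorb\<close>.\<close>

lemma cutoff_kernel_truncation_error:
  assumes q2: "q \<ge> 2"
  shows "\<exists>c\<ge>0. \<forall>\<kappa> \<delta> N. filtered_kernel_params q a w C\<^sub>H \<kappa>\<^sub>0 \<gamma> \<theta> H \<kappa> \<delta> \<longrightarrow> \<kappa> \<le> real N \<longrightarrow> 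
     cube_bounded (cutoff_kernel chi H \<delta> \<kappa>) \<and>
     (\<forall>x. (\<forall>i. \<bar>x $ i\<bar> < 1) \<longrightarrow> cmod (truncation_error N (cutoff_kernel chi H \<delta> \<kappa>) x)
       \<le> c * (real N powr (3/2) * (\<kappa> / real N) ^ (q - 1) + real N powr (-1/2)))"
proof -
  obtain X where X: "X \<ge> 0" "\<And>r. \<bar>chi r\<bar> \<le> X" using chi_bounded by blast
  define e where "e = \<kappa>\<^sub>0 / 3"
  have e: "e > 0" using pos by (simp add: e_def)
  obtain C where C: "C \<ge> 0" and path: "\<And>N W \<gamma>. N > 0 \<Longrightarrow> integrable lborel W \<Longrightarrow> \<gamma> \<in> borel_measurable borel \<Longrightarrow>
     (\<And>p. W p \<noteq> 0 \<Longrightarrow> cmod (\<gamma> p) \<le> 2 * real N \<and> \<bar>Im (\<gamma> p)\<bar> \<le> e) \<Longrightarrow>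
     cube_bounded (superpose W \<gamma>) \<and>
     (\<forall>x. (\<forall>i. \<bar>x $ i\<bar> < 1) \<longrightarrow>
       cmod (truncation_error N (superpose W \<gamma>) x) \<le> C / real N powr (3/2) * (LINT p|lborel. cmod (W p)))"
    using superpose_tail[of e] by blast
  obtain c1 where c1: "c1 \<ge> 0" and far: "\<And>\<kappa> \<delta> N x. filtered_kernel_params q a w C\<^sub>H \<kappa>\<^sub>0 \<gamma> \<theta> H \<kappa> \<delta> \<Longrightarrow> \<kappa> \<le> real N \<Longrightarrow>
     cube_bounded (superpose (filtered_kernel_params.W_far H \<kappa> \<delta> N) of_real) \<and>
     cmod (truncation_error N (superpose (filtered_kernel_params.W_far H \<kappa> \<delta> N) of_real) x)
     \<le> c1 * (\<kappa> / real N) ^ (2 * q) * real N powr (3/2)"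
    using far_part_error[OF X] by blast
  \<comment> \<open>\<open>b1\<close> collects the coefficients of \<kappa> ln (2 N / e) from the
    two real pieces, \<open>b2\<close> those of \<open>N\<close> from the upper piece and the
    semicircle, where \<pi> is bounded by 4.\<close>
  define b1 where "b1 = near_bound + C\<^sub>H"
  define b2 where "b2 = 2 * C\<^sub>H + 8 * near_bound"
  \<comment> \<open>The logarithm is split into ln (2 / e), which may have either sign, and ln N,
    for which \<open>log_absorb\<close> supplies the factor (q - 1) / 2.\<close>
  define c2 where "c2 = C * (b1 * (\<bar>ln (2 / e)\<bar> + real (q - 1) / 2) + b2)"
  have b: "b1 \<ge> 0" "b2 \<ge> 0" using near_bound_nonneg C\<^sub>H_nonneg by (auto simp: b1_def b2_def)
  have c2: "c2 \<ge> 0" unfolding c2_def using C b by (intro mult_nonneg_nonneg add_nonneg_nonneg) auto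
  define K where "K = 1 / (2 * (complex_of_real pi)\<^sup>2)"
  show ?thesis
  proof (intro exI[of _ "cmod K * (c2 + c1)"] conjI allI impI)
    show "cmod K * (c2 + c1) \<ge> 0" using c1 c2 by simp
    fix \<kappa> \<delta> :: real and N :: nat
    assume "filtered_kernel_params q a w C\<^sub>H \<kappa>\<^sub>0 \<gamma> \<theta> H \<kappa> \<delta>" and N: "\<kappa> \<le> real N"
    then interpret filtered_kernel_params q a w C\<^sub>H \<kappa>\<^sub>0 \<gamma> \<theta> H \<kappa> \<delta> by simp
    have N0: "N > 0" using N \<kappa>_pos by (cases "N = 0") auto
    have N1: "real N \<ge> 1" using N0 by simp
    have ie: "indent = e" by (simp add: indent_def e_def)
    have [measurable]: "complex_of_real \<in> borel_measurable borel" "arc \<in> borel_measurable borel"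
      unfolding arc_def[abs_def] by (intro borel_measurable_continuous_onI continuous_intros)+
    let ?E = "truncation_error N"
    let ?I = "\<lambda>W :: real \<Rightarrow> complex. LINT p|lborel. cmod (W p)"
    have below: "cube_bounded (superpose W_below of_real)" "(\<forall>i. \<bar>x $ i\<bar> < 1) \<Longrightarrow> cmod (?E (superpose W_below of_real) x) \<le> C / real N powr (3/2) * ?I W_below" for x
      using path[of N W_below complex_of_real] N0 N integrable_W_below indent e ie
      by (auto simp: W_below_def indicator_def)
    have above: "cube_bounded (superpose (W_above N) of_real)" "(\<forall>i. \<bar>x $ i\<bar> < 1) \<Longrightarrow> cmod (?E (superpose (W_above N) of_real) x) \<le> C / real N powr (3/2) * ?I (W_above N)" for x
      using path[of N "W_above N" complex_of_real] N0 integrable_W_above indent e \<kappa>_pos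
      by (auto simp: W_above_def indicator_def)
    have "cmod (arc t) \<le> 2 * real N \<and> \<bar>Im (arc t)\<bar> \<le> e" for t
      using arc_bounds(3,4)[of t] indent N ie \<kappa>_pos by auto
    then have arc: "cube_bounded (superpose W_arc arc)" "(\<forall>i. \<bar>x $ i\<bar> < 1) \<Longrightarrow> cmod (?E (superpose W_arc arc) x) \<le> C / real N powr (3/2) * ?I W_arc" for x
      using path[of N W_arc arc] N0 integrable_W_arc by auto
    note far' = far[OF filtered_kernel_params_axioms N]
    have G: "cutoff_kernel chi H \<delta> \<kappa> = (\<lambda>r. K * (superpose W_below of_real r + superpose (W_above N) of_real r + superpose W_arc arc r + superpose (W_far N) of_real r))"
    proof
      fix r
      have m: "of_real (chi r) * (LINT p|lborel. W p * j0 (\<gamma> p * of_real (norm r))) = superpose W \<gamma> r" for W \<gamma> :: "real \<Rightarrow> complex"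
        unfolding superpose_def mult.left_commute[of _ "complex_of_real (chi r)"] by simp
      show "cutoff_kernel chi H \<delta> \<kappa> r = K * (superpose W_below of_real r + superpose (W_above N) of_real r + superpose W_arc arc r + superpose (W_far N) of_real r)"
        unfolding cutoff_kernel_def mollified_kernel_split[OF N] K_def[symmetric] mult.left_commute[of _ K] distrib_left m ..
    qed
    show "cube_bounded (cutoff_kernel chi H \<delta> \<kappa>)"
      unfolding G by (intro cube_bounded_mult cube_bounded_const cube_bounded_add below above arc conjunct1[OF far'])
    fix x :: "real^3" assume x: "\<forall>i. \<bar>x $ i\<bar> < 1"
    define t where "t = \<kappa> / real N"
    have t: "0 < t" "t \<le> 1" using N N0 \<kappa>_pos by (auto simp: t_def)
    define T where "T = real N powr (3/2) * t ^ (q - 1)"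
    define U where "U = real N powr (-1/2)"
    have TU: "T \<ge> 0" "U \<ge> 0" using t by (auto simp: T_def U_def)
    define Z1 where "Z1 = ?E (superpose W_below of_real) x"
    define Z2 where "Z2 = ?E (superpose (W_above N) of_real) x"
    define Z3 where "Z3 = ?E (superpose W_arc arc) x"
    define Z4 where "Z4 = ?E (superpose (W_far N) of_real) x"
    have Z: "cmod Z1 \<le> C / real N powr (3/2) * ?I W_below"
      "cmod Z2 \<le> C / real N powr (3/2) * ?I (W_above N)"
      "cmod Z3 \<le> C / real N powr (3/2) * ?I W_arc"
      unfolding Z1_def Z2_def Z3_def by (rule below(2)[OF x] above(2)[OF x] arc(2)[OF x])+
    have Z4: "cmod Z4 \<le> c1 * t ^ (2 * q) * real N powr (3/2)"
      unfolding Z4_def t_def by (rule conjunct2[OF far'])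
    have "?E (cutoff_kernel chi H \<delta> \<kappa>) x = K * (Z1 + Z2 + Z3 + Z4)"
      unfolding G Z1_def Z2_def Z3_def Z4_def by (rule truncation_error_linear4[OF below(1) above(1) arc(1) conjunct1[OF far']])
    also have "cmod \<dots> \<le> cmod K * (cmod (Z1) + cmod (Z2) + cmod (Z3) + cmod (Z4))"
    proof -
      have n4: "cmod (a + b + c + d) \<le> cmod a + cmod b + cmod c + cmod d" for a b c d
        using norm_triangle_ineq[of "a + b + c" d] norm_triangle_ineq[of "a + b" c] norm_triangle_ineq[of a b] by linarith
      show ?thesis unfolding norm_mult by (rule mult_left_mono[OF n4 norm_ge_zero])
    qed
    also have "\<dots> \<le> cmod K * (c2 * (T + U) + c1 * (T + U))"
    proof (rule mult_left_mono)
      have "cmod (Z1) + cmod (Z2) + cmod (Z3) \<le>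
          C / real N powr (3/2) * ?I W_below + C / real N powr (3/2) * ?I (W_above N) + C / real N powr (3/2) * ?I W_arc"
        by (intro add_mono Z)
      also have "\<dots> = C / real N powr (3/2) * (?I W_below + ?I (W_above N) + ?I W_arc)"
        by (simp only: distrib_left)
      also have "\<dots> \<le> C / real N powr (3/2) * (real N * (b1 * (t * ln (2 * real N / e)) + b2))"
      proof (rule mult_left_mono)
        have "ln (\<kappa> / indent) \<le> ln (2 * real N / e)"
          unfolding ie using N \<kappa>_pos e by (intro ln_mono divide_right_mono) auto
        then have "near_bound * \<kappa> * ln (\<kappa> / indent) \<le> near_bound * \<kappa> * ln (2 * real N / e)"
          using near_bound_nonneg \<kappa>_pos by (intro mult_left_mono) auto
        moreover have "near_bound * (2 * \<kappa>) * pi \<le> near_bound * (2 * real N) * 4"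
          using near_bound_nonneg \<kappa>_pos N pi_less_4 by (intro mult_mono mult_nonneg_nonneg) auto
        ultimately have "?I W_below + ?I (W_above N) + ?I W_arc \<le>
           near_bound * \<kappa> * ln (2 * real N / e) + C\<^sub>H * (2 * real N + \<kappa> * ln (2 * real N / e)) + near_bound * (2 * real N) * 4"
          using integral_norm_W_below integral_norm_W_above[OF N] integral_norm_W_arc unfolding ie by linarith
        also have "\<dots> = real N * (b1 * (t * ln (2 * real N / e)) + b2)"
          using N0 by (simp add: b1_def b2_def t_def field_simps)
        finally show "?I W_below + ?I (W_above N) + ?I W_arc \<le>
           real N * (b1 * (t * ln (2 * real N / e)) + b2)" .
      qed (use C in simp)
      also have "\<dots> = C * U * (b1 * (t * ln (2 * real N / e)) + b2)"
      proof -
        have "real N / real N powr (3/2) = U"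
          using N0 powr_diff[of "real N" 1 "3/2"] by (simp add: U_def)
        moreover have "C / real N powr (3/2) * (real N * y) = C * (real N / real N powr (3/2)) * y" for y by simp
        ultimately show ?thesis by (simp only:)
      qed
      also have "\<dots> \<le> C * (b1 * (\<bar>ln (2 / e)\<bar> + real (q - 1) / 2) + b2) * (T + U)"
      proof -
        have "ln (2 * real N / e) = ln (2 / e) + ln (real N)"
          using N0 e ln_mult[of "2 / e" "real N"] by simp
        then have "U * (t * ln (2 * real N / e)) = U * t * ln (2 / e) + t * ln (real N) * U" by (simp add: algebra_simps)
        also have "U * t * ln (2 / e) \<le> \<bar>ln (2 / e)\<bar> * (T + U)"
        proof -
          have "U * t * ln (2 / e) \<le> U * t * \<bar>ln (2 / e)\<bar>" using TU t by (intro mult_left_mono) auto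
          also have "U * t * \<bar>ln (2 / e)\<bar> \<le> (T + U) * \<bar>ln (2 / e)\<bar>"
          proof (rule mult_right_mono)
            have "U * t \<le> U * 1" using TU t by (intro mult_left_mono) auto
            then show "U * t \<le> T + U" using TU by simp
          qed simp
          finally show ?thesis by (simp add: mult.commute)
        qed
        also have "t * ln (real N) * U \<le> real (q - 1) / 2 * (T + U)"
          unfolding T_def U_def by (rule log_absorb) (use N1 t q2 in auto)
        finally have *: "U * (t * ln (2 * real N / e)) \<le> (\<bar>ln (2 / e)\<bar> + real (q - 1) / 2) * (T + U)"
          by (simp add: algebra_simps)
        have "U * (b1 * (t * ln (2 * real N / e)) + b2) = b1 * (U * (t * ln (2 * real N / e))) + b2 * U" by (simp add: algebra_simps)
        also have "\<dots> \<le> b1 * ((\<bar>ln (2 / e)\<bar> + real (q - 1) / 2) * (T + U)) + b2 * (T + U)"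
          using b TU * by (intro add_mono mult_left_mono) auto
        finally have "U * (b1 * (t * ln (2 * real N / e)) + b2) \<le> (b1 * (\<bar>ln (2 / e)\<bar> + real (q - 1) / 2) + b2) * (T + U)"
          by (simp add: algebra_simps)
        from mult_left_mono[OF this C] show ?thesis by (simp only: mult.assoc)
      qed
      finally have low: "cmod (Z1) + cmod (Z2) + cmod (Z3) \<le> c2 * (T + U)"
        unfolding c2_def .
      have "cmod Z4 \<le> c1 * t ^ (2 * q) * real N powr (3/2)" by (rule Z4)
      \<comment> \<open>As \<open>t\<close> is at most 1, lowering the exponent from 2 q to q - 1
        enlarges the bound and matches \<open>T\<close>.\<close>
      also have "\<dots> \<le> c1 * t ^ (q - 1) * real N powr (3/2)"
        using t c1 by (intro mult_right_mono mult_left_mono power_decreasing) auto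
      also have "\<dots> = c1 * T" by (simp add: T_def)
      also have "\<dots> \<le> c1 * (T + U)" using c1 TU by (intro mult_left_mono) auto
      finally show "cmod (Z1) + cmod (Z2) + cmod (Z3) + cmod (Z4) \<le> c2 * (T + U) + c1 * (T + U)"
        using low by linarith
    qed simp
    finally show "cmod (?E (cutoff_kernel chi H \<delta> \<kappa>) x) \<le> cmod K * (c2 + c1) * (real N powr (3/2) * (\<kappa> / real N) ^ (q - 1) + real N powr (-1/2))"
      by (simp only: T_def U_def t_def distrib_right mult.assoc)
  qed
qed

end

section \<open>The boundary surface\<close>

text \<open>\<open>V\<close> is a Lipschitz graph over the coordinate plane orthogonal to \<open>b\<close>; cutting the plane into \<open>n\<^sup>2\<close> squares
  covers \<open>V\<close> by \<open>n\<^sup>2\<close> cells of diameter \<open>O (1 / n)\<close>.\<close>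

lemma hausdorff2_outer_Lipschitz_graph:
  fixes V :: "(real^3) set" and M L :: real and b :: 3
  assumes bV: "V \<subseteq> cbox (vec (-M)) (vec M)" and M: "M > 0" and L: "L \<ge> 0"
    and lip: "\<And>x y. x \<in> V \<Longrightarrow> y \<in> V \<Longrightarrow> norm (x - y) \<le> L * (\<Sum>i\<in>UNIV - {b}. \<bar>x $ i - y $ i\<bar>)"
  shows "hausdorff2_outer V \<le> ennreal (pi / 4 * (16 * L\<^sup>2 * M\<^sup>2))"
proof -
  define h where "h n = 2 * M / real n" for n
  define T where "T n = ((UNIV - {b}) \<rightarrow>\<^sub>E {..<n})" for n :: nat
  define cell where "cell n p = {x \<in> V. \<forall>i. i \<noteq> b \<longrightarrow> -M + h n * real (p i) \<le> x $ i \<and> x $ i \<le> -M + h n * (real (p i) + 1)}"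
    for n and p :: "3 \<Rightarrow> nat"
  have finT: "finite (T n)" for n unfolding T_def by (intro finite_PiE) auto
  have cb: "card (UNIV - {b}) = 2" by (simp add: card_Diff_subset)
  have cardT: "card (T n) = n\<^sup>2" for n
    unfolding T_def by (subst card_PiE) (simp_all add: cb)
  have cell_bdd: "bounded (cell n p)" for n p
    by (rule bounded_subset[OF bounded_cbox[of "vec (-M)" "vec M"]]) (use bV in \<open>auto simp: cell_def\<close>)
  have cell_diam: "diameter (cell n p) \<le> 2 * L * h n" if "n > 0" for n p
  proof (rule diameter_le)
    have h0: "h n > 0" using that M by (simp add: h_def)
    show "cell n p \<noteq> {} \<or> 0 \<le> 2 * L * h n" using h0 L by simp
    fix x y assume x: "x \<in> cell n p" and y: "y \<in> cell n p"
    have xy: "norm (x - y) \<le> L * (\<Sum>i\<in>UNIV - {b}. \<bar>x $ i - y $ i\<bar>)"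
      by (rule lip) (use x y in \<open>auto simp: cell_def\<close>)
    have "(\<Sum>i\<in>UNIV - {b}. \<bar>x $ i - y $ i\<bar>) \<le> (\<Sum>i\<in>UNIV - {b}. h n)"
    proof (rule sum_mono)
      fix i assume "i \<in> UNIV - {b}"
      then have "-M + h n * real (p i) \<le> x $ i" "x $ i \<le> -M + h n * real (p i) + h n"
        "-M + h n * real (p i) \<le> y $ i" "y $ i \<le> -M + h n * real (p i) + h n"
        using x y by (auto simp: cell_def algebra_simps)
      then show "\<bar>x $ i - y $ i\<bar> \<le> h n" by linarith
    qed
    also have "(\<Sum>i\<in>UNIV - {b}. h n) = 2 * h n" by (simp add: cb)
    finally have "(\<Sum>i\<in>UNIV - {b}. \<bar>x $ i - y $ i\<bar>) \<le> 2 * h n" .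
    from mult_left_mono[OF this L] show "norm (x - y) \<le> 2 * L * h n" using xy by simp
  qed
  have cover: "V \<subseteq> (\<Union>p\<in>T n. cell n p)" if n: "n > 0" for n
  proof
    fix x assume x: "x \<in> V"
    \<comment> \<open>The minimum assigns points whose coordinate equals \<open>M\<close> to the
      last square; \<open>undefined\<close> at \<open>b\<close> is what the extensional function
      space \<open>T n\<close> prescribes.\<close>
    define p where "p i = (if i = b then undefined else min (n - 1) (nat \<lfloor>(x $ i + M) / h n\<rfloor>))" for i
    have h0: "h n > 0" using n M by (simp add: h_def)
    have "p \<in> T n" unfolding T_def by (rule PiE_I) (use n in \<open>auto simp: p_def\<close>)
    moreover have "x \<in> cell n p"
      unfolding cell_def
    proof (intro CollectI conjI x allI impI)
      fix i assume i: "i \<noteq> b"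
      have xi: "-M \<le> x $ i" "x $ i \<le> M" using x bV by (auto simp: mem_box_cart subset_iff)
      define z where "z = (x $ i + M) / h n"
      have z: "0 \<le> z" "z \<le> real n" "x $ i = -M + h n * z"
      proof -
        show "0 \<le> z" using xi h0 by (simp add: z_def)
        have "x $ i + M \<le> real n * h n" using xi n by (simp add: h_def)
        then show "z \<le> real n" using h0 by (simp add: z_def pos_divide_le_eq)
        show "x $ i = -M + h n * z" using h0 by (simp add: z_def)
      qed
      have fl: "real (nat \<lfloor>z\<rfloor>) \<le> z" "z < real (nat \<lfloor>z\<rfloor>) + 1" using z(1) by linarith+
      have pi: "p i = min (n - 1) (nat \<lfloor>z\<rfloor>)" using i by (simp add: p_def z_def)
      have "real (p i) \<le> z" using fl unfolding pi by linarith
      moreover have "z \<le> real (p i) + 1"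
      proof (cases "n - 1 \<le> nat \<lfloor>z\<rfloor>")
        case True
        then show ?thesis using z(2) n by (simp add: pi of_nat_diff)
      qed (use fl pi in simp)
      ultimately show "-M + h n * real (p i) \<le> x $ i" "x $ i \<le> -M + h n * (real (p i) + 1)"
        unfolding z(3) using h0 by (auto intro!: mult_left_mono)
    qed
    ultimately show "x \<in> (\<Union>p\<in>T n. cell n p)" by blast
  qed
  have content: "hausdorff2_content \<epsilon> V \<le> ennreal (pi / 4 * (16 * L\<^sup>2 * M\<^sup>2))" if e: "\<epsilon> > 0" for \<epsilon>
  proof -
    \<comment> \<open>Fine enough that the diameter bound 2 L h of the cells falls below \<epsilon>.
      The total is independent of this choice, since n^2 cells of squared diameter O (1 / n^2) are
      summed.\<close>
    obtain n0 where n0: "2 * L * (2 * M) / \<epsilon> < real n0" using reals_Archimedean2 by blast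
    define n where "n = max n0 1"
    have n: "n > 0" "2 * L * (2 * M) / \<epsilon> < real n" using n0 by (auto simp: n_def)
    have small: "2 * L * h n \<le> \<epsilon>" using n e by (simp add: h_def divide_simps mult_ac)
    obtain f where f: "bij_betw f {..<card (T n)} (T n)" using ex_bij_betw_nat_finite[OF finT] by (auto simp: atLeast0LessThan)
    \<comment> \<open>The content is defined by sequences of sets, so the finite family is padded
      with empty sets, which have diameter 0.\<close>
    define C where "C i = (if i < card (T n) then cell n (f i) else {})" for i
    have "V \<subseteq> (\<Union>i. C i)"
    proof
      fix x assume "x \<in> V"
      then obtain p where p: "p \<in> T n" "x \<in> cell n p" using cover[OF n(1)] by blast
      then obtain i where "i < card (T n)" "f i = p" using bij_betw_imp_surj_on[OF f] by (metis imageE lessThan_iff)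
      then show "x \<in> (\<Union>i. C i)" using p by (auto simp: C_def)
    qed
    moreover have "bounded (C i) \<and> diameter (C i) \<le> \<epsilon>" for i
      using cell_bdd cell_diam[OF n(1)] small e by (auto simp: C_def intro: order_trans)
    ultimately have "hausdorff2_content \<epsilon> V \<le> (\<Sum>i. ennreal (pi / 4 * (diameter (C i))\<^sup>2))"
      unfolding hausdorff2_content_def by (intro INF_lower) auto
    also have "\<dots> = (\<Sum>i<card (T n). ennreal (pi / 4 * (diameter (C i))\<^sup>2))"
      by (rule suminf_finite) (auto simp: C_def)
    also have "\<dots> \<le> (\<Sum>i<card (T n). ennreal (pi / 4 * (2 * L * h n)\<^sup>2))"
    proof (rule sum_mono)
      fix i assume "i \<in> {..<card (T n)}"
      then have "diameter (C i) \<le> 2 * L * h n" using cell_diam[OF n(1)] by (simp add: C_def)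
      moreover have "diameter (C i) \<ge> 0" using cell_bdd by (auto simp: C_def intro!: diameter_ge_0)
      ultimately show "ennreal (pi / 4 * (diameter (C i))\<^sup>2) \<le> ennreal (pi / 4 * (2 * L * h n)\<^sup>2)"
        by (intro ennreal_leI mult_left_mono power_mono) auto
    qed
    also have "\<dots> = ennreal (real (n\<^sup>2) * (pi / 4 * (2 * L * h n)\<^sup>2))"
    proof -
      have "(\<Sum>i<card (T n). ennreal c) = ennreal (real (n\<^sup>2) * c)" if "c \<ge> 0" for c
        using that by (simp add: cardT ennreal_of_nat_eq_real_of_nat ennreal_mult del: of_nat_power)
      then show ?thesis by simp
    qed
    also have "real (n\<^sup>2) * (pi / 4 * (2 * L * h n)\<^sup>2) = pi / 4 * (16 * L\<^sup>2 * M\<^sup>2)"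
      using n by (simp add: h_def power_mult_distrib power_divide)
    finally show ?thesis .
  qed
  show ?thesis unfolding hausdorff2_outer_def by (rule SUP_least) (use content in auto)
qed

text \<open>Near a boundary point one partial derivative of the defining function stays away from zero, so
  two zeros of it differ in that coordinate by at most a multiple of the other two differences.\<close>

lemma smooth_boundary_local_finite:
  assumes D: "open D" "smooth_boundary D" and x: "x \<in> frontier D"
  shows "\<exists>e>0. hausdorff2_outer (frontier D \<inter> ball x e) < \<infinity>"
proof -
  from bspec[OF D(2)[unfolded smooth_boundary_def] x] obtain U \<phi> where
    U\<phi>: "open U \<and> x \<in> U \<and> (\<forall>n. C_n_on n \<phi> U) \<and> (\<forall>y\<in>U. \<exists>h. frechet_derivative \<phi> (at y) h \<noteq> 0) \<and>
      D \<inter> U = {y \<in> U. \<phi> y < 0}"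
    by (elim exE)
  from U\<phi> have U: "open U" "x \<in> U" by auto
  from U\<phi> have smooth: "C_n_on n \<phi> U" for n by (elim conjE allE)
  from U\<phi> have crit: "\<exists>h. frechet_derivative \<phi> (at y) h \<noteq> 0" if "y \<in> U" for y using that by (elim conjE) (erule bspec)
  from U\<phi> have DU: "D \<inter> U = {y \<in> U. \<phi> y < 0}" by (elim conjE)
  have diff: "\<phi> differentiable (at y)" if "y \<in> U" for y
    using smooth[of 1] that by simp
  define g where "g i y = frechet_derivative \<phi> (at y) (axis i 1)" for i y
  have gc: "continuous_on U (g i)" for i
    using smooth[of 1] by (auto simp: g_def[abs_def] Basis_vec_eq)
  have fd: "frechet_derivative \<phi> (at y) v = (\<Sum>i\<in>UNIV. v $ i * g i y)" if "y \<in> U" for y v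
  proof -
    have lin: "linear (frechet_derivative \<phi> (at y))" by (rule linear_frechet_derivative[OF diff[OF that]])
    have "v = (\<Sum>i\<in>UNIV. v $ i *\<^sub>R axis i 1)" using basis_expansion[of v] by (simp add: scalar_mult_eq_scaleR)
    then have "frechet_derivative \<phi> (at y) v = frechet_derivative \<phi> (at y) (\<Sum>i\<in>UNIV. v $ i *\<^sub>R axis i 1)" by simp
    also have "\<dots> = (\<Sum>i\<in>UNIV. v $ i * g i y)"
      by (simp add: linear_sum[OF lin] linear_cmul[OF lin] g_def)
    finally show ?thesis .
  qed
  have phic: "continuous_on U \<phi>" using diff differentiable_imp_continuous_within[of \<phi> _ UNIV]
    by (meson continuous_at_imp_continuous_on)
  \<comment> \<open>A frontier point is outside the open set \<open>D\<close>, so \<phi> is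
    nonnegative there; were it positive, a whole neighbourhood would miss \<open>D\<close>.\<close>
  have zero: "\<phi> y = 0" if y: "y \<in> frontier D" "y \<in> U" for y
  proof -
    have "y \<notin> D" using y D(1) by (simp add: frontier_def interior_open)
    then have ge: "\<phi> y \<ge> 0" using DU y by force
    have "\<not> \<phi> y > 0"
    proof
      assume "\<phi> y > 0"
      then have "open (U \<inter> \<phi> -` {0<..})" "y \<in> U \<inter> \<phi> -` {0<..}"
        using continuous_on_open_vimage[OF U(1), of \<phi>] phic y(2) by (auto simp: Int_commute)
      moreover have "y \<in> closure D" using y by (simp add: frontier_def)
      ultimately have "D \<inter> (U \<inter> \<phi> -` {0<..}) \<noteq> {}" using open_Int_closure_eq_empty by blast
      then show False using DU by force
    qed
    then show ?thesis using ge by simp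
  qed
  obtain h where "frechet_derivative \<phi> (at x) h \<noteq> 0" using crit U(2) by blast
  then have "(\<Sum>i\<in>UNIV. h $ i * g i x) \<noteq> 0" by (simp add: fd[OF U(2)])
  then obtain b where "h $ b * g b x \<noteq> 0" by (rule sum.not_neutral_contains_not_neutral)
  then have b: "g b x \<noteq> 0" by simp
  \<comment> \<open>Half the modulus of the nonzero derivative at \<open>x\<close>, and one more
    than the sum of all moduli there: by continuity both strict bounds persist on a ball.\<close>
  define m where "m = \<bar>g b x\<bar> / 2"
  define B where "B = (\<Sum>i\<in>UNIV. \<bar>g i x\<bar>) + 1"
  have m: "m > 0" using b by (simp add: m_def)
  obtain e where e: "e > 0" "ball x e \<subseteq> U" and gb: "\<And>y. y \<in> ball x e \<Longrightarrow> \<bar>g b y\<bar> \<ge> m"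
    and gB: "\<And>y i. y \<in> ball x e \<Longrightarrow> \<bar>g i y\<bar> \<le> B"
  proof -
    have "open (U \<inter> (\<lambda>y. \<bar>g b y\<bar>) -` {m<..})" "open (U \<inter> (\<lambda>y. \<Sum>i\<in>UNIV. \<bar>g i y\<bar>) -` {..<B})"
      by (intro continuous_open_preimage U(1) continuous_intros gc open_greaterThan open_lessThan)+
    moreover have "U \<inter> (\<lambda>y. \<bar>g b y\<bar>) -` {m<..} = {y \<in> U. \<bar>g b y\<bar> > m}"
      "U \<inter> (\<lambda>y. \<Sum>i\<in>UNIV. \<bar>g i y\<bar>) -` {..<B} = {y \<in> U. (\<Sum>i\<in>UNIV. \<bar>g i y\<bar>) < B}" by auto
    ultimately have o1: "open {y \<in> U. \<bar>g b y\<bar> > m}" and o2: "open {y \<in> U. (\<Sum>i\<in>UNIV. \<bar>g i y\<bar>) < B}" by simp_all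
    have "x \<in> {y \<in> U. \<bar>g b y\<bar> > m} \<inter> {y \<in> U. (\<Sum>i\<in>UNIV. \<bar>g i y\<bar>) < B}"
      using U b by (simp add: m_def B_def)
    then obtain e where e: "e > 0" "ball x e \<subseteq> {y \<in> U. \<bar>g b y\<bar> > m} \<inter> {y \<in> U. (\<Sum>i\<in>UNIV. \<bar>g i y\<bar>) < B}"
      using openE[OF open_Int[OF o1 o2]] by blast
    show ?thesis
    proof (rule that[OF e(1)])
      show "ball x e \<subseteq> U" "\<And>y. y \<in> ball x e \<Longrightarrow> \<bar>g b y\<bar> \<ge> m" using e(2) by (force simp: less_imp_le)+
      fix y i assume "y \<in> ball x e"
      then have "(\<Sum>i\<in>UNIV. \<bar>g i y\<bar>) < B" using e(2) by blast
      then show "\<bar>g i y\<bar> \<le> B" using member_le_sum[of i UNIV "\<lambda>i. \<bar>g i y\<bar>"] by auto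
    qed
  qed
  have B: "B > 0" unfolding B_def by (intro add_nonneg_pos sum_nonneg) auto
  let ?V = "frontier D \<inter> ball x e"
  \<comment> \<open>The 1 stands for the two free coordinates in the l1 norm, and B / m bounds the
    slope of the coordinate \<open>b\<close> over them.\<close>
  define L where "L = 1 + B / m"
  have L: "L \<ge> 0" using B m by (simp add: L_def)
  have lip: "norm (y - z) \<le> L * (\<Sum>i\<in>UNIV - {b}. \<bar>y $ i - z $ i\<bar>)" if y: "y \<in> ?V" and z: "z \<in> ?V" for y z
  proof -
    have seg: "closed_segment z y \<subseteq> ball x e" using y z by (intro closed_segment_subset) auto
    \<comment> \<open>The mean value theorem on the segment between two zeros, which stays in the
      convex ball, yields a point where the derivative along \<open>y - z\<close> vanishes.\<close>
    have "\<exists>s\<in>{0..1}. \<phi> (z + 1 *\<^sub>R (y - z)) - \<phi> (z + 0 *\<^sub>R (y - z)) = (1 - 0) * frechet_derivative \<phi> (at (z + s *\<^sub>R (y - z))) (y - z)"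
    proof -
      have "\<exists>s. 0 < s \<and> s < 1 \<and> \<phi> (z + 1 *\<^sub>R (y - z)) - \<phi> (z + 0 *\<^sub>R (y - z)) = (1 - 0) * frechet_derivative \<phi> (at (z + s *\<^sub>R (y - z))) (y - z)"
      proof (rule MVT2[where f = "\<lambda>s. \<phi> (z + s *\<^sub>R (y - z))"])
        fix s :: real assume s: "0 \<le> s" "s \<le> 1"
        have "z + s *\<^sub>R (y - z) \<in> closed_segment z y" using s by (auto simp: in_segment algebra_simps intro!: exI[of _ s])
        then have "z + s *\<^sub>R (y - z) \<in> U" using seg e(2) by blast
        note d = diff[OF this]
        have "(\<phi> \<circ> (\<lambda>s. z + s *\<^sub>R (y - z)) has_derivative frechet_derivative \<phi> (at (z + s *\<^sub>R (y - z))) \<circ> (\<lambda>t. t *\<^sub>R (y - z))) (at s)"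
          using d by (intro diff_chain_at) (auto intro!: derivative_eq_intros simp: frechet_derivative_works)
        moreover have "frechet_derivative \<phi> (at (z + s *\<^sub>R (y - z))) \<circ> (\<lambda>t. t *\<^sub>R (y - z)) = (*) (frechet_derivative \<phi> (at (z + s *\<^sub>R (y - z))) (y - z))"
          using linear_cmul[OF linear_frechet_derivative[OF d]] by (auto simp: fun_eq_iff mult.commute)
        ultimately show "((\<lambda>s. \<phi> (z + s *\<^sub>R (y - z))) has_real_derivative frechet_derivative \<phi> (at (z + s *\<^sub>R (y - z))) (y - z)) (at s)"
          by (simp add: has_field_derivative_def o_def)
      qed simp
      then show ?thesis by force
    qed
    then obtain s where s: "s \<in> {0..1}" and eq: "\<phi> y - \<phi> z = frechet_derivative \<phi> (at (z + s *\<^sub>R (y - z))) (y - z)" by auto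
    define u where "u = z + s *\<^sub>R (y - z)"
    have "u \<in> closed_segment z y" using s unfolding u_def by (auto simp: in_segment algebra_simps intro!: exI[of _ s])
    then have u: "u \<in> ball x e" using seg by blast
    have "(\<Sum>i\<in>UNIV. (y - z) $ i * g i u) = 0"
    proof -
      have "u \<in> U" "y \<in> U" "z \<in> U" using e(2) u y z by blast+
      then have "\<phi> y = 0" "\<phi> z = 0" using zero y z by auto
      then have "frechet_derivative \<phi> (at u) (y - z) = 0" using eq unfolding u_def[symmetric] by simp
      then show ?thesis by (simp only: fd[OF \<open>u \<in> U\<close>])
    qed
    then have "(y - z) $ b * g b u = - (\<Sum>i\<in>UNIV - {b}. (y - z) $ i * g i u)"
      by (subst (asm) sum.remove[of _ b]) auto
    then have "\<bar>(y - z) $ b\<bar> * \<bar>g b u\<bar> = \<bar>\<Sum>i\<in>UNIV - {b}. (y - z) $ i * g i u\<bar>" by (metis abs_minus_cancel abs_mult)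
    also have "\<dots> \<le> (\<Sum>i\<in>UNIV - {b}. \<bar>(y - z) $ i * g i u\<bar>)" by (rule sum_abs)
    also have "\<dots> \<le> (\<Sum>i\<in>UNIV - {b}. B * \<bar>y $ i - z $ i\<bar>)"
      using gB[OF u] by (intro sum_mono) (auto simp: abs_mult mult.commute[of B] intro!: mult_left_mono)
    finally have "\<bar>(y - z) $ b\<bar> * \<bar>g b u\<bar> \<le> B * (\<Sum>i\<in>UNIV - {b}. \<bar>y $ i - z $ i\<bar>)" by (simp add: sum_distrib_left)
    moreover have "\<bar>(y - z) $ b\<bar> * m \<le> \<bar>(y - z) $ b\<bar> * \<bar>g b u\<bar>" using gb[OF u] by (intro mult_left_mono) auto
    ultimately have yb: "\<bar>y $ b - z $ b\<bar> \<le> B / m * (\<Sum>i\<in>UNIV - {b}. \<bar>y $ i - z $ i\<bar>)"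
      using m by (simp add: divide_simps mult_ac)
    have "norm (y - z) \<le> (\<Sum>i\<in>UNIV. \<bar>(y - z) $ i\<bar>)" by (rule norm_le_l1_cart)
    also have "\<dots> = \<bar>y $ b - z $ b\<bar> + (\<Sum>i\<in>UNIV - {b}. \<bar>y $ i - z $ i\<bar>)"
      by (subst sum.remove[of _ b]) auto
    finally show ?thesis using yb by (simp add: L_def algebra_simps)
  qed
  define M where "M = norm x + e"
  have M: "M > 0" using e by (simp add: M_def add_nonneg_pos)
  have "?V \<subseteq> cbox (vec (-M)) (vec M)"
  proof
    fix y assume "y \<in> ?V"
    then have "norm y \<le> M" using norm_triangle_sub[of y x] by (simp add: M_def dist_norm norm_minus_commute)
    then have "\<bar>y $ i\<bar> \<le> M" for i using component_le_norm_cart[of y i] by simp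
    then show "y \<in> cbox (vec (-M)) (vec M)" by (simp add: mem_box_cart abs_le_iff minus_le_iff)
  qed
  from hausdorff2_outer_Lipschitz_graph[OF this M L lip] show ?thesis
    using e(1) by (intro exI[of _ e]) (auto intro: order_le_less_trans)
qed

text \<open>The frontier of a bounded set is compact, so finitely many of the balls with finite
  outer measure cover it.\<close>

lemma surface_measure_finite:
  assumes D: "open D" "bounded D" "smooth_boundary D"
  shows "finite_measure (surface_measure (frontier D))"
proof -
  let ?\<mu> = "measure_of UNIV (sets borel) hausdorff2_outer :: (real^3) measure"
  have sets: "sets ?\<mu> = sets borel"
    using sets.sigma_sets_eq[of borel] by (simp add: sets_measure_of)
  \<comment> \<open>\<open>measure_of\<close> gives the zero measure if its argument is not countably additive, so additivity of
    \<open>hausdorff2_outer\<close> is not needed here.\<close>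
  have le: "emeasure ?\<mu> A \<le> hausdorff2_outer A" for A
  proof -
    have "emeasure ?\<mu> A = hausdorff2_outer A \<or> emeasure ?\<mu> A = 0"
      unfolding emeasure_measure_of_conv by auto
    then show ?thesis by auto
  qed
  have "compact (frontier D)" using D(2) by (simp add: compact_frontier_bounded)
  have "\<forall>x\<in>frontier D. \<exists>e>0. hausdorff2_outer (frontier D \<inter> ball x e) < \<infinity>"
    using smooth_boundary_local_finite[OF D(1,3)] by blast
  then obtain e where e: "\<And>x. x \<in> frontier D \<Longrightarrow> e x > 0 \<and> hausdorff2_outer (frontier D \<inter> ball x (e x)) < \<infinity>" by metis
  obtain F where F: "F \<subseteq> frontier D" "finite F" "frontier D \<subseteq> (\<Union>x\<in>F. ball x (e x))"
    using compactE_image[OF \<open>compact (frontier D)\<close>, of "frontier D" "\<lambda>x. ball x (e x)"] e by force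
  have "emeasure ?\<mu> (frontier D) \<le> emeasure ?\<mu> (\<Union>x\<in>F. frontier D \<inter> ball x (e x))"
    using F by (intro emeasure_mono) (auto simp: sets intro!: sets.finite_UN)
  also have "\<dots> \<le> (\<Sum>x\<in>F. emeasure ?\<mu> (frontier D \<inter> ball x (e x)))"
    using F by (intro emeasure_subadditive_finite) (auto simp: sets)
  also have "\<dots> < \<infinity>"
    using F e by (auto simp: ennreal_sum_less_top intro: order_le_less_trans[OF le])
  finally have fin: "emeasure ?\<mu> (frontier D) < \<infinity>" .
  show ?thesis
    unfolding surface_measure_def
  proof
    show "emeasure (restrict_space ?\<mu> (frontier D)) (space (restrict_space ?\<mu> (frontier D))) \<noteq> \<infinity>"
      using fin by (simp add: space_restrict_space emeasure_restrict_space sets)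
  qed
qed

section \<open>Surface operators\<close>

lemma space_surface_measure [simp]: "space (surface_measure S) = S"
  by (simp add: surface_measure_def space_restrict_space)

lemma measurable_ident_surface_measure: "(\<lambda>y. y) \<in> measurable (surface_measure S) borel"
proof -
  have "sets (measure_of UNIV (sets borel) hausdorff2_outer) = sets (borel :: (real^3) measure)"
    using sets.sigma_sets_eq[of borel] by (simp add: sets_measure_of)
  then show ?thesis
    unfolding surface_measure_def by (intro measurable_restrict_space1 measurable_ident_sets)
qed

text \<open>Cauchy-Schwarz against the constant 1: the integral of the square of |f| - a is a
  quadratic in \<open>a\<close> that is nonnegative for every real \<open>a\<close>.\<close>

lemma L2_on_integrable:
  assumes "finite_measure (surface_measure S)" and f: "L2_on S f"
  shows "integrable (surface_measure S) f"
    and "(LINT x|surface_measure S. cmod (f x)) \<le> sqrt (measure (surface_measure S) S) * L2_norm_on S f"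
proof -
  let ?M = "surface_measure S"
  interpret finite_measure ?M by fact
  have [measurable]: "f \<in> borel_measurable ?M" and i2: "integrable ?M (\<lambda>x. (cmod (f x))\<^sup>2)"
    using f by (auto simp: L2_on_def)
  show i: "integrable ?M f"
  proof (rule Bochner_Integration.integrable_bound[where f = "\<lambda>x. 1 + (cmod (f x))\<^sup>2"])
    have "y \<le> 1 + y\<^sup>2" for y :: real
      using zero_le_power2[of "y - 1/2"] by (simp add: power2_eq_square algebra_simps)
    then show "AE x in ?M. norm (f x) \<le> norm (1 + (cmod (f x))\<^sup>2)" by (intro AE_I2) simp
  qed (use i2 in auto)
  define \<mu> where "\<mu> = measure ?M S"
  define I where "I = (LINT x|?M. cmod (f x))"
  define J where "J = (LINT x|?M. (cmod (f x))\<^sup>2)"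
  have I0: "I \<ge> 0" unfolding I_def by (intro Bochner_Integration.integral_nonneg) auto
  have q: "0 \<le> J - 2 * a * I + a\<^sup>2 * \<mu>" for a
  proof -
    have "0 \<le> (LINT x|?M. (cmod (f x) - a)\<^sup>2)" by (intro Bochner_Integration.integral_nonneg) auto
    also have "\<dots> = (LINT x|?M. (cmod (f x))\<^sup>2 - 2 * a * cmod (f x) + a\<^sup>2)"
      by (intro Bochner_Integration.integral_cong) (auto simp: power2_diff)
    also have "\<dots> = J - 2 * a * I + a\<^sup>2 * \<mu>"
      using i i2 by (simp add: J_def I_def \<mu>_def)
    finally show ?thesis .
  qed
  have "I\<^sup>2 \<le> \<mu> * J"
  proof (cases "\<mu> = 0")
    case True
    have "I = 0"
    proof (rule ccontr)
      assume "I \<noteq> 0"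
      \<comment> \<open>With measure 0 the quadratic is affine in \<open>a\<close>, and this
        argument gives it the value -1.\<close>
      then show False using q[of "(J + 1) / (2 * I)"] True by simp
    qed
    then show ?thesis using True by simp
  next
    case False
    then have "\<mu> > 0" by (simp add: \<mu>_def zero_less_measure_iff)
    \<comment> \<open>The minimum of the quadratic.\<close>
    then show ?thesis using q[of "I / \<mu>"] by (simp add: field_simps power2_eq_square)
  qed
  then have "I \<le> sqrt (\<mu> * J)" using I0 by (simp add: real_le_rsqrt)
  then show "(LINT x|?M. cmod (f x)) \<le> sqrt (measure ?M S) * L2_norm_on S f"
    by (simp add: I_def \<mu>_def J_def L2_norm_on_def real_sqrt_mult)
qed

text \<open>Only values of the kernels at differences of points of \<open>S\<close> enter. Passing
  from the L1 to the L2 norm costs the root of the area once for \<open>f\<close> and once for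
  \<open>g\<close>, which gives the full area.\<close>

lemma pairing_operator_difference:
  assumes fin: "finite_measure (surface_measure S)"
    and S: "\<And>x y i. x \<in> S \<Longrightarrow> y \<in> S \<Longrightarrow> \<bar>(x - y) $ i\<bar> < 1"
    and K1: "cube_bounded K1" and K2: "cube_bounded K2"
    and B: "\<And>r. (\<And>i. \<bar>r $ i\<bar> < 1) \<Longrightarrow> cmod (K1 r - K2 r) \<le> B" and B0: "B \<ge> 0"
    and f: "L2_on S f" and g: "L2_on S g"
  shows "cmod (pairing S f (\<lambda>x. surface_operator S K1 g x - surface_operator S K2 g x)) \<le>
     B * measure (surface_measure S) S * L2_norm_on S f * L2_norm_on S g"
proof -
  let ?M = "surface_measure S"
  let ?N = "\<lambda>f. sqrt (measure ?M S) * L2_norm_on S f"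
  note gi = L2_on_integrable[OF fin g] and fi = L2_on_integrable[OF fin f]
  have gm [measurable]: "g \<in> borel_measurable ?M" using gi by auto
  have N0: "?N f \<ge> 0" for f by (simp add: L2_norm_on_def Bochner_Integration.integral_nonneg)
  have Ki: "integrable ?M (\<lambda>y. K (x - y) * g y)" if K: "cube_bounded K" and x: "x \<in> S" for K x
  proof -
    obtain k where k: "\<And>r. r \<in> cube \<Longrightarrow> cmod (K r) \<le> k" and Km: "K \<in> borel_measurable borel"
      using K by (auto simp: cube_bounded_def)
    have m: "(\<lambda>y. K (x - y)) \<in> borel_measurable ?M"
      by (rule measurable_compose[OF measurable_ident_surface_measure[of S]]) (use Km in measurable)
    show ?thesis
    proof (rule Bochner_Integration.integrable_bound[where f = "\<lambda>y. \<bar>k\<bar> * cmod (g y)"])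
      show "integrable ?M (\<lambda>y. \<bar>k\<bar> * cmod (g y))" using gi(1) by (intro integrable_mult_right integrable_norm)
      show "AE y in ?M. norm (K (x - y) * g y) \<le> norm (\<bar>k\<bar> * cmod (g y))"
      proof (rule AE_I2)
        fix y assume "y \<in> space ?M"
        then have "\<forall>i. \<bar>(x - y) $ i\<bar> < 1" using S x by simp
        then have "x - y \<in> cube" by (rule mem_cubeI)
        then have "cmod (K (x - y)) \<le> \<bar>k\<bar>" using k[of "x - y"] by simp
        then show "norm (K (x - y) * g y) \<le> norm (\<bar>k\<bar> * cmod (g y))" by (simp add: norm_mult mult_right_mono)
      qed
    qed (use m in measurable)
  qed
  let ?h = "\<lambda>x. surface_operator S K1 g x - surface_operator S K2 g x"
  have h: "cmod (?h x) \<le> B * ?N g" if x: "x \<in> S" for x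
  proof -
    have "?h x = (LINT y|?M. (K1 (x - y) - K2 (x - y)) * g y)"
      unfolding surface_operator_def left_diff_distrib
      by (rule Bochner_Integration.integral_diff[symmetric]) (intro Ki K1 K2 x)+
    also have "cmod \<dots> \<le> (LINT y|?M. cmod ((K1 (x - y) - K2 (x - y)) * g y))" by (rule integral_norm_bound)
    also have "\<dots> \<le> (LINT y|?M. B * cmod (g y))"
    proof (rule integral_mono')
      show "integrable ?M (\<lambda>y. B * cmod (g y))" using gi(1) by (intro integrable_mult_right integrable_norm)
      fix y assume "y \<in> space ?M"
      then have "cmod (K1 (x - y) - K2 (x - y)) \<le> B" using S x by (intro B) simp
      then show "cmod ((K1 (x - y) - K2 (x - y)) * g y) \<le> B * cmod (g y)" by (simp add: norm_mult mult_right_mono)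
    qed (use B0 in simp)
    also have "\<dots> = B * (LINT y|?M. cmod (g y))" by simp
    also have "\<dots> \<le> B * ?N g" using gi(2) B0 by (intro mult_left_mono)
    finally show ?thesis .
  qed
  have "cmod (pairing S f ?h) \<le> (LINT x|?M. cmod (f x * ?h x))"
    unfolding pairing_def by (rule integral_norm_bound)
  \<comment> \<open>\<open>integral_mono'\<close> asks for integrability of the nonnegative majorant
    alone; a left side that failed to be integrable would have integral 0.\<close>
  also have "\<dots> \<le> (LINT x|?M. cmod (f x) * (B * ?N g))"
  proof (rule integral_mono')
    show "integrable ?M (\<lambda>x. cmod (f x) * (B * ?N g))" using fi(1) by (intro integrable_mult_left integrable_norm)
    show "cmod (f x * ?h x) \<le> cmod (f x) * (B * ?N g)" if "x \<in> space ?M" for x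
      using h that by (simp only: norm_mult space_surface_measure mult_left_mono norm_ge_zero)
    show "0 \<le> cmod (f x) * (B * ?N g)" for x by (rule mult_nonneg_nonneg[OF norm_ge_zero mult_nonneg_nonneg[OF B0 N0]])
  qed
  also have "\<dots> = (LINT x|?M. cmod (f x)) * (B * ?N g)" by (rule integral_mult_left_zero)
  also have "\<dots> \<le> ?N f * (B * ?N g)" by (rule mult_right_mono[OF fi(2) mult_nonneg_nonneg[OF B0 N0]])
  also have "\<dots> = B * (sqrt (measure ?M S) * sqrt (measure ?M S)) * L2_norm_on S f * L2_norm_on S g" by (simp only: mult_ac)
  finally show ?thesis by simp
qed

lemma cube_bounded_truncation: "cube_bounded (fourier_truncation N F)"
  unfolding fourier_truncation_box[abs_def] by (intro cube_bounded_intros)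

theorem theorem5p4:
  fixes D S :: "(real^3) set" and d :: real and chi :: "real^3 \<Rightarrow> real"
    and q :: nat and a :: "nat \<Rightarrow> complex" and w :: "nat \<Rightarrow> real" and C\<^sub>H :: real
    and H :: "complex \<Rightarrow> complex"
    and \<kappa>\<^sub>0 \<gamma> \<theta> :: real
  assumes "open D" and "bounded D" and "smooth_boundary D" and "S = frontier D"
    and "0 < d" and "d < 1" and "S \<subseteq> cbox (vec 0) (vec (1 - d))"
    and "C_n_on 3 chi UNIV"
    and "\<forall>r \<in> cbox (vec (-1 + d)) (vec (1 - d)). chi r = 1"
    and "\<forall>r. r \<notin> cbox (vec (-1)) (vec 1) \<longrightarrow> chi r = 0"
    and "q \<ge> 1" and "\<forall>k\<in>{1..q}. w k \<noteq> 0"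
    and "H = rational_filter q a w"
    and "H 0 = 1"
    and "\<forall>z::real. z > 0 \<longrightarrow> cmod (H (of_real z)) \<le> C\<^sub>H * min 1 (1 / z ^ q)"
    and "\<kappa>\<^sub>0 > 0" and "\<gamma> > 0" and "0 < \<theta>" and "\<theta> < 1"
  shows "\<exists>c::real. \<forall>(\<kappa>::real) (\<delta>::real) (N::nat) (m::nat) f g.
    \<kappa> \<ge> \<kappa>\<^sub>0 \<and> \<gamma> \<le> \<delta> * \<kappa>\<^sup>2 \<and> \<delta> * \<kappa>\<^sup>2 \<le> \<theta> * Min ((\<lambda>k. (w k)\<^sup>2) ` {1..q}) \<and>
    N > 0 \<and> truncation_ratio \<delta> \<kappa> N < 1 \<and> 0 < m \<and> m < q \<and> L2_on S f \<and> L2_on S g \<longrightarrow>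
    cmod (pairing S f (\<lambda>x.
        surface_operator S (cutoff_kernel chi H \<delta> \<kappa>) g x -
        surface_operator S (fourier_truncation N (cutoff_kernel chi H \<delta> \<kappa>)) g x))
    \<le> c * ((real m)\<^sup>2 * real N powr (3/2) * truncation_ratio \<delta> \<kappa> N ^ m + real N powr (-1/2)) *
       L2_norm_on S f * L2_norm_on S g"
proof (cases "q \<ge> 2")
  case False
  then have "\<And>m::nat. 0 < m \<Longrightarrow> \<not> m < q" by simp
  then show ?thesis by blast
next
  case q2: True
  interpret filtered_cutoff q a w C\<^sub>H \<kappa>\<^sub>0 \<gamma> \<theta> H chi
    by unfold_locales (use assms in \<open>auto simp: cube_def\<close>)
  have fin: "finite_measure (surface_measure S)"
    using surface_measure_finite[OF assms(1-3)] assms(4) by simp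
  \<comment> \<open>The margin \<open>d\<close> puts all differences into the open cube, where the
    pointwise bounds on the truncation error are available.\<close>
  have S: "\<bar>(x - y) $ i\<bar> < 1" if "x \<in> S" "y \<in> S" for x y i
  proof -
    have "x \<in> cbox (vec 0) (vec (1 - d))" "y \<in> cbox (vec 0) (vec (1 - d))" using that assms(7) by auto
    then have "0 \<le> x $ i" "x $ i \<le> 1 - d" "0 \<le> y $ i" "y $ i \<le> 1 - d" by (auto simp: mem_box_cart)
    then show ?thesis using \<open>0 < d\<close> by (simp add: abs_less_iff)
  qed
  let ?P = "filtered_kernel_params q a w C\<^sub>H \<kappa>\<^sub>0 \<gamma> \<theta> H"
  obtain c where c: "c \<ge> 0" and err: "\<And>\<kappa> \<delta> N. ?P \<kappa> \<delta> \<Longrightarrow> \<kappa> \<le> real N \<Longrightarrow> 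
     cube_bounded (cutoff_kernel chi H \<delta> \<kappa>) \<and>
     (\<forall>x. (\<forall>i. \<bar>x $ i\<bar> < 1) \<longrightarrow> cmod (truncation_error N (cutoff_kernel chi H \<delta> \<kappa>) x)
       \<le> c * (real N powr (3/2) * (\<kappa> / real N) ^ (q - 1) + real N powr (-1/2)))"
    using cutoff_kernel_truncation_error[OF q2] by blast
  define \<mu> where "\<mu> = measure (surface_measure S) S"
  show ?thesis
  proof (intro exI[of _ "c * \<mu>"] allI impI)
    fix \<kappa> \<delta> :: real and N m :: nat and f g
    assume A: "\<kappa> \<ge> \<kappa>\<^sub>0 \<and> \<gamma> \<le> \<delta> * \<kappa>\<^sup>2 \<and> \<delta> * \<kappa>\<^sup>2 \<le> \<theta> * Min ((\<lambda>k. (w k)\<^sup>2) ` {1..q}) \<and>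
      N > 0 \<and> truncation_ratio \<delta> \<kappa> N < 1 \<and> 0 < m \<and> m < q \<and> L2_on S f \<and> L2_on S g"
    interpret P: filtered_kernel_params q a w C\<^sub>H \<kappa>\<^sub>0 \<gamma> \<theta> H \<kappa> \<delta>
      by unfold_locales (use A in \<open>auto simp: wmin_def\<close>)
    let ?l = "truncation_ratio \<delta> \<kappa> N"
    let ?B = "c * (real N powr (3/2) * (\<kappa> / real N) ^ (q - 1) + real N powr (-1/2))"
    let ?B' = "c * ((real m)\<^sup>2 * real N powr (3/2) * ?l ^ m + real N powr (-1/2))"
    have t0: "0 < \<kappa> / real N" using A P.\<kappa>_pos by simp
    \<comment> \<open>Dropping the 1 from the numerator under the root leaves exactly \<kappa> /
      N.\<close>
    have "\<kappa> / real N \<le> ?l"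
      unfolding truncation_ratio_def
    proof (rule real_le_rsqrt)
      have "(\<kappa> / real N)\<^sup>2 = (\<delta> * \<kappa>\<^sup>2) / (\<delta> * (real N)\<^sup>2)" using P.\<delta>_pos by (simp add: power_divide)
      also have "\<dots> \<le> (1 + (sqrt \<delta> * \<kappa>)\<^sup>2) / (\<delta> * (real N)\<^sup>2)"
        using P.\<delta>_pos A by (intro divide_right_mono) (auto simp: power_mult_distrib)
      finally show "(\<kappa> / real N)\<^sup>2 \<le> (1 + (sqrt \<delta> * \<kappa>)\<^sup>2) / (\<delta> * (real N)\<^sup>2)" .
    qed
    moreover have l1: "?l < 1" using A by blast
    ultimately have l: "\<kappa> / real N \<le> ?l" "?l < 1" "\<kappa> / real N < 1" by linarith+
    have N: "\<kappa> \<le> real N" using l(3) A by (simp add: divide_simps)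
    \<comment> \<open>The exponent m enters only here: m \<le> q - 1 and \<lambda> < 1 give the
      power, and m \<ge> 1 gives the factor m^2.\<close>
    have "(\<kappa> / real N) ^ (q - 1) \<le> ?l ^ (q - 1)" using t0 l by (intro power_mono) auto
    also have "\<dots> \<le> ?l ^ m" using A t0 l by (intro power_decreasing) auto
    finally have "(\<kappa> / real N) ^ (q - 1) \<le> ?l ^ m" .
    moreover have "1 \<le> (real m)\<^sup>2" using A by simp
    ultimately have "1 * (\<kappa> / real N) ^ (q - 1) \<le> (real m)\<^sup>2 * ?l ^ m" using t0 by (intro mult_mono) auto
    then have "real N powr (3/2) * (\<kappa> / real N) ^ (q - 1) \<le> real N powr (3/2) * ((real m)\<^sup>2 * ?l ^ m)"
      by (intro mult_left_mono) auto
    then have BB: "?B \<le> ?B'" using c by (intro mult_left_mono) (auto simp: mult_ac)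
    have "cmod (pairing S f (\<lambda>x. surface_operator S (cutoff_kernel chi H \<delta> \<kappa>) g x -
        surface_operator S (fourier_truncation N (cutoff_kernel chi H \<delta> \<kappa>)) g x)) \<le> ?B' * \<mu> * L2_norm_on S f * L2_norm_on S g"
      unfolding \<mu>_def
    proof (rule pairing_operator_difference[OF fin S _ cube_bounded_truncation])
      show "cube_bounded (cutoff_kernel chi H \<delta> \<kappa>)"
        using err[OF P.filtered_kernel_params_axioms N] by blast
      show "cmod (cutoff_kernel chi H \<delta> \<kappa> r - fourier_truncation N (cutoff_kernel chi H \<delta> \<kappa>) r) \<le> ?B'"
        if "\<And>i. \<bar>r $ i\<bar> < 1" for r
        using err[OF P.filtered_kernel_params_axioms N] that BB unfolding truncation_error_def by (meson order_trans)
      show "?B' \<ge> 0" using c t0 l by (intro mult_nonneg_nonneg add_nonneg_nonneg) auto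
    qed (use A in auto)
    then show "cmod (pairing S f (\<lambda>x. surface_operator S (cutoff_kernel chi H \<delta> \<kappa>) g x -
        surface_operator S (fourier_truncation N (cutoff_kernel chi H \<delta> \<kappa>)) g x)) \<le>
        c * \<mu> * ((real m)\<^sup>2 * real N powr (3/2) * ?l ^ m + real N powr (-1/2)) * L2_norm_on S f * L2_norm_on S g"
      by (simp only: mult_ac)
  qed
qed

end
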